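(* Let $\Omega\subset\mathbb{R}^2$ be a bounded domain, $T>0$, and let $K=\{(\rho,u,m)\in\mathbb{R}\times\mathbb{R}^2\times\mathbb{R}^2:\ |\rho|=1,\ m=\tfrac12\rho u\}$ with $\Lambda$-convex hull $K^\Lambda$, where $\Lambda=\{(\rho,u,m):\ |\rho|^2=|u|^2\}$. Say that a set $S\subset\mathbb{R}\times\mathbb{R}^2\times\mathbb{R}^2$ is stable under weak convergence if the following holds: whenever $(\rho_k,u_k,m_k)\in L^\infty\times L^2\times L^2$ (on $\Omega\times(0,T)$) is a sequence of weak solutions of the linear system $$\partial_t\rho+\operatorname{div} m=0,\qquad \operatorname{div}(u-(0,\rho))=0,\qquad \operatorname{curl}(u+(0,\rho))=0$$ such that $(\rho_k,u_k,m_k)\in S$ for a.e. $(x,t)$, and $(\rho_k,u_k,m_k)\rightharpoonup(\rho,u,m)$ weakly in $L^2$, then $(\rho,u,m)\in S$ for a.e. $(x,t)$. Then $K^\Lambda$ is stable under weak convergence. Moreover, $K^\Lambda$ is the smallest set containing $K$ that is stable under weak convergence.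
   Context: A function $f:\mathbb{R}\times\mathbb{R}^2\times\mathbb{R}^2\to\mathbb{R}$ is $\Lambda$-convex if $s\mapsto f(w_0+sw)$ is convex for all $w_0$ and all $w\in\Lambda$. For a closed set $K$, the $\Lambda$-convex hull $K^\Lambda$ is defined by: $z\notin K^\Lambda$ if and only if there is a $\Lambda$-convex $f$ with $f\le0$ on $K$ and $f(z)>0$. Here $\operatorname{div}$ and $\operatorname{curl}$ are taken in the spatial variable $x\in\Omega\subset\mathbb{R}^2$, with $\operatorname{curl}u=\partial_1u_2-\partial_2u_1$; weak solution means solution in the sense of distributions on $\Omega\times(0,T)$. *)

theory Defs
  imports "HOL-Analysis.Analysis"
begin

text \<open>A state is a triple \<open>(\<rho>, u, m)\<close>; a space-time point is a pair \<open>(x, t)\<close>.\<close>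

type_synonym state = "real \<times> (real ^ 2) \<times> (real ^ 2)"
type_synonym spacetime = "(real ^ 2) \<times> real"


subsection \<open>Lambda-convexity and the Lambda-convex hull\<close>

definition Lambda_convex :: "state set \<Rightarrow> (state \<Rightarrow> real) \<Rightarrow> bool" where
  "Lambda_convex \<Lambda> f \<longleftrightarrow>
     (\<forall>w0. \<forall>w\<in>\<Lambda>. convex_on UNIV (\<lambda>s::real. f (w0 + s *\<^sub>R w)))"

definition Lambda_hull :: "state set \<Rightarrow> state set \<Rightarrow> state set" where
  "Lambda_hull \<Lambda> K =
     {z. \<not> (\<exists>f. Lambda_convex \<Lambda> f \<and> (\<forall>y\<in>K. f y \<le> 0) \<and> f z > 0)}"

definition wave_cone :: "state set" where
  "wave_cone = {(\<rho>, u, m). \<bar>\<rho>\<bar>\<^sup>2 = (norm u)\<^sup>2}"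

definition constraint_set :: "state set" where
  "constraint_set = {(\<rho>, u, m). \<bar>\<rho>\<bar> = 1 \<and> m = ((1/2) * \<rho>) *\<^sub>R u}"


subsection \<open>Distributional solutions\<close>

primrec Ck :: "nat \<Rightarrow> ('a::euclidean_space \<Rightarrow> real) \<Rightarrow> bool" where
  "Ck 0 \<phi> \<longleftrightarrow> continuous_on UNIV \<phi>"
| "Ck (Suc n) \<phi> \<longleftrightarrow>
     \<phi> differentiable_on UNIV \<and>
     (\<forall>b\<in>Basis. Ck n (\<lambda>z. frechet_derivative \<phi> (at z) b))"

definition test_functions :: "('a::euclidean_space) set \<Rightarrow> ('a \<Rightarrow> real) set" where
  "test_functions Q =
     {\<phi>. (\<forall>n. Ck n \<phi>) \<and> compact (closure {z. \<phi> z \<noteq> 0}) \<and> closure {z. \<phi> z \<noteq> 0} \<subseteq> Q}"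

definition grad_x :: "(spacetime \<Rightarrow> real) \<Rightarrow> spacetime \<Rightarrow> real ^ 2" where
  "grad_x \<phi> z = (\<chi> i. frechet_derivative \<phi> (at z) (axis i 1, 0))"

definition deriv_t :: "(spacetime \<Rightarrow> real) \<Rightarrow> spacetime \<Rightarrow> real" where
  "deriv_t \<phi> z = frechet_derivative \<phi> (at z) (0, 1)"

text \<open>The three predicates below are the equations \<open>\<partial>\<^sub>t \<rho> + div m = 0\<close>, \<open>div v = 0\<close> and
  \<open>curl v = \<partial>\<^sub>1 v\<^sub>2 - \<partial>\<^sub>2 v\<^sub>1 = 0\<close> tested against \<open>\<phi>\<close>,
  with the derivatives moved onto \<open>\<phi>\<close> and the overall sign dropped.\<close>

definition weak_transport :: "spacetime set \<Rightarrow> (spacetime \<Rightarrow> real) \<Rightarrow> (spacetime \<Rightarrow> real ^ 2) \<Rightarrow> bool" where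
  "weak_transport Q \<rho> m \<longleftrightarrow> (\<forall>\<phi>\<in>test_functions Q.
     (LINT z|lebesgue_on Q. \<rho> z * deriv_t \<phi> z + m z \<bullet> grad_x \<phi> z) = 0)"

definition weak_div_free :: "spacetime set \<Rightarrow> (spacetime \<Rightarrow> real ^ 2) \<Rightarrow> bool" where
  "weak_div_free Q v \<longleftrightarrow> (\<forall>\<phi>\<in>test_functions Q.
     (LINT z|lebesgue_on Q. v z \<bullet> grad_x \<phi> z) = 0)"

definition weak_curl_free :: "spacetime set \<Rightarrow> (spacetime \<Rightarrow> real ^ 2) \<Rightarrow> bool" where
  "weak_curl_free Q v \<longleftrightarrow> (\<forall>\<phi>\<in>test_functions Q.
     (LINT z|lebesgue_on Q. v z $ 2 * grad_x \<phi> z $ 1 - v z $ 1 * grad_x \<phi> z $ 2) = 0)"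

definition weak_solution ::
    "spacetime set \<Rightarrow> (spacetime \<Rightarrow> real) \<Rightarrow> (spacetime \<Rightarrow> real ^ 2) \<Rightarrow> (spacetime \<Rightarrow> real ^ 2) \<Rightarrow> bool" where
  "weak_solution Q \<rho> u m \<longleftrightarrow>
     weak_transport Q \<rho> m \<and>
     weak_div_free Q (\<lambda>z. u z - vector [0, \<rho> z]) \<and>
     weak_curl_free Q (\<lambda>z. u z + vector [0, \<rho> z])"


subsection \<open>Function spaces and weak convergence\<close>

definition L2 :: "('a::euclidean_space) set \<Rightarrow> ('a \<Rightarrow> 'b::euclidean_space) set" where
  "L2 Q = {f. f \<in> borel_measurable (lebesgue_on Q) \<and>
              integrable (lebesgue_on Q) (\<lambda>z. (norm (f z))\<^sup>2)}"

definition Linfty :: "('a::euclidean_space) set \<Rightarrow> ('a \<Rightarrow> 'b::euclidean_space) set" where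
  "Linfty Q = {f. f \<in> borel_measurable (lebesgue_on Q) \<and>
                  (\<exists>C. AE z in lebesgue_on Q. norm (f z) \<le> C)}"

definition weakly_converges_L2 ::
    "('a::euclidean_space) set \<Rightarrow> (nat \<Rightarrow> 'a \<Rightarrow> 'b::euclidean_space) \<Rightarrow> ('a \<Rightarrow> 'b) \<Rightarrow> bool" where
  "weakly_converges_L2 Q F f \<longleftrightarrow>
     (\<forall>k. F k \<in> L2 Q) \<and> f \<in> L2 Q \<and>
     (\<forall>g\<in>L2 Q. (\<lambda>k. LINT z|lebesgue_on Q. F k z \<bullet> g z)
        \<longlonglongrightarrow> (LINT z|lebesgue_on Q. f z \<bullet> g z))"


subsection \<open>Stability under weak convergence\<close>

text \<open>The set \<open>S\<close> is arbitrary, possibly non-measurable: the statement that \<open>w z \<in> S\<close> for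
  almost every \<open>z\<close> means that it holds outside some null set.  The limit is only required
  to be in \<open>L2\<close>; its density component need not be essentially bounded.\<close>

definition weakly_stable :: "(real ^ 2) set \<Rightarrow> real \<Rightarrow> state set \<Rightarrow> bool" where
  "weakly_stable \<Omega> T S \<longleftrightarrow>
     (let Q = \<Omega> \<times> {0<..<T} in
      \<forall>(\<rho>s :: nat \<Rightarrow> spacetime \<Rightarrow> real) us ms \<rho> u m.
        (\<forall>k. \<rho>s k \<in> Linfty Q \<and> us k \<in> L2 Q \<and> ms k \<in> L2 Q) \<and>
        (\<forall>k. weak_solution Q (\<rho>s k) (us k) (ms k)) \<and>
        (\<forall>k. AE z in lebesgue_on Q. (\<rho>s k z, us k z, ms k z) \<in> S) \<and>
        weakly_converges_L2 Q (\<lambda>k z. (\<rho>s k z, us k z, ms k z)) (\<lambda>z. (\<rho> z, u z, m z))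
        \<longrightarrow> (AE z in lebesgue_on Q. (\<rho> z, u z, m z) \<in> S))"

end

theory Submission
  imports Defs
begin

text \<open>The hull is the set of states with \<open>m \<bullet> e - \<rho> (u \<bullet> e) / 2 + (\<rho>\<^sup>2 - 1) / 2 \<le> 0\<close> for all \<open>e\<close> in the
  unit disc, that is, \<open>\<bar>\<rho>\<bar> \<le> 1\<close> and \<open>\<bar>m - \<rho> u / 2\<bar> \<le> (1 - \<rho>\<^sup>2) / 2\<close>: these functions are convex along the
  wave cone and nonpositive on the constraint set, and conversely every such state is reached from
  the constraint set by two successive segments in wave-cone directions.

  Stability amounts to \<open>liminf \<integral> \<psi> r (r - v \<bullet> e) \<ge> 0\<close> for the differences \<open>(r, v, n)\<close> between the sequence
  and its weak limit. By the div-curl structure, \<open>\<bar>v\<bar>\<^sup>2 - r\<^sup>2\<close> is the product of a curl-free and a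
  divergence-free field in space. Time oscillations of \<open>v\<close> do not see this structure, so the argument is
  applied to spatial increments \<open>r(x, t) - r(x - y, t)\<close>: since the increment of a curl-free field is the
  gradient of a function of size \<open>O(y)\<close>, the product of increments integrates to \<open>O(y)\<close>. The mixed terms
  \<open>r(x - y, t) v(x, t)\<close>, averaged over small \<open>y\<close>, tend to zero because the transport equation makes
  spatial averages of \<open>r\<close> equicontinuous in time, hence strongly convergent.

  Minimality: a set that is stable under weak convergence is closed (use constant sequences) and, by
  rapidly oscillating plane waves with two values, closed under midpoints of wave-cone segments.\<close>

section \<open>Square-integrable functions\<close>

text \<open>For e in the unit disc the separating function is quadratic, so along a sequence it
  changes by weakly null linear terms plus half of r (r - v . e). Completing a square with |e| <= 1
  gives r (r - v . e) >= (r^2 - |v|^2) / 2, which is how the null Lagrangian enters. It cannot be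
  applied to the differences themselves: r = 0, n = 0 and v a function of t alone, oscillating
  weakly to zero, is a solution for which |v|^2 does not tend to zero although r (r - v . e) = 0.
  Spatial increments remove such v, at the price of the mixed terms. Compactness in time comes from
  a factor \<theta> on the time variable of the averaging kernel. At \<theta> = 0 only spatial
  shifts are averaged, where the increment estimate holds; at \<theta> > 0 the kernel is a
  square-integrable function of space-time, and weak convergence to zero gives pointwise
  convergence. The transport equation bounds the difference by a multiple of \<theta>, uniformly
  along the sequence. The constraint does not bound u, so the energy bounds come from weak
  convergence itself, by uniform boundedness.\<close>

definition square_integrable :: "'a measure \<Rightarrow> ('a \<Rightarrow> real) \<Rightarrow> bool" where
  "square_integrable M f \<longleftrightarrow> f \<in> borel_measurable M \<and> integrable M (\<lambda>x. (f x)\<^sup>2)"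

lemma square_integrableD: "square_integrable M f \<Longrightarrow> integrable M (\<lambda>x. (f x)\<^sup>2)"
  by (simp add: square_integrable_def)

lemma abs_mult_le_weighted_squares:
  fixes x y a :: real
  assumes "a > 0"
  shows "\<bar>x * y\<bar> \<le> a * x\<^sup>2 + y\<^sup>2 / a"
proof -
  have "0 \<le> (sqrt a * \<bar>x\<bar> - \<bar>y\<bar> / sqrt a)\<^sup>2" by simp
  also have "\<dots> = a * x\<^sup>2 + y\<^sup>2 / a - 2 * \<bar>x * y\<bar>"
    using assms by (simp add: power2_diff power_mult_distrib power_divide abs_mult)
  finally have "2 * \<bar>x * y\<bar> \<le> a * x\<^sup>2 + y\<^sup>2 / a" by simp
  then show ?thesis by linarith
qed

lemma square_integrable_mult:
  assumes "square_integrable M f" "square_integrable M g"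
  shows "integrable M (\<lambda>x. f x * g x)"
proof (rule Bochner_Integration.integrable_bound)
  show "integrable M (\<lambda>x. (f x)\<^sup>2 + (g x)\<^sup>2)"
    using assms by (simp add: square_integrable_def)
  show "(\<lambda>x. f x * g x) \<in> borel_measurable M"
    using assms by (auto simp: square_integrable_def)
  show "AE x in M. norm (f x * g x) \<le> norm ((f x)\<^sup>2 + (g x)\<^sup>2)"
    using abs_mult_le_weighted_squares[of 1] by (auto intro!: AE_I2 simp: abs_of_nonneg)
qed

lemma integral_mult_le_weighted_squares:
  assumes f: "square_integrable M f" and g: "square_integrable M g" and "a > 0"
  shows "\<bar>\<integral>x. f x * g x \<partial>M\<bar> \<le> a * (\<integral>x. (f x)\<^sup>2 \<partial>M) + (\<integral>x. (g x)\<^sup>2 \<partial>M) / a"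
proof -
  have "\<bar>\<integral>x. f x * g x \<partial>M\<bar> \<le> (\<integral>x. \<bar>f x * g x\<bar> \<partial>M)"
    by (rule integral_abs_bound)
  also have "\<dots> \<le> (\<integral>x. a * (f x)\<^sup>2 + (g x)\<^sup>2 / a \<partial>M)"
    using square_integrable_mult[OF f g] f g abs_mult_le_weighted_squares[OF \<open>a > 0\<close>]
    by (intro integral_mono) (auto simp: square_integrable_def)
  also have "\<dots> = a * (\<integral>x. (f x)\<^sup>2 \<partial>M) + (\<integral>x. (g x)\<^sup>2 \<partial>M) / a"
    using f g by (simp add: square_integrable_def)
  finally show ?thesis .
qed

text \<open>The integral of (s f + t g)^2 is a nonnegative quadratic form in \<open>(s, t)\<close>.
  Keeping two variables lets \<open>s = - C\<close>, \<open>t = A\<close> produce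
  \<open>A * (A * B - C\<^sup>2)\<close> without a division, so only the degenerate case
  \<open>A = 0\<close> is separate.\<close>

lemma Cauchy_Schwarz_integral:
  assumes f: "square_integrable M f" and g: "square_integrable M g"
  shows "(\<integral>x. f x * g x \<partial>M)\<^sup>2 \<le> (\<integral>x. (f x)\<^sup>2 \<partial>M) * (\<integral>x. (g x)\<^sup>2 \<partial>M)"
proof -
  define A B C where "A = (\<integral>x. (f x)\<^sup>2 \<partial>M)" and "B = (\<integral>x. (g x)\<^sup>2 \<partial>M)"
    and "C = (\<integral>x. f x * g x \<partial>M)"
  have nonneg: "0 \<le> A" by (simp add: A_def)
  have int: "integrable M (\<lambda>x. (f x)\<^sup>2)" "integrable M (\<lambda>x. (g x)\<^sup>2)" "integrable M (\<lambda>x. f x * g x)"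
    using f g square_integrable_mult[OF f g] by (auto simp: square_integrable_def)
  have quad: "0 \<le> s\<^sup>2 * A + 2 * s * t * C + t\<^sup>2 * B" for s t
  proof -
    have "0 \<le> (\<integral>x. (s * f x + t * g x)\<^sup>2 \<partial>M)" by simp
    also have "\<dots> = (\<integral>x. s\<^sup>2 * (f x)\<^sup>2 + 2 * s * t * (f x * g x) + t\<^sup>2 * (g x)\<^sup>2 \<partial>M)"
      by (intro Bochner_Integration.integral_cong) (auto simp: power2_eq_square algebra_simps)
    also have "\<dots> = s\<^sup>2 * A + 2 * s * t * C + t\<^sup>2 * B"
      using int by (simp add: A_def B_def C_def)
    finally show ?thesis .
  qed
  have "C\<^sup>2 \<le> A * B"
  proof (cases "A = 0")
    case False
    have "0 \<le> A * (A * B - C\<^sup>2)"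
      using quad[of "- C" A] by (simp add: power2_eq_square algebra_simps)
    with False nonneg show ?thesis by (simp add: zero_le_mult_iff)
  next
    case True
    have "C = 0"
    proof (rule ccontr)
      assume "C \<noteq> 0"
      \<comment> \<open>With \<open>A = 0\<close> the form is affine in \<open>s\<close>, and
        \<open>s = - (B + 1) / (2 * C)\<close> drives it to -1.\<close>
      have "0 \<le> - (B + 1) / C * C + B"
        using quad[of "- (B + 1) / (2 * C)" 1] True \<open>C \<noteq> 0\<close> by (simp add: field_simps)
      with \<open>C \<noteq> 0\<close> show False by (simp add: field_simps)
    qed
    with True show ?thesis by simp
  qed
  then show ?thesis by (simp add: A_def B_def C_def)
qed

lemma Cauchy_Schwarz_integral_sqrt:
  assumes "square_integrable M f" "square_integrable M g"
  shows "\<bar>\<integral>x. f x * g x \<partial>M\<bar> \<le> sqrt (\<integral>x. (f x)\<^sup>2 \<partial>M) * sqrt (\<integral>x. (g x)\<^sup>2 \<partial>M)"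
  using real_sqrt_le_mono[OF Cauchy_Schwarz_integral[OF assms]] by (simp add: real_sqrt_mult)

lemma square_sum_le: "(a + b)\<^sup>2 \<le> 2 * a\<^sup>2 + 2 * (b\<^sup>2 :: real)"
  using zero_le_power2[of "a - b"] unfolding power2_eq_square by (simp add: algebra_simps)

lemma square_integrable_add [intro]:
  assumes "square_integrable M f" "square_integrable M g"
  shows "square_integrable M (\<lambda>x. f x + g x)"
proof -
  have "integrable M (\<lambda>x. (f x + g x)\<^sup>2)"
  proof (rule Bochner_Integration.integrable_bound)
    show "integrable M (\<lambda>x. 2 * (f x)\<^sup>2 + 2 * (g x)\<^sup>2)"
      using assms by (simp add: square_integrable_def)
    show "(\<lambda>x. (f x + g x)\<^sup>2) \<in> borel_measurable M"
      using assms by (auto simp: square_integrable_def)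
    show "AE x in M. norm ((f x + g x)\<^sup>2) \<le> norm (2 * (f x)\<^sup>2 + 2 * (g x)\<^sup>2)"
      using square_sum_le by (auto intro!: AE_I2 simp: abs_of_nonneg)
  qed
  then show ?thesis using assms by (auto simp: square_integrable_def)
qed

lemma square_integrable_bounded_mult:
  assumes "square_integrable M f" "h \<in> borel_measurable M" "\<And>x. \<bar>h x\<bar> \<le> C"
  shows "square_integrable M (\<lambda>x. h x * f x)"
proof -
  have "integrable M (\<lambda>x. (h x * f x)\<^sup>2)"
  proof (rule Bochner_Integration.integrable_bound)
    show "integrable M (\<lambda>x. C\<^sup>2 * (f x)\<^sup>2)"
      using assms by (simp add: square_integrable_def)
    show "(\<lambda>x. (h x * f x)\<^sup>2) \<in> borel_measurable M"
      using assms by (auto simp: square_integrable_def)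
    have "(h x)\<^sup>2 \<le> C\<^sup>2" for x
      using power_mono[OF assms(3)[of x], of 2] by simp
    then show "AE x in M. norm ((h x * f x)\<^sup>2) \<le> norm (C\<^sup>2 * (f x)\<^sup>2)"
      by (auto intro!: AE_I2 simp: power_mult_distrib mult_right_mono)
  qed
  then show ?thesis using assms by (auto simp: square_integrable_def)
qed

lemma square_integrable_cmult [intro]:
  "square_integrable M f \<Longrightarrow> square_integrable M (\<lambda>x. c * f x)"
  by (auto simp: square_integrable_def power_mult_distrib)

lemma square_integrable_uminus [intro]:
  "square_integrable M f \<Longrightarrow> square_integrable M (\<lambda>x. - f x)"
  by (auto simp: square_integrable_def)

lemma square_integrable_diff [intro]:
  "square_integrable M f \<Longrightarrow> square_integrable M g \<Longrightarrow> square_integrable M (\<lambda>x. f x - g x)"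
  using square_integrable_add[of M f "\<lambda>x. - g x"] by (simp add: square_integrable_uminus)

lemma integral_square_add_le:
  assumes "square_integrable M f" "square_integrable M g"
  shows "(\<integral>x. (f x + g x)\<^sup>2 \<partial>M) \<le> 2 * (\<integral>x. (f x)\<^sup>2 \<partial>M) + 2 * (\<integral>x. (g x)\<^sup>2 \<partial>M)"
proof -
  have "(\<integral>x. (f x + g x)\<^sup>2 \<partial>M) \<le> (\<integral>x. 2 * (f x)\<^sup>2 + 2 * (g x)\<^sup>2 \<partial>M)"
    using square_integrableD[OF square_integrable_add[OF assms]] assms square_sum_le
    by (intro integral_mono) (auto simp: square_integrable_def)
  then show ?thesis using assms by (auto simp: square_integrable_def)
qed

lemma integral_square_diff_le:
  assumes "square_integrable M f" "square_integrable M g"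
  shows "(\<integral>x. (f x - g x)\<^sup>2 \<partial>M) \<le> 2 * (\<integral>x. (f x)\<^sup>2 \<partial>M) + 2 * (\<integral>x. (g x)\<^sup>2 \<partial>M)"
  using integral_square_add_le[OF assms(1) square_integrable_uminus[OF assms(2)]] by simp

subsection \<open>Translations\<close>

lemma lborel_distr_shift: "distr lborel borel (\<lambda>x. x + c) = (lborel :: 'a::euclidean_space measure)"
  using lborel_distr_plus[of c] by (simp add: add.commute cong: distr_cong)

lemma integral_shift:
  fixes f :: "'a::euclidean_space \<Rightarrow> real"
  assumes [measurable]: "f \<in> borel_measurable borel"
  shows "(LBINT x. f (x + c)) = (LBINT x. f x)"
proof -
  have "(LBINT x. f x) = (\<integral>x. f x \<partial>distr lborel borel (\<lambda>x. x + c))"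
    by (simp add: lborel_distr_shift)
  also have "\<dots> = (LBINT x. f (x + c))"
    by (rule integral_distr) auto
  finally show ?thesis by simp
qed

lemma integrable_shift:
  fixes f :: "'a::euclidean_space \<Rightarrow> real"
  assumes "integrable lborel f"
  shows "integrable lborel (\<lambda>x. f (x + c))"
proof -
  have "integrable (distr lborel borel (\<lambda>x. x + c)) f"
    using assms by (simp add: lborel_distr_shift)
  then show ?thesis
    by (subst (asm) integrable_distr_eq) (use assms in auto)
qed

lemma lborel_distr_reflect:
  "distr lborel borel (\<lambda>x. c - x) = (lborel :: 'a::euclidean_space measure)"
  by (subst lborel_affine[of "-1" c], auto simp: density_1)

lemma integral_reflect:
  fixes f :: "'a::euclidean_space \<Rightarrow> real"
  assumes [measurable]: "f \<in> borel_measurable borel"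
  shows "(LBINT x. f (c - x)) = (LBINT x. f x)"
proof -
  have "(LBINT x. f x) = (\<integral>x. f x \<partial>distr lborel borel (\<lambda>x. c - x))"
    by (simp add: lborel_distr_reflect)
  also have "\<dots> = (LBINT x. f (c - x))"
    by (rule integral_distr) auto
  finally show ?thesis by simp
qed

lemma integrable_reflect:
  fixes f :: "'a::euclidean_space \<Rightarrow> real"
  assumes "integrable lborel f"
  shows "integrable lborel (\<lambda>x. f (c - x))"
proof -
  have "integrable (distr lborel borel (\<lambda>x. c - x)) f"
    using assms by (simp add: lborel_distr_reflect)
  then show ?thesis
    by (subst (asm) integrable_distr_eq) (use assms in auto)
qed

lemma square_integrable_shift:
  fixes f :: "'a::euclidean_space \<Rightarrow> real"
  assumes "square_integrable lborel f"
  shows "square_integrable lborel (\<lambda>x. f (x + c))"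
  using assms integrable_shift[of "\<lambda>x. (f x)\<^sup>2" c] unfolding square_integrable_def
  by (auto intro!: measurable_compose[of "\<lambda>x. x + c" lborel borel f])

lemma square_integrable_reflect:
  fixes f :: "'a::euclidean_space \<Rightarrow> real"
  assumes "square_integrable lborel f"
  shows "square_integrable lborel (\<lambda>x. f (c - x))"
  using assms integrable_reflect[of "\<lambda>x. (f x)\<^sup>2" c] unfolding square_integrable_def
  by (auto intro!: measurable_compose[of "\<lambda>x. c - x" lborel borel f])

subsection \<open>Continuous functions of compact support are dense\<close>

lemma integrable_bounded_support:
  fixes f :: "'a::euclidean_space \<Rightarrow> real"
  assumes [measurable]: "f \<in> borel_measurable borel"
    and "\<And>x. \<bar>f x\<bar> \<le> C" "\<And>x. norm x > R \<Longrightarrow> f x = 0"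
  shows "integrable lborel f"
proof (rule Bochner_Integration.integrable_bound)
  show "integrable lborel (\<lambda>x::'a. C * indicator (cball 0 R) x)"
    by (intro integrable_mult_right integrable_real_indicator emeasure_lborel_cball_finite) auto
  have "\<bar>f x\<bar> \<le> \<bar>C * indicator (cball 0 R) x\<bar>" for x
    using assms(2)[of x] assms(3)[of x] by (auto simp: indicator_def)
  then show "AE x in lborel. norm (f x) \<le> norm (C * indicator (cball 0 R) x)" by simp
qed simp

lemma tendsto_clip:
  fixes f :: "'a::euclidean_space \<Rightarrow> real"
  assumes f: "square_integrable lborel f"
  defines "F n x \<equiv> indicator (cball 0 (real n)) x * max (- real n) (min (real n) (f x))"
  shows "(\<lambda>n. LBINT x. (F n x - f x)\<^sup>2) \<longlonglongrightarrow> 0"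
proof -
  have [measurable]: "f \<in> borel_measurable borel" using f by (simp add: square_integrable_def)
  have [measurable]: "F n \<in> borel_measurable borel" for n unfolding F_def
    by (intro borel_measurable_times borel_measurable_indicator borel_measurable_max borel_measurable_min) auto
  have "(\<lambda>n. LBINT x. (F n x - f x)\<^sup>2) \<longlonglongrightarrow> (\<integral>x. 0 \<partial>(lborel :: 'a measure))"
  proof (rule integral_dominated_convergence[where w = "\<lambda>x. (f x)\<^sup>2"])
    show "integrable lborel (\<lambda>x. (f x)\<^sup>2)" using f by (simp add: square_integrable_def)
    have "(\<lambda>n. (F n x - f x)\<^sup>2) \<longlonglongrightarrow> 0" for x
    proof (rule tendsto_eventually)
      obtain N where N: "real N > norm x + \<bar>f x\<bar>" using reals_Archimedean2 by blast
      have "(F n x - f x)\<^sup>2 = 0" if "n \<ge> N" for n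
      proof -
        have "real n > norm x + \<bar>f x\<bar>" using N that by linarith
        then have "norm x \<le> real n" "\<bar>f x\<bar> \<le> real n" 
          using norm_ge_zero[of x] abs_ge_zero[of "f x"] by linarith+
        then show ?thesis by (auto simp: F_def)
      qed
      then show "\<forall>\<^sub>F n in sequentially. (F n x - f x)\<^sup>2 = 0"
        by (auto simp: eventually_sequentially)
    qed
    then show "AE x in lborel. (\<lambda>n. (F n x - f x)\<^sup>2) \<longlonglongrightarrow> 0" by simp
    have "\<bar>F n x - f x\<bar> \<le> \<bar>f x\<bar>" for n x
      by (auto simp: F_def indicator_def)
    then have "(F n x - f x)\<^sup>2 \<le> (f x)\<^sup>2" for n x
      by (simp add: abs_le_square_iff)
    then show "AE x in lborel. norm ((F n x - f x)\<^sup>2) \<le> (f x)\<^sup>2" for n by simp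
  qed auto
  then show ?thesis by simp
qed

text \<open>Truncation in height and in space reduces to a bounded function on a ball. Lebesgue
  measurability, in the form \<open>measurable_on\<close>, supplies continuous functions converging
  to it almost everywhere; clipping and cutting them off keeps them continuous and makes dominated
  convergence applicable.\<close>

lemma square_integrable_approx_continuous:
  fixes f :: "'a::euclidean_space \<Rightarrow> real"
  assumes f: "square_integrable lborel f" and "e > 0"
  obtains g R where "continuous_on UNIV g" "square_integrable lborel g" "\<And>x. norm x > R \<Longrightarrow> g x = 0"
    "(LBINT x. (g x - f x)\<^sup>2) < e"
proof -
  have [measurable]: "f \<in> borel_measurable borel" using f by (simp add: square_integrable_def)
  define F where "F n x = indicator (cball 0 (real n)) x * max (- real n) (min (real n) (f x))" for n x
  have "\<forall>\<^sub>F n in sequentially. (LBINT x. (F n x - f x)\<^sup>2) < e / 4"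
    using tendsto_clip[OF f] \<open>e > 0\<close> unfolding F_def by (intro order_tendstoD(2)) auto
  then obtain n where n: "(LBINT x. (F n x - f x)\<^sup>2) < e / 4"
    by (auto simp: eventually_sequentially)
  have [measurable]: "F n \<in> borel_measurable borel" unfolding F_def
    by (intro borel_measurable_times borel_measurable_indicator borel_measurable_max borel_measurable_min) auto
  have Fsupp: "F n x = 0" if "norm x > real n" for x using that by (simp add: F_def)
  have Fbd: "\<bar>F n x\<bar> \<le> real n" for x by (auto simp: F_def indicator_def)
  have "F n \<in> borel_measurable lebesgue" by (simp add: measurable_completion)
  then have "F n measurable_on UNIV" by (simp add: measurable_on_iff_borel_measurable)
  then obtain N h where N: "negligible N" and h: "\<And>k. continuous_on UNIV (h k)"
    and lim: "\<And>x. x \<notin> N \<Longrightarrow> (\<lambda>k. h k x) \<longlonglongrightarrow> F n x"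
    unfolding measurable_on_def by auto
  \<comment> \<open>A continuous cutoff: 1 on the ball of radius \<open>n\<close> that carries
    \<open>F n\<close>, and 0 outside the ball of radius \<open>n + 1\<close>. Multiplying by it
    does not change \<open>F n\<close>.\<close>
  define c where "c x = max 0 (min 1 (real n + 1 - norm x))" for x :: 'a
  define G where "G k x = c x * max (- real n) (min (real n) (h k x))" for k x
  have contG: "continuous_on UNIV (G k)" for k
    unfolding G_def c_def by (intro continuous_intros h)
  then have [measurable]: "G k \<in> borel_measurable borel" for k
    by (rule borel_measurable_continuous_onI)
  have Gbd: "\<bar>G k x\<bar> \<le> real n" for k x
  proof -
    have "\<bar>G k x\<bar> \<le> 1 * real n" unfolding G_def abs_mult
      by (intro mult_mono) (auto simp: c_def)
    then show ?thesis by simp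
  qed
  have Gsupp: "G k x = 0" if "norm x > real n + 1" for k x
    using that by (simp add: G_def c_def)
  have sqG: "square_integrable lborel (G k)" for k
    unfolding square_integrable_def
    by (auto intro!: integrable_bounded_support[where C = "(real n)\<^sup>2" and R = "real n + 1"] power_mono
      simp: Gsupp abs_le_square_iff[symmetric] Gbd)
  have sqF: "square_integrable lborel (F n)"
    unfolding square_integrable_def
    by (auto intro!: integrable_bounded_support[where C = "(real n)\<^sup>2" and R = "real n"] power_mono
      simp: Fsupp abs_le_square_iff[symmetric] Fbd)
  have "(\<lambda>k. LBINT x. (G k x - F n x)\<^sup>2) \<longlonglongrightarrow> (\<integral>x. 0 \<partial>(lborel :: 'a measure))"
  proof (rule integral_dominated_convergence[where w = "\<lambda>x. (2 * real n)\<^sup>2 * indicator (cball 0 (real n + 1)) x"])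
    show "integrable lborel (\<lambda>x::'a. (2 * real n)\<^sup>2 * indicator (cball 0 (real n + 1)) x)"
      by (intro integrable_mult_right integrable_real_indicator emeasure_lborel_cball_finite) auto
    have "(\<lambda>k. (G k x - F n x)\<^sup>2) \<longlonglongrightarrow> 0" if "x \<notin> N" for x
    proof -
      have "(\<lambda>k. G k x) \<longlonglongrightarrow> c x * max (- real n) (min (real n) (F n x))"
        unfolding G_def by (intro tendsto_intros lim that)
      also have "c x * max (- real n) (min (real n) (F n x)) = F n x"
        by (auto simp: F_def c_def indicator_def)
      finally show ?thesis by (auto intro!: tendsto_eq_intros)
    qed
    moreover have "AE x in lebesgue. x \<notin> N"
      using N by (auto simp: negligible_iff_null_sets intro: AE_not_in)
    ultimately have "AE x in lebesgue. (\<lambda>k. (G k x - F n x)\<^sup>2) \<longlonglongrightarrow> 0"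
      by (auto elim: eventually_mono)
    then show "AE x in lborel. (\<lambda>k. (G k x - F n x)\<^sup>2) \<longlonglongrightarrow> 0"
      by (simp add: AE_completion_iff)
    show "AE x in lborel. norm ((G k x - F n x)\<^sup>2) \<le> (2 * real n)\<^sup>2 * indicator (cball 0 (real n + 1)) x" for k
    proof (intro AE_I2)
      fix x :: 'a
      have "\<bar>G k x - F n x\<bar> \<le> \<bar>2 * real n\<bar>" using Gbd[of k x] Fbd[of x] by linarith
      then have "(G k x - F n x)\<^sup>2 \<le> (2 * real n)\<^sup>2" by (simp only: abs_le_square_iff)
      then show "norm ((G k x - F n x)\<^sup>2) \<le> (2 * real n)\<^sup>2 * indicator (cball 0 (real n + 1)) x"
        by (cases "norm x > real n + 1") (auto simp: Gsupp F_def indicator_def)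
    qed
  qed auto
  then have "\<forall>\<^sub>F k in sequentially. (LBINT x. (G k x - F n x)\<^sup>2) < e / 4"
    using \<open>e > 0\<close> by (intro order_tendstoD(2)) auto
  then obtain k where k: "(LBINT x. (G k x - F n x)\<^sup>2) < e / 4"
    by (auto simp: eventually_sequentially)
  have "(LBINT x. (G k x - f x)\<^sup>2) = (LBINT x. ((G k x - F n x) + (F n x - f x))\<^sup>2)"
    by simp
  also have "\<dots> \<le> 2 * (LBINT x. (G k x - F n x)\<^sup>2) + 2 * (LBINT x. (F n x - f x)\<^sup>2)"
    by (intro integral_square_add_le square_integrable_diff sqG sqF f)
  also have "\<dots> < e" using n k by simp
  finally show ?thesis using that contG sqG Gsupp by blast
qed

lemma L2_translation_continuous:
  fixes f :: "'a::euclidean_space \<Rightarrow> real"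
  assumes f: "square_integrable lborel f" and "e > 0"
  obtains d where "d > 0" "\<And>h. norm h < d \<Longrightarrow> (LBINT x. (f (x + h) - f x)\<^sup>2) < e"
proof -
  \<comment> \<open>Origin of 16: the inequality (a + b)^2 <= 2 a^2 + 2 b^2 is applied twice, so the
    three differences contribute at most 2 e/16 + 4 e/8 + 4 e/16, which is below
    \<open>e\<close>.\<close>
  obtain g R where g: "continuous_on UNIV g" "square_integrable lborel g"
    and supp: "\<And>x. norm x > R \<Longrightarrow> g x = 0" and fg: "(LBINT x. (g x - f x)\<^sup>2) < e / 16"
    using square_integrable_approx_continuous[OF f, of "e / 16"] \<open>e > 0\<close> by auto
  \<comment> \<open>For shifts shorter than 1, both \<open>g x\<close> and \<open>g (x + h)\<close>
    vanish outside this ball. The \<open>+ 1\<close> in the definition of \<eta> guards against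
    division by a zero volume.\<close>
  define B :: "'a set" where "B = cball 0 (R + 1)"
  define V where "V = measure lborel B"
  have V: "V \<ge> 0" by (simp add: V_def)
  have meas[measurable]: "f \<in> borel_measurable borel" "g \<in> borel_measurable borel"
    using f g by (auto simp: square_integrable_def)
  define \<eta> where "\<eta> = sqrt (e / (8 * (V + 1)))"
  have \<eta>: "\<eta> > 0" using \<open>e > 0\<close> V by (simp add: \<eta>_def)
  have "uniformly_continuous_on (cball 0 (R + 2)) g"
    by (intro compact_uniformly_continuous continuous_on_subset[OF g(1)]) auto
  then obtain d where d: "d > 0"
    "\<And>x y. \<lbrakk>x \<in> cball 0 (R + 2); y \<in> cball 0 (R + 2); dist y x < d\<rbrakk> \<Longrightarrow> dist (g y) (g x) < \<eta>"
    using \<eta> unfolding uniformly_continuous_on_def by metis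
  have close: "(g (x + h) - g x)\<^sup>2 \<le> \<eta>\<^sup>2 * indicator B x" if "norm h < min d 1" for x h
  proof (cases "x \<in> B")
    case True
    have "dist (g (x + h)) (g x) < \<eta>"
      using True that norm_triangle_ineq[of x h]
      by (intro d(2)) (auto simp: B_def dist_norm[of "x + h" x] simp del: mem_cball intro!: mem_cball_0[THEN iffD2])
    then have "\<bar>g (x + h) - g x\<bar> \<le> \<bar>\<eta>\<bar>" by (simp add: dist_real_def)
    with True show ?thesis by (simp add: abs_le_square_iff)
  next
    case False
    then have "norm x > R + 1" by (simp add: B_def)
    moreover have "norm (x + h) > R" 
      using that \<open>norm x > R + 1\<close> norm_diff_ineq[of x h] by auto
    ultimately show ?thesis using supp[of x] supp[of "x + h"] False by simp
  qed
  show ?thesis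
  proof (rule that[of "min d 1"])
    show "min d 1 > 0" using d by simp
    fix h :: 'a assume h: "norm h < min d 1"
    have "(LBINT x. (g (x + h) - g x)\<^sup>2) \<le> (LBINT x. \<eta>\<^sup>2 * indicator B x)"
      using close[OF h] square_integrable_diff[OF square_integrable_shift[OF g(2)] g(2), of h]
      by (intro integral_mono) (auto simp: square_integrable_def B_def
        intro!: emeasure_bounded_finite integrable_mult_right integrable_real_indicator)
    also have "\<dots> = \<eta>\<^sup>2 * V" by (simp add: V_def B_def)
    also have "\<dots> < e / 8"
    proof -
      have "\<eta>\<^sup>2 = e / (8 * (V + 1))" using \<open>e > 0\<close> V by (simp add: \<eta>_def)
      then have "\<eta>\<^sup>2 * V = e / 8 * (V / (V + 1))" by simp
      also have "\<dots> < e / 8 * 1" using \<open>e > 0\<close> V by (intro mult_strict_left_mono) auto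
      finally show ?thesis by simp
    qed
    finally have 1: "(LBINT x. (g (x + h) - g x)\<^sup>2) < e / 8" .
    have 2: "(LBINT x. (f (x + h) - g (x + h))\<^sup>2) < e / 16"
      using integral_shift[of "\<lambda>x. (f x - g x)\<^sup>2" h] fg by (simp add: power2_commute)
    have "(LBINT x. (f (x + h) - f x)\<^sup>2)
        = (LBINT x. ((f (x + h) - g (x + h)) + ((g (x + h) - g x) + (g x - f x)))\<^sup>2)"
      by simp
    also have "\<dots> \<le> 2 * (LBINT x. (f (x + h) - g (x + h))\<^sup>2) 
        + 2 * (LBINT x. ((g (x + h) - g x) + (g x - f x))\<^sup>2)"
      by (intro integral_square_add_le square_integrable_add square_integrable_diff
          square_integrable_shift f g)
    finally have 3: "(LBINT x. (f (x + h) - f x)\<^sup>2) \<le> 2 * (LBINT x. (f (x + h) - g (x + h))\<^sup>2) 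
        + 2 * (LBINT x. ((g (x + h) - g x) + (g x - f x))\<^sup>2)" .
    have 4: "(LBINT x. ((g (x + h) - g x) + (g x - f x))\<^sup>2)
        \<le> 2 * (LBINT x. (g (x + h) - g x)\<^sup>2) + 2 * (LBINT x. (g x - f x)\<^sup>2)"
      by (intro integral_square_add_le square_integrable_diff square_integrable_shift f g)
    show "(LBINT x. (f (x + h) - f x)\<^sup>2) < e"
      using 1 2 3 4 fg \<open>e > 0\<close> by linarith
  qed
qed

section \<open>Bounded differentiable functions and test functions\<close>

text \<open>Only directional derivatives are recorded: \<open>f' w z\<close> is the derivative of \<open>f\<close> at \<open>z\<close> in
  direction \<open>w\<close>.\<close>

definition bounded_diff :: "('a::euclidean_space \<Rightarrow> real) \<Rightarrow> ('a \<Rightarrow> 'a \<Rightarrow> real) \<Rightarrow> bool" where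
  "bounded_diff f f' \<longleftrightarrow>
     f \<in> borel_measurable borel \<and> (\<exists>C. \<forall>z. \<bar>f z\<bar> \<le> C) \<and>
     (\<forall>w. f' w \<in> borel_measurable borel \<and> (\<exists>C. \<forall>z. \<bar>f' w z\<bar> \<le> C)) \<and>
     (\<forall>z. linear (\<lambda>w. f' w z)) \<and>
     (\<forall>w z s. ((\<lambda>s. f (z + s *\<^sub>R w)) has_real_derivative f' w (z + s *\<^sub>R w)) (at s))"

lemma bounded_diff_measurable:
  assumes "bounded_diff f f'"
  shows "f \<in> borel_measurable borel" "f' w \<in> borel_measurable borel"
  using assms by (auto simp: bounded_diff_def)

lemma bounded_diff_bound:
  assumes "bounded_diff f f'"
  obtains C where "C \<ge> 0" "\<And>z. \<bar>f z\<bar> \<le> C"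
proof -
  obtain C where "\<forall>z. \<bar>f z\<bar> \<le> C" using assms by (auto simp: bounded_diff_def)
  then show ?thesis using that[of C] by (meson abs_ge_zero order_trans)
qed

lemma bounded_diff_deriv_bound:
  assumes "bounded_diff f f'"
  obtains C where "C \<ge> 0" "\<And>z. \<bar>f' w z\<bar> \<le> C"
proof -
  obtain C where "\<forall>z. \<bar>f' w z\<bar> \<le> C" using assms unfolding bounded_diff_def by blast
  then show ?thesis using that[of C] by (meson abs_ge_zero order_trans)
qed

lemma bounded_diff_linear: "bounded_diff f f' \<Longrightarrow> linear (\<lambda>w. f' w z)"
  by (simp add: bounded_diff_def)

lemma bounded_diff_deriv:
  "bounded_diff f f' \<Longrightarrow> ((\<lambda>s. f (z + s *\<^sub>R w)) has_real_derivative f' w (z + s *\<^sub>R w)) (at s)"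
  by (simp add: bounded_diff_def)

lemma bounded_diff_add:
  assumes f: "bounded_diff f f'" and g: "bounded_diff g g'"
  shows "bounded_diff (\<lambda>z. f z + g z) (\<lambda>w z. f' w z + g' w z)"
proof -
  have bdd: "\<exists>C. \<forall>z. \<bar>p z + q z\<bar> \<le> C" if "\<forall>z. \<bar>p z\<bar> \<le> C" "\<forall>z. \<bar>q z\<bar> \<le> D" for p q :: "'a \<Rightarrow> real" and C D
    using that by (intro exI[of _ "C + D"]) (meson abs_triangle_ineq add_mono order_trans)
  have "\<exists>C. \<forall>z. \<bar>f z + g z\<bar> \<le> C" "\<exists>C. \<forall>z. \<bar>f' w z + g' w z\<bar> \<le> C" for w
    using f g bdd unfolding bounded_diff_def by blast+
  then show ?thesis
    using bounded_diff_measurable[OF f] bounded_diff_measurable[OF g] bounded_diff_linear[OF f] bounded_diff_linear[OF g]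
    unfolding bounded_diff_def 
    by (auto intro!: linear_compose_add DERIV_add bounded_diff_deriv[OF f] bounded_diff_deriv[OF g])
qed

lemma bounded_diff_mult:
  assumes f: "bounded_diff f f'" and g: "bounded_diff g g'"
  shows "bounded_diff (\<lambda>z. f z * g z) (\<lambda>w z. f' w z * g z + f z * g' w z)"
proof -
  obtain C where C: "C \<ge> 0" "\<And>z. \<bar>f z\<bar> \<le> C" using bounded_diff_bound[OF f] by blast
  obtain D where D: "D \<ge> 0" "\<And>z. \<bar>g z\<bar> \<le> D" using bounded_diff_bound[OF g] by blast
  have "\<bar>f z * g z\<bar> \<le> C * D" for z
    unfolding abs_mult using C D by (intro mult_mono) auto
  moreover have "\<exists>K. \<forall>z. \<bar>f' w z * g z + f z * g' w z\<bar> \<le> K" for w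
  proof -
    obtain C' where C': "C' \<ge> 0" "\<And>z. \<bar>f' w z\<bar> \<le> C'" using bounded_diff_deriv_bound[OF f] by blast
    obtain D' where D': "D' \<ge> 0" "\<And>z. \<bar>g' w z\<bar> \<le> D'" using bounded_diff_deriv_bound[OF g] by blast
    have "\<bar>f' w z * g z + f z * g' w z\<bar> \<le> C' * D + C * D'" for z
      by (rule order_trans[OF abs_triangle_ineq], unfold abs_mult)
        (use C D C' D' in \<open>intro add_mono mult_mono; auto\<close>)
    then show ?thesis by blast
  qed
  moreover have "linear (\<lambda>w. f' w z * g z + f z * g' w z)" for z
    using bounded_diff_linear[OF f, of z] bounded_diff_linear[OF g, of z]
    by (intro linearI) (auto simp: linear_iff algebra_simps)
  moreover have "((\<lambda>s. f (z + s *\<^sub>R w) * g (z + s *\<^sub>R w)) has_real_derivative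
     f' w (z + s *\<^sub>R w) * g (z + s *\<^sub>R w) + f (z + s *\<^sub>R w) * g' w (z + s *\<^sub>R w)) (at s)" for z w s
    by (rule DERIV_cong[OF DERIV_mult[OF bounded_diff_deriv[OF f] bounded_diff_deriv[OF g]]])
      (simp add: algebra_simps)
  ultimately show ?thesis
    using bounded_diff_measurable[OF f] bounded_diff_measurable[OF g]
    unfolding bounded_diff_def by (auto intro!: borel_measurable_times borel_measurable_add)
qed

lemma bounded_diff_cmult:
  assumes f: "bounded_diff f f'"
  shows "bounded_diff (\<lambda>z. c * f z) (\<lambda>w z. c * f' w z)"
proof -
  have "bounded_diff (\<lambda>z. c) (\<lambda>w z. 0)"
    by (auto simp: bounded_diff_def intro!: linear_zero exI[of _ "\<bar>c\<bar>"])
  from bounded_diff_mult[OF this f] show ?thesis by simp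
qed

lemma bounded_diff_diff:
  assumes f: "bounded_diff f f'" and g: "bounded_diff g g'"
  shows "bounded_diff (\<lambda>z. f z - g z) (\<lambda>w z. f' w z - g' w z)"
  using bounded_diff_add[OF f bounded_diff_cmult[OF g, of "-1"]] by simp

lemma bounded_diff_shift:
  assumes f: "bounded_diff f f'"
  shows "bounded_diff (\<lambda>z. f (z + y)) (\<lambda>w z. f' w (z + y))"
proof -
  have "((\<lambda>s. f (z + s *\<^sub>R w + y)) has_real_derivative f' w (z + s *\<^sub>R w + y)) (at s)" for w z s
    using bounded_diff_deriv[OF f, of "z + y" w s] by (simp add: algebra_simps)
  moreover have "(\<lambda>z. f (z + y)) \<in> borel_measurable borel" "(\<lambda>z. f' w (z + y)) \<in> borel_measurable borel" for w
    using bounded_diff_measurable[OF f] by measurable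
  moreover have "\<exists>C. \<forall>z. \<bar>f (z + y)\<bar> \<le> C" "\<exists>C. \<forall>z. \<bar>f' w (z + y)\<bar> \<le> C" for w
    using f unfolding bounded_diff_def by blast+
  ultimately show ?thesis
    using bounded_diff_linear[OF f] unfolding bounded_diff_def by blast
qed

lemma bounded_diff_deriv_eq_0:
  assumes f: "bounded_diff f f'" and supp: "\<And>z. norm z > R \<Longrightarrow> f z = 0" and z: "norm z > R"
  shows "f' w z = 0"
proof -
  have "open {s. norm (z + s *\<^sub>R w) > R}"
    by (intro open_Collect_less continuous_intros)
  moreover have "0 \<in> {s. norm (z + s *\<^sub>R w) > R}" using z by simp
  ultimately have "((\<lambda>s. f (z + s *\<^sub>R w)) has_real_derivative 0) (at 0)"
    using has_field_derivative_transform_within_open[where f = "\<lambda>_. 0" and f' = 0 and a = 0 and S = "{s. norm (z + s *\<^sub>R w) > R}" and g = "\<lambda>s. f (z + s *\<^sub>R w)"]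
    by (simp add: supp)
  with bounded_diff_deriv[OF f, where z = z and w = w and s = 0] show ?thesis
    by (auto dest: DERIV_unique)
qed

subsection \<open>Differentiation under the integral sign\<close>

text \<open>By the mean value theorem a difference quotient at \<open>s0\<close> is a value of
  \<open>F'\<close> at a point of the unit window around \<open>s0\<close>, hence bounded by
  \<open>w\<close>; dominated convergence along sequences gives the derivative.\<close>

lemma has_real_derivative_integral:
  fixes F F' :: "real \<Rightarrow> 'a \<Rightarrow> real"
  assumes int: "\<And>s. \<bar>s - s0\<bar> < 1 \<Longrightarrow> integrable M (F s)"
    and deriv: "\<And>s x. \<bar>s - s0\<bar> < 1 \<Longrightarrow> x \<in> space M \<Longrightarrow> ((\<lambda>s. F s x) has_real_derivative F' s x) (at s)"
    and bound: "\<And>s x. \<bar>s - s0\<bar> < 1 \<Longrightarrow> x \<in> space M \<Longrightarrow> \<bar>F' s x\<bar> \<le> w x"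
    and w: "integrable M w" and meas: "F' s0 \<in> borel_measurable M"
  shows "((\<lambda>s. \<integral>x. F s x \<partial>M) has_real_derivative (\<integral>x. F' s0 x \<partial>M)) (at s0)"
  unfolding has_field_derivative_iff tendsto_at_iff_sequentially comp_def
proof (intro allI impI)
  fix X :: "nat \<Rightarrow> real"
  assume X: "\<forall>i. X i \<in> UNIV - {s0}" and lim: "X \<longlonglongrightarrow> s0"
  have "\<forall>\<^sub>F i in sequentially. dist (X i) s0 < 1" using lim by (rule tendstoD) simp
  then obtain N where N: "\<And>i. i \<ge> N \<Longrightarrow> \<bar>X i - s0\<bar> < 1"
    by (auto simp: eventually_sequentially dist_real_def)
  \<comment> \<open>The offset \<open>N\<close> keeps all arguments inside the window where the
    hypotheses hold.\<close>
  define Q where "Q i x = (F (X (i + N)) x - F s0 x) / (X (i + N) - s0)" for i x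
  have Xne: "X i \<noteq> s0" for i using X by auto
  have intF: "integrable M (F (X (i + N)))" "integrable M (F s0)" for i
    using int N by auto
  have "(\<lambda>i. \<integral>x. Q i x \<partial>M) \<longlonglongrightarrow> (\<integral>x. F' s0 x \<partial>M)"
  proof (rule integral_dominated_convergence[where w = w])
    show "Q i \<in> borel_measurable M" for i
      unfolding Q_def using intF by (intro borel_measurable_divide borel_measurable_diff) auto
    have "(\<lambda>i. Q i x) \<longlonglongrightarrow> F' s0 x" if "x \<in> space M" for x
    proof -
      have "((\<lambda>y. (F y x - F s0 x) / (y - s0)) \<longlongrightarrow> F' s0 x) (at s0)"
        using deriv[of s0 x] that by (simp add: has_field_derivative_iff)
      then show ?thesis
        unfolding Q_def tendsto_at_iff_sequentially comp_def 
        using X LIMSEQ_ignore_initial_segment[OF lim, of N] by auto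
    qed
    then show "AE x in M. (\<lambda>i. Q i x) \<longlonglongrightarrow> F' s0 x" by (auto intro!: AE_I2)
    have "\<bar>Q i x\<bar> \<le> w x" if xM: "x \<in> space M" for i x
    proof -
      define t where "t = X (i + N)"
      have t: "t \<noteq> s0" "\<bar>t - s0\<bar> < 1" using N[of "i + N"] Xne by (auto simp: t_def)
      have "\<exists>c. \<bar>c - s0\<bar> < 1 \<and> (F t x - F s0 x) / (t - s0) = F' c x"
      proof (cases "t < s0")
        case True
        obtain c where "t < c" "c < s0" "F s0 x - F t x = (s0 - t) * F' c x"
          using MVT2[OF True, of "\<lambda>s. F s x" "\<lambda>s. F' s x"] deriv[OF _ xM] t True by (auto simp: abs_if)
        with t show ?thesis by (intro exI[of _ c]) (auto simp: field_simps)
      next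
        case False
        then have "s0 < t" using t by simp
        then obtain c where "s0 < c" "c < t" "F t x - F s0 x = (t - s0) * F' c x"
          using MVT2[of s0 t "\<lambda>s. F s x" "\<lambda>s. F' s x"] deriv[OF _ xM] t by (auto simp: abs_if)
        with t show ?thesis by (intro exI[of _ c]) (auto simp: field_simps)
      qed
      then obtain c where "\<bar>c - s0\<bar> < 1" "Q i x = F' c x" by (auto simp: Q_def t_def)
      with bound xM show ?thesis by metis
    qed
    then show "AE x in M. norm (Q i x) \<le> w x" for i by (auto intro!: AE_I2)
  qed (use w meas in auto)
  moreover have "(\<integral>x. Q i x \<partial>M) = ((\<integral>x. F (X (i + N)) x \<partial>M) - (\<integral>x. F s0 x \<partial>M)) / (X (i + N) - s0)" for i
    unfolding Q_def using intF by simp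
  ultimately have "(\<lambda>i. ((\<integral>x. F (X (i + N)) x \<partial>M) - (\<integral>x. F s0 x \<partial>M)) / (X (i + N) - s0))
     \<longlonglongrightarrow> (\<integral>x. F' s0 x \<partial>M)" by simp
  then show "(\<lambda>i. ((\<integral>x. F (X i) x \<partial>M) - (\<integral>x. F s0 x \<partial>M)) / (X i - s0)) \<longlonglongrightarrow> (\<integral>x. F' s0 x \<partial>M)"
    by (rule LIMSEQ_offset)
qed

text \<open>The case \<open>h = 1\<close> is the divergence theorem for compactly supported fields.\<close>

lemma integral_directional_derivative_eq_0:
  fixes f h :: "'a::euclidean_space \<Rightarrow> real"
  assumes f: "bounded_diff f f'" and supp: "\<And>z. norm z > R \<Longrightarrow> f z = 0"
    and [measurable]: "h \<in> borel_measurable borel" and h: "\<And>z. \<bar>h z\<bar> \<le> H" 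
    and inv: "\<And>z s. h (z + s *\<^sub>R w) = h z"
  shows "(LBINT z. h z * f' w z) = 0"
proof -
  note [measurable] = bounded_diff_measurable[OF f]
  obtain C where C: "C \<ge> 0" "\<And>z. \<bar>f z\<bar> \<le> C" using bounded_diff_bound[OF f] by blast
  obtain D where D: "D \<ge> 0" "\<And>z. \<bar>f' w z\<bar> \<le> D" using bounded_diff_deriv_bound[OF f] by blast
  have H: "H \<ge> 0" using h[of 0] by linarith
  have far: "norm (z + s *\<^sub>R w) > R" if "norm z > R + norm w" "\<bar>s\<bar> < 1" for z s
  proof -
    have "norm (s *\<^sub>R w) \<le> 1 * norm w" unfolding norm_scaleR using that by (intro mult_right_mono) auto
    then show ?thesis using that norm_diff_ineq[of z "s *\<^sub>R w"] by simp
  qed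
  have "((\<lambda>s. LBINT z. h z * f (z + s *\<^sub>R w)) has_real_derivative
      (LBINT z. h z * f' w (z + 0 *\<^sub>R w))) (at 0)"
  proof (rule has_real_derivative_integral[where w = "\<lambda>z. H * D * indicator (cball 0 (R + norm w)) z"])
    fix s :: real assume s: "\<bar>s - 0\<bar> < 1"
    show "integrable lborel (\<lambda>z. h z * f (z + s *\<^sub>R w))"
      by (rule integrable_bounded_support[where C = "H * C" and R = "R + norm w"])
        (use supp far s in \<open>auto simp: abs_mult intro!: mult_mono h C H\<close>)
    show "((\<lambda>s. h z * f (z + s *\<^sub>R w)) has_real_derivative h z * f' w (z + s *\<^sub>R w)) (at s)" for z
      by (intro DERIV_cmult bounded_diff_deriv[OF f])
    show "\<bar>h z * f' w (z + s *\<^sub>R w)\<bar> \<le> H * D * indicator (cball 0 (R + norm w)) z" for z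
    proof (cases "norm z > R + norm w")
      case True
      then show ?thesis using bounded_diff_deriv_eq_0[OF f supp far[OF True], of s w] s by simp
    next
      case False
      then show ?thesis by (auto simp: abs_mult indicator_def intro!: mult_mono h D H)
    qed
  qed (auto intro!: integrable_mult_right integrable_real_indicator emeasure_bounded_finite)
  \<comment> \<open>Since \<open>h\<close> does not change along \<open>w\<close>, the integrand is
    a translate of \<open>h z * f z\<close>, so the integral is constant in \<open>s\<close> and its
    derivative is zero.\<close>
  moreover have "(LBINT z. h z * f (z + s *\<^sub>R w)) = (LBINT z. h z * f z)" for s
    using integral_shift[of "\<lambda>z. h z * f z" "s *\<^sub>R w"] by (simp add: inv)
  ultimately have "((\<lambda>s. LBINT z. h z * f z) has_real_derivative
      (LBINT z. h z * f' w z)) (at (0::real))" by simp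
  then show ?thesis using DERIV_const DERIV_unique by blast
qed

subsection \<open>A smooth bump function\<close>

text \<open>Dividing exp(-1/x) by powers of \<open>x\<close> gives a family in \<open>j\<close>
  whose derivatives are again linear combinations of its members, so smoothness reduces to a single
  differentiation.\<close>

definition flat_exp :: "nat \<Rightarrow> real \<Rightarrow> real" where
  "flat_exp j x = (if x > 0 then exp (- (1 / x)) / x ^ j else 0)"

lemma flat_exp_nonneg: "flat_exp j x \<ge> 0"
  by (simp add: flat_exp_def)

lemma flat_exp_tendsto_0: "(flat_exp j \<longlongrightarrow> 0) (at_right 0)"
proof -
  have "((\<lambda>x::real. (inverse x) ^ j / exp (inverse x)) \<longlongrightarrow> 0) (at_right 0)"
    by (rule filterlim_compose[OF tendsto_power_div_exp_0 filterlim_inverse_at_top_right])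
  moreover have "\<forall>\<^sub>F x in at_right 0. (inverse x) ^ j / exp (inverse x) = flat_exp j x"
    by (rule eventually_mono[OF eventually_at_right_less]) (simp add: flat_exp_def exp_minus field_simps)
  ultimately show ?thesis by (rule Lim_transform_eventually)
qed

lemma flat_exp_deriv:
  "(flat_exp j has_real_derivative flat_exp (j + 2) x - real j * flat_exp (j + 1) x) (at x)"
proof -
  consider "x > 0" | "x < 0" | "x = 0" by linarith
  then show ?thesis
  proof cases
    case 1
    have "((\<lambda>x. exp (- (1 / x)) / x ^ j) has_real_derivative 
        flat_exp (j + 2) x - real j * flat_exp (j + 1) x) (at x)"
      using 1 by (auto intro!: derivative_eq_intros simp: flat_exp_def field_simps power2_eq_square)
        (cases j; auto simp: field_simps)
    then show ?thesis
      by (rule has_field_derivative_transform_within_open[where S = "{0<..}"]) (use 1 in \<open>auto simp: flat_exp_def\<close>)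
  next
    case 2
    have "((\<lambda>x. 0) has_real_derivative flat_exp (j + 2) x - real j * flat_exp (j + 1) x) (at x)"
      using 2 by (simp add: flat_exp_def)
    then show ?thesis
      by (rule has_field_derivative_transform_within_open[where S = "{..<0}"]) (use 2 in \<open>auto simp: flat_exp_def\<close>)
  next
    case 3
    have "((\<lambda>y. (flat_exp j y - flat_exp j 0) / (y - 0)) \<longlongrightarrow> 0) (at 0)"
    proof (rule filterlim_split_at)
      have "\<forall>\<^sub>F y in at_left 0. 0 = (flat_exp j y - flat_exp j 0) / (y - 0)"
        by (rule eventually_mono[OF eventually_at_left_real[of "-1" 0]]) (auto simp: flat_exp_def)
      then show "((\<lambda>y. (flat_exp j y - flat_exp j 0) / (y - 0)) \<longlongrightarrow> 0) (at_left 0)"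
        by (rule Lim_transform_eventually[OF tendsto_const])
      \<comment> \<open>To the right of the origin the difference quotient is itself the next member
        of the family, which tends to 0.\<close>
      have "\<forall>\<^sub>F y in at_right 0. flat_exp (j + 1) y = (flat_exp j y - flat_exp j 0) / (y - 0)"
        by (rule eventually_mono[OF eventually_at_right_less]) (auto simp: flat_exp_def)
      then show "((\<lambda>y. (flat_exp j y - flat_exp j 0) / (y - 0)) \<longlongrightarrow> 0) (at_right 0)"
        by (rule Lim_transform_eventually[OF flat_exp_tendsto_0])
    qed
    then show ?thesis using 3 by (simp add: has_field_derivative_iff flat_exp_def)
  qed
qed

text \<open>A class of functions that contains the bump function and is closed under partial derivatives.\<close>

inductive_set bump_class :: "('a::euclidean_space \<Rightarrow> real) set" where
  base: "(\<lambda>z. flat_exp j (1 - z \<bullet> z)) \<in> bump_class"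
| add: "f \<in> bump_class \<Longrightarrow> g \<in> bump_class \<Longrightarrow> (\<lambda>z. f z + g z) \<in> bump_class"
| cmult: "f \<in> bump_class \<Longrightarrow> (\<lambda>z. c * f z) \<in> bump_class"
| inner: "f \<in> bump_class \<Longrightarrow> (\<lambda>z. (z \<bullet> b) * f z) \<in> bump_class"

lemma bump_class_derivative:
  "f \<in> bump_class \<Longrightarrow> \<exists>f'. (\<forall>z. (f has_derivative f' z) (at z)) \<and> (\<forall>b. (\<lambda>z. f' z b) \<in> bump_class)"
proof (induction rule: bump_class.induct)
  case (base j)
  have "((\<lambda>z::'a. flat_exp j (1 - z \<bullet> z)) has_derivative
      (\<lambda>w. (flat_exp (j + 2) (1 - z \<bullet> z) - real j * flat_exp (j + 1) (1 - z \<bullet> z)) * (- 2 * (z \<bullet> w)))) (at z)" for z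
  proof -
    have "((\<lambda>z::'a. 1 - z \<bullet> z) has_derivative (\<lambda>w. - 2 * (z \<bullet> w))) (at z)"
      by (auto intro!: derivative_eq_intros simp: inner_commute)
    from has_derivative_compose[OF this flat_exp_deriv[unfolded has_field_derivative_def]]
    show ?thesis by simp
  qed
  moreover have "(\<lambda>z. (flat_exp (j + 2) (1 - z \<bullet> z) - real j * flat_exp (j + 1) (1 - z \<bullet> z)) * (- 2 * (z \<bullet> w))) 
      \<in> bump_class" for w :: 'a
  proof -
    have "(\<lambda>z. - 2 * ((z \<bullet> w) * (flat_exp (j + 2) (1 - z \<bullet> z) + (- real j) * flat_exp (j + 1) (1 - z \<bullet> z)))) \<in> bump_class"
      by (intro bump_class.intros)
    then show ?thesis by (simp add: algebra_simps)
  qed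
  ultimately show ?case by (intro exI conjI allI)
next
  case (add f g)
  then obtain f' g' where *: "\<And>z. (f has_derivative f' z) (at z)" "\<And>b. (\<lambda>z. f' z b) \<in> bump_class"
    "\<And>z. (g has_derivative g' z) (at z)" "\<And>b. (\<lambda>z. g' z b) \<in> bump_class" by blast
  show ?case
    by (rule exI[of _ "\<lambda>z w. f' z w + g' z w"]) (auto intro!: has_derivative_add * bump_class.add)
next
  case (cmult f c)
  then obtain f' where *: "\<And>z. (f has_derivative f' z) (at z)" "\<And>b. (\<lambda>z. f' z b) \<in> bump_class" by blast
  show ?case
    by (rule exI[of _ "\<lambda>z w. c * f' z w"]) (auto intro!: has_derivative_mult_right * bump_class.cmult)
next
  case (inner f b)
  then obtain f' where *: "\<And>z. (f has_derivative f' z) (at z)" "\<And>b. (\<lambda>z. f' z b) \<in> bump_class" by blast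
  have "((\<lambda>z. (z \<bullet> b) * f z) has_derivative (\<lambda>w. (z \<bullet> b) * f' z w + (w \<bullet> b) * f z)) (at z)" for z
    by (intro has_derivative_mult * has_derivative_inner_left has_derivative_ident)
  moreover have "(\<lambda>z. (z \<bullet> b) * f' z w + (w \<bullet> b) * f z) \<in> bump_class" for w
    by (intro bump_class.intros * inner)
  ultimately show ?case by (intro exI conjI allI)
qed

lemma Ck_bump_class: "f \<in> bump_class \<Longrightarrow> Ck n f"
proof (induction n arbitrary: f)
  case 0
  then obtain f' where "\<And>z. (f has_derivative f' z) (at z)" using bump_class_derivative by blast
  then have "f differentiable_on UNIV" unfolding differentiable_on_def differentiable_def by blast
  then show ?case by (simp add: differentiable_imp_continuous_on)
next
  case (Suc n)
  then obtain f' where *: "\<And>z. (f has_derivative f' z) (at z)" "\<And>b. (\<lambda>z. f' z b) \<in> bump_class"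
    using bump_class_derivative by blast
  have "frechet_derivative f (at z) = f' z" for z using frechet_derivative_at[OF *(1)] by simp
  with * Suc.IH show ?case
    by (auto simp: differentiable_on_def differentiable_def)
qed

text \<open>The factor \<open>k\<close> is there for the induction: each differentiation multiplies
  by \<open>a\<close>, and the derivative must have the same form again.\<close>

lemma Ck_affine:
  fixes \<phi> :: "'a::euclidean_space \<Rightarrow> real"
  shows "Ck n \<phi> \<Longrightarrow> Ck n (\<lambda>y. k * \<phi> (c + a *\<^sub>R y))"
proof (induction n arbitrary: \<phi> k)
  case 0
  have "continuous_on UNIV (\<lambda>y. \<phi> (c + a *\<^sub>R y))"
    by (rule continuous_on_compose2[of UNIV \<phi>]) (use 0 in \<open>auto intro!: continuous_intros\<close>)
  then show ?case by (auto intro: continuous_intros)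
next
  case (Suc n)
  have d: "(\<phi> has_derivative frechet_derivative \<phi> (at z)) (at z)" for z
    using Suc.prems by (auto simp: differentiable_on_def frechet_derivative_works)
  have D: "((\<lambda>y. k * \<phi> (c + a *\<^sub>R y)) has_derivative
      (\<lambda>w. k * a * frechet_derivative \<phi> (at (c + a *\<^sub>R y)) w)) (at y)" for y
  proof -
    have "((\<lambda>y. c + a *\<^sub>R y) has_derivative (\<lambda>w. a *\<^sub>R w)) (at y)"
      by (auto intro!: derivative_eq_intros)
    from has_derivative_mult_right[OF has_derivative_compose[OF this d], of k]
    show ?thesis
      by (simp add: linear_cmul[OF has_derivative_linear[OF d]] mult.assoc)
  qed
  then have "frechet_derivative (\<lambda>y. k * \<phi> (c + a *\<^sub>R y)) (at y) = 
      (\<lambda>w. k * a * frechet_derivative \<phi> (at (c + a *\<^sub>R y)) w)" for y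
    using frechet_derivative_at by metis
  moreover have "Ck n (\<lambda>y. k * a * frechet_derivative \<phi> (at (c + a *\<^sub>R y)) b)" if "b \<in> Basis" for b
    by (rule Suc.IH) (use Suc.prems that in simp)
  ultimately show ?case
    using D by (auto simp: differentiable_on_def differentiable_def)
qed

text \<open>\<open>Ck\<close> speaks of basis directions only. Linearity of the derivative extends
  continuity to every direction, and vanishing outside a ball turns continuity into
  boundedness.\<close>

lemma Ck_Suc_bounded_diff:
  fixes \<phi> :: "'a::euclidean_space \<Rightarrow> real"
  assumes C: "Ck (Suc 0) \<phi>" and supp: "\<And>z. norm z > R \<Longrightarrow> \<phi> z = 0"
  shows "bounded_diff \<phi> (\<lambda>w z. frechet_derivative \<phi> (at z) w)"
proof -
  have d: "(\<phi> has_derivative frechet_derivative \<phi> (at z)) (at z)" for z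
    using C by (auto simp: differentiable_on_def frechet_derivative_works)
  note lin = has_derivative_linear[OF d]
  have cont: "continuous_on UNIV \<phi>"
    using C by (auto intro: differentiable_imp_continuous_on)
  have contD: "continuous_on UNIV (\<lambda>z. frechet_derivative \<phi> (at z) w)" for w
  proof -
    have "frechet_derivative \<phi> (at z) w = (\<Sum>b\<in>Basis. (w \<bullet> b) * frechet_derivative \<phi> (at z) b)" for z
    proof -
      have "frechet_derivative \<phi> (at z) (\<Sum>b\<in>Basis. (w \<bullet> b) *\<^sub>R b) =
          (\<Sum>b\<in>Basis. (w \<bullet> b) * frechet_derivative \<phi> (at z) b)"
        by (simp add: linear_sum[OF lin] linear_cmul[OF lin])
      then show ?thesis by (simp add: euclidean_representation)
    qed
    moreover have "continuous_on UNIV (\<lambda>z. \<Sum>b\<in>Basis. (w \<bullet> b) * frechet_derivative \<phi> (at z) b)"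
      using C by (intro continuous_intros) auto
    ultimately show ?thesis by simp
  qed
  have D: "((\<lambda>s. \<phi> (z + s *\<^sub>R w)) has_real_derivative frechet_derivative \<phi> (at (z + s *\<^sub>R w)) w) (at s)" for z w s
  proof -
    have "((\<lambda>s. z + s *\<^sub>R w) has_derivative (\<lambda>t. t *\<^sub>R w)) (at s)"
      by (auto intro!: derivative_eq_intros)
    from has_derivative_compose[OF this d] show ?thesis
      by (simp add: has_field_derivative_def linear_cmul[OF lin] mult_commute_abs)
  qed
  have suppD: "frechet_derivative \<phi> (at z) w = 0" if "norm z > R" for z w
  proof -
    have "(\<phi> has_derivative (\<lambda>w. 0)) (at z)"
      by (rule has_derivative_transform_within_open[where s = "{z. norm z > R}" and f = "\<lambda>_. 0"])
        (use that supp in \<open>auto intro!: open_Collect_less continuous_intros\<close>)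
    then show ?thesis using frechet_derivative_at by metis
  qed
  have bdd: "\<exists>C. \<forall>z. \<bar>f z\<bar> \<le> C" if "continuous_on UNIV f" "\<And>z. norm z > R \<Longrightarrow> f z = 0" for f :: "'a \<Rightarrow> real"
  proof -
    have "bounded (f ` cball 0 R)"
      by (intro compact_imp_bounded compact_continuous_image continuous_on_subset[OF that(1)]) auto
    then obtain B where "\<And>z. norm z \<le> R \<Longrightarrow> \<bar>f z\<bar> \<le> B" unfolding bounded_iff by (metis image_eqI mem_cball_0 real_norm_def)
    then have "\<bar>f z\<bar> \<le> max B 0" for z using that(2)[of z] by (cases "norm z \<le> R") fastforce+
    then show ?thesis by blast
  qed
  show ?thesis
    unfolding bounded_diff_def
    using bdd[OF cont supp] bdd[OF contD suppD] lin D
    by (auto intro!: borel_measurable_continuous_onI cont contD)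
qed

section \<open>Mollifiers\<close>

definition mollifier :: "real \<Rightarrow> 'a::euclidean_space \<Rightarrow> real" where
  "mollifier \<epsilon> z = flat_exp 0 (1 - (z /\<^sub>R \<epsilon>) \<bullet> (z /\<^sub>R \<epsilon>)) / (LBINT z. flat_exp 0 (1 - ((z::'a) /\<^sub>R \<epsilon>) \<bullet> (z /\<^sub>R \<epsilon>)))"

lemma Ck_mollifier_affine: "Ck n (\<lambda>y. mollifier \<epsilon> (c + a *\<^sub>R y))"
proof -
  have "Ck n (\<lambda>y. k * flat_exp 0 (1 - (c /\<^sub>R \<epsilon> + (a / \<epsilon>) *\<^sub>R y) \<bullet> (c /\<^sub>R \<epsilon> + (a / \<epsilon>) *\<^sub>R y)))" for k
    by (rule Ck_affine[OF Ck_bump_class[OF bump_class.base]])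
  from this[of "1 / (LBINT z. flat_exp 0 (1 - ((z::'a) /\<^sub>R \<epsilon>) \<bullet> (z /\<^sub>R \<epsilon>)))"]
  show ?thesis by (simp add: mollifier_def scaleR_add_right divide_inverse_commute)
qed

lemma Ck_mollifier: "Ck n (mollifier \<epsilon>)"
  using Ck_mollifier_affine[of n \<epsilon> 0 1] by simp

lemma mollifier_nonneg: "mollifier \<epsilon> z \<ge> 0"
  by (simp add: mollifier_def flat_exp_nonneg)

lemma mollifier_minus: "mollifier \<epsilon> (- z) = mollifier \<epsilon> z"
  by (simp add: mollifier_def)

lemma mollifier_eq_0:
  assumes "\<epsilon> > 0" "norm z \<ge> \<epsilon>"
  shows "mollifier \<epsilon> z = 0"
proof -
  have "(z /\<^sub>R \<epsilon>) \<bullet> (z /\<^sub>R \<epsilon>) = (norm z / \<epsilon>)\<^sup>2"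
    using assms by (simp add: dot_square_norm[symmetric] power_divide power2_norm_eq_inner) (simp add: divide_inverse power2_eq_square)
  also have "\<dots> \<ge> 1" using assms by (intro one_le_power) auto
  finally show ?thesis by (simp add: mollifier_def flat_exp_def)
qed

lemma bounded_diff_mollifier:
  assumes "\<epsilon> > 0"
  shows "bounded_diff (mollifier \<epsilon>) (\<lambda>w z. frechet_derivative (mollifier \<epsilon>) (at z) w)"
  by (rule Ck_Suc_bounded_diff[where R = \<epsilon>]) (use assms in \<open>auto intro!: Ck_mollifier mollifier_eq_0 simp del: Ck.simps\<close>)

lemma measurable_mollifier [measurable]: "mollifier \<epsilon> \<in> borel_measurable borel"
  using Ck_mollifier[of 0 \<epsilon>] by (auto intro: borel_measurable_continuous_onI)

lemma integrable_mollifier: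
  assumes "\<epsilon> > 0"
  shows "integrable lborel (mollifier \<epsilon> :: 'a::euclidean_space \<Rightarrow> real)"
proof -
  obtain C where "\<And>z::'a. \<bar>mollifier \<epsilon> z\<bar> \<le> C"
    using bounded_diff_bound[OF bounded_diff_mollifier[OF assms]] by blast
  then show ?thesis
    by (intro integrable_bounded_support[where R = \<epsilon> and C = C]) (use assms in \<open>auto intro!: mollifier_eq_0\<close>)
qed

text \<open>The kernel is the bump divided by its own integral at the same \<epsilon>, so what has
  to be checked is that this integral is not zero. Otherwise the bump would vanish almost
  everywhere, yet it is nonzero on a ball.\<close>

lemma integral_mollifier:
  assumes "\<epsilon> > 0"
  shows "(LBINT z. mollifier \<epsilon> (z::'a::euclidean_space)) = 1"
proof -
  define b where "b z = flat_exp 0 (1 - ((z::'a) /\<^sub>R \<epsilon>) \<bullet> (z /\<^sub>R \<epsilon>))" for z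
  have Cb: "Ck 0 b"
    unfolding b_def using Ck_affine[OF Ck_bump_class[OF bump_class.base], of 0 1 0 0 "1 / \<epsilon>"]
    by (simp add: divide_inverse)
  have [measurable]: "b \<in> borel_measurable borel"
    using Cb by (auto intro: borel_measurable_continuous_onI)
  have b01: "0 \<le> b z" "b z \<le> 1" for z by (auto simp: b_def flat_exp_def)
  have supp: "b z = 0" if "norm z > \<epsilon>" for z
  proof -
    have "(z /\<^sub>R \<epsilon>) \<bullet> (z /\<^sub>R \<epsilon>) = (norm z / \<epsilon>)\<^sup>2"
      using assms by (simp add: dot_square_norm[symmetric] power_divide power2_norm_eq_inner) (simp add: divide_inverse power2_eq_square)
    also have "\<dots> \<ge> 1" using assms that by (intro one_le_power) auto
    finally show ?thesis by (simp add: b_def flat_exp_def)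
  qed
  have int: "integrable lborel b"
    by (rule integrable_bounded_support[where C = 1 and R = \<epsilon>]) (use b01 supp in auto)
  have "(LBINT z. b z) \<noteq> 0"
  proof
    assume "(LBINT z. b z) = 0"
    then have "AE z in lborel. b z = 0"
      using integral_nonneg_eq_0_iff_AE[OF int] b01 by auto
    moreover have "b z \<noteq> 0" if "z \<in> ball 0 \<epsilon>" for z
    proof -
      have "(z /\<^sub>R \<epsilon>) \<bullet> (z /\<^sub>R \<epsilon>) = (norm z / \<epsilon>)\<^sup>2"
        using assms by (simp add: dot_square_norm[symmetric] power_divide power2_norm_eq_inner) (simp add: divide_inverse power2_eq_square)
      also have "\<dots> < 1" using that assms by (intro power_less_one_iff[THEN iffD2]) auto
      finally show ?thesis by (simp add: b_def flat_exp_def)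
    qed
    ultimately have "AE z in lborel. z \<notin> ball (0::'a) \<epsilon>" by (auto elim: eventually_mono)
    then have "ball (0::'a) \<epsilon> \<in> null_sets lborel"
      by (subst AE_iff_null_sets) auto
    then have "negligible (ball (0::'a) \<epsilon>)"
      by (simp add: negligible_iff_null_sets null_sets_completionI)
    then show False
      using open_not_negligible[of "ball (0::'a) \<epsilon>"] assms by simp
  qed
  then show ?thesis by (simp add: mollifier_def b_def[symmetric] del: inner_scaleR_left inner_scaleR_right)
qed

lemma mollifier_test_function:
  assumes "\<epsilon> > 0" "cball z \<epsilon> \<subseteq> Q"
  shows "(\<lambda>y. mollifier \<epsilon> (z - y)) \<in> test_functions Q"
proof -
  have "Ck n (\<lambda>y. mollifier \<epsilon> (z - y))" for n
    using Ck_mollifier_affine[of n \<epsilon> z "-1"] by simp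
  moreover have "y \<in> cball z \<epsilon>" if "mollifier \<epsilon> (z - y) \<noteq> 0" for y
    using mollifier_eq_0[of \<epsilon> "z - y"] that assms by (force simp: dist_norm)
  then have "closure {y. mollifier \<epsilon> (z - y) \<noteq> 0} \<subseteq> cball z \<epsilon>"
    by (intro closure_minimal) auto
  moreover from this have "compact (closure {y. mollifier \<epsilon> (z - y) \<noteq> 0})"
    by (meson bounded_cball bounded_subset closed_closure compact_eq_bounded_closed)
  ultimately show ?thesis using assms by (auto simp: test_functions_def)
qed

section \<open>Convolution\<close>

definition conv :: "('a::euclidean_space \<Rightarrow> real) \<Rightarrow> ('a \<Rightarrow> real) \<Rightarrow> 'a \<Rightarrow> real" where
  "conv J f z = (LBINT y. J (z - y) * f y)"

lemma measurable_conv: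
  assumes [measurable]: "J \<in> borel_measurable borel" "f \<in> borel_measurable borel"
  shows "conv J f \<in> borel_measurable borel"
  unfolding conv_def by measurable

lemma square_integrable_bounded_support:
  fixes J :: "'a::euclidean_space \<Rightarrow> real"
  assumes [measurable]: "J \<in> borel_measurable borel" and C: "\<And>z. \<bar>J z\<bar> \<le> C"
    and R: "\<And>z. norm z > R \<Longrightarrow> J z = 0"
  shows "square_integrable lborel J"
  unfolding square_integrable_def
proof
  have "C \<ge> 0" using C[of 0] by linarith
  then have "(J z)\<^sup>2 \<le> C\<^sup>2" for z using power_mono[OF C, of z 2] by simp
  then show "integrable lborel (\<lambda>x. (J x)\<^sup>2)"
    by (intro integrable_bounded_support[where C = "C\<^sup>2" and R = R]) (auto simp: R)
qed simp

lemma abs_conv_le: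
  assumes J: "square_integrable lborel J" and f: "square_integrable lborel f"
  shows "\<bar>conv J f z\<bar> \<le> sqrt (LBINT y. (J y)\<^sup>2) * sqrt (LBINT y. (f y)\<^sup>2)"
proof -
  have "(LBINT y. (J (z - y))\<^sup>2) = (LBINT y. (J y)\<^sup>2)"
    using J by (intro integral_reflect[of "\<lambda>y. (J y)\<^sup>2"]) (auto simp: square_integrable_def)
  then show ?thesis
    using Cauchy_Schwarz_integral_sqrt[OF square_integrable_reflect[OF J, of z] f] by (simp add: conv_def)
qed

lemma bounded_diff_conv:
  assumes J: "bounded_diff J J'" and R: "\<And>z. norm z > R \<Longrightarrow> J z = 0"
    and f: "square_integrable lborel f"
  shows "bounded_diff (conv J f) (\<lambda>w. conv (J' w) f)"
proof -
  note [measurable] = bounded_diff_measurable[OF J]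
  have [measurable]: "f \<in> borel_measurable borel" using f by (simp add: square_integrable_def)
  have R': "J' w z = 0" if "norm z > R" for w z
    using bounded_diff_deriv_eq_0[OF J R that] .
  have sqJ: "square_integrable lborel J"
    using bounded_diff_bound[OF J] square_integrable_bounded_support[OF bounded_diff_measurable(1)[OF J]] R by metis
  have sqJ': "square_integrable lborel (J' w)" for w
    using bounded_diff_deriv_bound[OF J, of w] square_integrable_bounded_support[OF bounded_diff_measurable(2)[OF J]] R'
    by metis
  have int: "integrable lborel (\<lambda>y. J (z - y) * f y)" for z
    by (intro square_integrable_mult square_integrable_reflect sqJ f)
  have int': "integrable lborel (\<lambda>y. J' w (z - y) * f y)" for w z
    by (intro square_integrable_mult square_integrable_reflect sqJ' f)
  have lin: "linear (\<lambda>w. conv (J' w) f z)" for z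
  proof (rule linearI)
    note l = bounded_diff_linear[OF J]
    show "conv (J' (a + b)) f z = conv (J' a) f z + conv (J' b) f z" for a b
      using int'[of a z] int'[of b z] by (simp add: conv_def linear_add[OF l] algebra_simps)
    show "conv (J' (c *\<^sub>R a)) f z = c *\<^sub>R conv (J' a) f z" for a c
      by (simp add: conv_def linear_cmul[OF l] mult.assoc)
  qed
  have deriv: "((\<lambda>s. conv J f (z + s *\<^sub>R w)) has_real_derivative conv (J' w) f (z + s0 *\<^sub>R w)) (at s0)" for z w s0
  proof -
    obtain D where D: "D \<ge> 0" "\<And>z. \<bar>J' w z\<bar> \<le> D" using bounded_diff_deriv_bound[OF J] by blast
    \<comment> \<open>For |s - s0| < 1 the functions y -> J (z + s w - y) all live in the ball of
      radius \<open>R + norm w\<close> about this point. As \<open>f\<close> is only square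
      integrable, the dominating function is a multiple of |f| cut off to that ball.\<close>
    define c where "c = z + s0 *\<^sub>R w"
    have "square_integrable lborel (\<lambda>y. indicator (cball c (R + norm w)) y)"
    proof (rule square_integrable_bounded_support[where C = 1 and R = "norm c + R + norm w"])
      fix x :: 'a assume "norm x > norm c + R + norm w"
      then show "indicat_real (cball c (R + norm w)) x = 0"
        using norm_triangle_sub[of x c] by (auto simp: dist_norm norm_minus_commute indicator_def)
    qed (auto simp: indicator_def)
    then have "integrable lborel (\<lambda>y. f y * indicator (cball c (R + norm w)) y)"
      by (rule square_integrable_mult[OF f])
    then have "integrable lborel (\<lambda>y. D * \<bar>f y * indicator (cball c (R + norm w)) y\<bar>)"
      by simp
    then have wint: "integrable lborel (\<lambda>y. D * (\<bar>f y\<bar> * indicator (cball c (R + norm w)) y))"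
      by (simp add: abs_mult)
    show ?thesis
      unfolding conv_def
    proof (rule has_real_derivative_integral[OF _ _ _ wint])
      fix s :: real assume s: "\<bar>s - s0\<bar> < 1"
      show "((\<lambda>s. J (z + s *\<^sub>R w - y) * f y) has_real_derivative J' w (z + s *\<^sub>R w - y) * f y) (at s)" for y
        using bounded_diff_deriv[OF J, where z = "z - y" and w = w and s = s]
        by (intro DERIV_cmult_right) (simp add: algebra_simps)
      show "\<bar>J' w (z + s *\<^sub>R w - y) * f y\<bar> \<le> D * (\<bar>f y\<bar> * indicator (cball c (R + norm w)) y)" for y
      proof (cases "y \<in> cball c (R + norm w)")
        case True
        then show ?thesis using D by (simp add: abs_mult mult_right_mono)
      next
        case False
        have "norm ((s - s0) *\<^sub>R w) \<le> 1 * norm w"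
          unfolding norm_scaleR using s by (intro mult_right_mono) auto
        then have "norm ((c - y) + (s - s0) *\<^sub>R w) > R"
          using False norm_diff_ineq[of "c - y" "(s - s0) *\<^sub>R w"] by (simp add: dist_norm)
        moreover have "(c - y) + (s - s0) *\<^sub>R w = z + s *\<^sub>R w - y" by (simp add: c_def algebra_simps)
        ultimately have "norm (z + s *\<^sub>R w - y) > R" by simp
        then show ?thesis using R' False by simp
      qed
    qed (auto intro!: int)
  qed
  have "\<exists>C. \<forall>z. \<bar>conv J f z\<bar> \<le> C" "\<exists>C. \<forall>z. \<bar>conv (J' w) f z\<bar> \<le> C" for w
    using abs_conv_le[OF sqJ f] abs_conv_le[OF sqJ' f] by blast+
  then show ?thesis
    unfolding bounded_diff_def using lin deriv by (auto intro!: measurable_conv)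
qed

text \<open>The kernel is a probability density, so the error at \<open>z\<close> is the kernel
  average of increments of \<open>f\<close>. Cauchy-Schwarz with \<open>J\<close> split into two
  factors \<open>sqrt (J y)\<close> bounds its square by the average of the squared increments;
  after exchanging the integrals, the one in \<open>z\<close> is at most \<open>c\<close>.\<close>

lemma integral_conv_diff_le:
  fixes f :: "'a::euclidean_space \<Rightarrow> real"
  assumes f: "square_integrable lborel f" and "\<epsilon> > 0"
    and c: "\<And>h. norm h < \<epsilon> \<Longrightarrow> (LBINT x. (f (x + h) - f x)\<^sup>2) \<le> c"
  shows "square_integrable lborel (\<lambda>z. conv (mollifier \<epsilon>) f z - f z)"
    and "(LBINT z. (conv (mollifier \<epsilon>) f z - f z)\<^sup>2) \<le> c"
proof -
  define J :: "'a \<Rightarrow> real" where "J = mollifier \<epsilon>"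
  have [measurable]: "J \<in> borel_measurable borel" by (simp add: J_def)
  have [measurable]: "f \<in> borel_measurable borel" using f by (simp add: square_integrable_def)
  obtain C where C: "\<And>z. \<bar>J z\<bar> \<le> C"
    using bounded_diff_bound[OF bounded_diff_mollifier[OF \<open>\<epsilon> > 0\<close>]] unfolding J_def by blast
  have J0: "J z = 0" if "norm z \<ge> \<epsilon>" for z using mollifier_eq_0[OF \<open>\<epsilon> > 0\<close> that] by (simp add: J_def)
  have Jnn: "J z \<ge> 0" for z by (simp add: J_def mollifier_nonneg)
  have Jint: "integrable lborel J" "(LBINT y. J y) = 1"
    using integrable_mollifier[OF \<open>\<epsilon> > 0\<close>] integral_mollifier[OF \<open>\<epsilon> > 0\<close>] by (auto simp: J_def)
  have c0: "c \<ge> 0" using c[of 0] \<open>\<epsilon> > 0\<close> by simp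
  have sqJ: "square_integrable lborel J"
    by (rule square_integrable_bounded_support[where R = \<epsilon>]) (auto intro!: C J0)
  have sqrtJ: "square_integrable lborel (\<lambda>y. sqrt (J y))"
    using Jint Jnn by (simp add: square_integrable_def)
  have sqX: "square_integrable lborel (\<lambda>y. sqrt (J y) * (f (z - y) - f z))" for z
  proof -
    have "\<bar>sqrt (J y)\<bar> \<le> sqrt C" for y using C[of y] Jnn[of y] by simp
    then have "square_integrable lborel (\<lambda>y. sqrt (J y) * f (z - y))"
      by (intro square_integrable_bounded_mult[where C = "sqrt C"] square_integrable_reflect f) auto
    from square_integrable_diff[OF this square_integrable_cmult[OF sqrtJ, of "f z"]]
    show ?thesis by (simp add: algebra_simps)
  qed
  have point: "(conv J f z - f z)\<^sup>2 \<le> (LBINT y. J y * (f (z - y) - f z)\<^sup>2)" for z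
  proof -
    have "conv J f z = (LBINT y. J (z - (z - y)) * f (z - y))"
      unfolding conv_def by (rule integral_reflect[symmetric, of "\<lambda>y. J (z - y) * f y"]) measurable
    then have "conv J f z - f z = (LBINT y. J y * f (z - y)) - (LBINT y. J y * f z)"
      using Jint by simp
    also have "\<dots> = (LBINT y. J y * f (z - y) - J y * f z)"
      by (rule Bochner_Integration.integral_diff[symmetric, OF square_integrable_mult[OF sqJ square_integrable_reflect[OF f]] 
            integrable_mult_left[OF Jint(1)]])
    also have "\<dots> = (LBINT y. sqrt (J y) * (sqrt (J y) * (f (z - y) - f z)))"
    proof -
      have "sqrt (J y) * (sqrt (J y) * t) = J y * t" for y t
        using Jnn[of y] by (simp flip: mult.assoc)
      then show ?thesis by (simp only: right_diff_distrib)
    qed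
    finally have "(conv J f z - f z)\<^sup>2 \<le> (LBINT y. (sqrt (J y))\<^sup>2) * (LBINT y. (sqrt (J y) * (f (z - y) - f z))\<^sup>2)"
      using Cauchy_Schwarz_integral[OF sqrtJ sqX] by simp
    then show ?thesis using Jnn Jint by (simp add: power_mult_distrib)
  qed
  have intX: "integrable lborel (\<lambda>y. J y * (f (z - y) - f z)\<^sup>2)" for z
    using square_integrableD[OF sqX[of z]] Jnn by (simp add: power_mult_distrib)
  have "(\<integral>\<^sup>+z. ennreal ((conv J f z - f z)\<^sup>2) \<partial>lborel) \<le> (\<integral>\<^sup>+z. (\<integral>\<^sup>+y. ennreal (J y * (f (z - y) - f z)\<^sup>2) \<partial>lborel) \<partial>lborel)"
    using point intX Jnn by (intro nn_integral_mono) (auto simp: nn_integral_eq_integral intro!: ennreal_leI)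
  also have "\<dots> = (\<integral>\<^sup>+y. (\<integral>\<^sup>+z. ennreal (J y * (f (z - y) - f z)\<^sup>2) \<partial>lborel) \<partial>lborel)"
    by (rule lborel_pair.Fubini'[symmetric]) measurable
  also have "\<dots> \<le> (\<integral>\<^sup>+y. ennreal (J y * c) \<partial>lborel)"
  proof (intro nn_integral_mono)
    fix y :: 'a
    have int: "integrable lborel (\<lambda>z. (f (z - y) - f z)\<^sup>2)"
      using square_integrableD[OF square_integrable_diff[OF square_integrable_shift[OF f, of "-y"] f]] by simp
    show "(\<integral>\<^sup>+z. ennreal (J y * (f (z - y) - f z)\<^sup>2) \<partial>lborel) \<le> ennreal (J y * c)"
    proof (cases "norm y < \<epsilon>")
      case True
      have "(\<integral>\<^sup>+z. ennreal (J y * (f (z - y) - f z)\<^sup>2) \<partial>lborel) = ennreal (J y * (LBINT z. (f (z - y) - f z)\<^sup>2))"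
        using int Jnn by (subst nn_integral_eq_integral) auto
      also have "\<dots> \<le> ennreal (J y * c)"
        using c[of "- y"] True Jnn by (intro ennreal_leI mult_left_mono) auto
      finally show ?thesis .
    qed (simp add: J0)
  qed
  also have "\<dots> = ennreal c"
    using Jint Jnn c0 by (subst nn_integral_eq_integral) auto
  finally have le: "(\<integral>\<^sup>+z. ennreal ((conv J f z - f z)\<^sup>2) \<partial>lborel) \<le> ennreal c" .
  have [measurable]: "conv J f \<in> borel_measurable borel" by (rule measurable_conv) measurable
  have int: "integrable lborel (\<lambda>z. (conv J f z - f z)\<^sup>2)"
    using le by (intro integrableI_bounded) (auto simp: less_top[symmetric] top_unique)
  then show "square_integrable lborel (\<lambda>z. conv (mollifier \<epsilon>) f z - f z)"
    by (simp add: square_integrable_def J_def[symmetric])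
  show "(LBINT z. (conv (mollifier \<epsilon>) f z - f z)\<^sup>2) \<le> c"
    using le int c0 by (subst (asm) nn_integral_eq_integral) (auto simp: J_def[symmetric] ennreal_le_iff)
qed

lemma mollify_L2:
  fixes f :: "'a::euclidean_space \<Rightarrow> real"
  assumes f: "square_integrable lborel f" and "e > 0"
  obtains d where "d > 0" 
    "\<And>\<epsilon>. 0 < \<epsilon> \<Longrightarrow> \<epsilon> \<le> d \<Longrightarrow> square_integrable lborel (conv (mollifier \<epsilon>) f)
       \<and> (LBINT z. (conv (mollifier \<epsilon>) f z - f z)\<^sup>2) \<le> e"
proof -
  obtain d where d: "d > 0" "\<And>h. norm h < d \<Longrightarrow> (LBINT x. (f (x + h) - f x)\<^sup>2) < e"
    using L2_translation_continuous[OF assms] by blast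
  show ?thesis
  proof (rule that[OF d(1)])
    fix \<epsilon> :: real assume \<epsilon>: "0 < \<epsilon>" "\<epsilon> \<le> d"
    have le: "(LBINT x. (f (x + h) - f x)\<^sup>2) \<le> e" if "norm h < \<epsilon>" for h
      using d(2)[of h] that \<epsilon> by simp
    have "square_integrable lborel (\<lambda>z. (conv (mollifier \<epsilon>) f z - f z) + f z)"
      by (intro square_integrable_add integral_conv_diff_le(1)[OF f \<epsilon>(1) le] f)
    then show "square_integrable lborel (conv (mollifier \<epsilon>) f) \<and> (LBINT z. (conv (mollifier \<epsilon>) f z - f z)\<^sup>2) \<le> e"
      using integral_conv_diff_le(2)[OF f \<epsilon>(1) le] by simp
  qed
qed

section \<open>Compensated compactness for smooth solutions\<close>

lemma bounded_diff_compose_linear: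
  assumes f: "bounded_diff f f'" and A: "linear A"
  shows "bounded_diff (\<lambda>z. f (A z)) (\<lambda>w z. f' (A w) (A z))"
proof -
  have [measurable]: "A \<in> borel_measurable borel"
    using A by (intro borel_measurable_continuous_onI linear_continuous_on) (simp add: linear_conv_bounded_linear)
  have "((\<lambda>s. f (A (z + s *\<^sub>R w))) has_real_derivative f' (A w) (A (z + s *\<^sub>R w))) (at s)" for w z s
    using bounded_diff_deriv[OF f, where z = "A z" and w = "A w"] A by (simp add: linear_add linear_cmul)
  moreover have "(\<lambda>z. f (A z)) \<in> borel_measurable borel" "(\<lambda>z. f' (A w) (A z)) \<in> borel_measurable borel" for w
    using bounded_diff_measurable[OF f] by measurable
  moreover have "\<exists>C. \<forall>z. \<bar>f (A z)\<bar> \<le> C" "\<exists>C. \<forall>z. \<bar>f' (A w) (A z)\<bar> \<le> C" for w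
    using f unfolding bounded_diff_def by blast+
  moreover have "linear (\<lambda>w. f' (A w) (A z))" for z
    using linear_compose[OF A bounded_diff_linear[OF f, of "A z"]] by (simp add: comp_def)
  ultimately show ?thesis
    unfolding bounded_diff_def by blast
qed

lemma deriv_shifted_integral:
  assumes f: "bounded_diff f f'" and [measurable]: "c \<in> borel_measurable borel"
    and C: "\<And>z. \<bar>c z\<bar> \<le> C" and R: "\<And>z. norm z > R \<Longrightarrow> c z = 0"
  shows "((\<lambda>s. LBINT z. c z * f (z + s *\<^sub>R w)) has_real_derivative
     (LBINT z. c z * f' w (z + s0 *\<^sub>R w))) (at s0)"
proof -
  note [measurable] = bounded_diff_measurable[OF f]
  obtain B where B: "B \<ge> 0" "\<And>z. \<bar>f z\<bar> \<le> B" using bounded_diff_bound[OF f] by blast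
  obtain D where D: "D \<ge> 0" "\<And>z. \<bar>f' w z\<bar> \<le> D" using bounded_diff_deriv_bound[OF f] by blast
  have C0: "C \<ge> 0" using C[of 0] by linarith
  show ?thesis
  proof (rule has_real_derivative_integral[where w = "\<lambda>z. C * D * indicator (cball 0 R) z"])
    show "integrable lborel (\<lambda>z. c z * f (z + s *\<^sub>R w))" for s
      by (rule integrable_bounded_support[where C = "C * B" and R = R])
        (use R in \<open>auto simp: abs_mult intro!: mult_mono C B C0\<close>)
    show "((\<lambda>s. c z * f (z + s *\<^sub>R w)) has_real_derivative c z * f' w (z + s *\<^sub>R w)) (at s)" for s z
      by (intro DERIV_cmult bounded_diff_deriv[OF f])
    show "\<bar>c z * f' w (z + s *\<^sub>R w)\<bar> \<le> C * D * indicator (cball 0 R) z" for s z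
      using R[of z] by (cases "norm z > R") (auto simp: abs_mult intro!: mult_mono C D C0)
  qed (auto intro!: integrable_mult_right integrable_real_indicator emeasure_bounded_finite)
qed

lemma bounded_diff_lipschitz:
  assumes f: "bounded_diff f f'" and K: "\<And>z. \<bar>f' w z\<bar> \<le> K"
  shows "\<bar>f (z + w) - f z\<bar> \<le> K"
proof -
  obtain c where "f (z + 1 *\<^sub>R w) - f (z + 0 *\<^sub>R w) = (1 - 0) * f' w (z + c *\<^sub>R w)"
    using MVT2[of 0 1 "\<lambda>s. f (z + s *\<^sub>R w)" "\<lambda>s. f' w (z + s *\<^sub>R w)"] bounded_diff_deriv[OF f] by auto
  then show ?thesis using K by simp
qed

lemma abs_integral_mult_le:
  assumes "square_integrable M f" "square_integrable M g"
    "(\<integral>x. (f x)\<^sup>2 \<partial>M) \<le> A" "(\<integral>x. (g x)\<^sup>2 \<partial>M) \<le> B"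
  shows "\<bar>\<integral>x. f x * g x \<partial>M\<bar> \<le> A + B"
  using integral_mult_le_weighted_squares[OF assms(1,2), of 1] assms(3,4) by simp

section \<open>The null Lagrangian of spatial increments\<close>

abbreviation dir_x :: spacetime where "dir_x \<equiv> (axis 1 1, 0)"
abbreviation dir_y :: spacetime where "dir_y \<equiv> (axis 2 1, 0)"
abbreviation dir_t :: spacetime where "dir_t \<equiv> (0, 1)"

text \<open>One mollified member of the sequence of differences from the weak limit. The equations
  hold classically on \<open>U\<close>, and every point where \<psi> does not vanish has a margin
  \<open>d\<close> for shifts inside \<open>U\<close>. The bounds \<open>M\<close> and
  \<open>K\<close> are parameters because the estimates must be uniform along the sequence;
  (\<epsilon>1, \<epsilon>2) is the vector e of the unit disc.\<close>

locale smooth_solution =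
  fixes r v1 v2 n1 n2 \<psi> :: "spacetime \<Rightarrow> real"
    and r' v1' v2' n1' n2' \<psi>' :: "spacetime \<Rightarrow> spacetime \<Rightarrow> real"
    and U :: "spacetime set" and d R M K \<epsilon>1 \<epsilon>2 :: real
  assumes r: "bounded_diff r r'" and v1: "bounded_diff v1 v1'" and v2: "bounded_diff v2 v2'"
    and n1: "bounded_diff n1 n1'" and n2: "bounded_diff n2 n2'" and \<psi>: "bounded_diff \<psi> \<psi>'"
    and sq: "square_integrable lborel r" "square_integrable lborel v1" "square_integrable lborel v2"
      "square_integrable lborel n1" "square_integrable lborel n2"
    and energy: "(LBINT z. (r z)\<^sup>2) \<le> M" "(LBINT z. (v1 z)\<^sup>2) \<le> M" "(LBINT z. (v2 z)\<^sup>2) \<le> M"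
      "(LBINT z. (n1 z)\<^sup>2) \<le> M" "(LBINT z. (n2 z)\<^sup>2) \<le> M"
    and div0: "\<And>z. z \<in> U \<Longrightarrow> v1' dir_x z + v2' dir_y z - r' dir_y z = 0"
    and curl0: "\<And>z. z \<in> U \<Longrightarrow> v2' dir_x z + r' dir_x z - v1' dir_y z = 0"
    and transport: "\<And>z. z \<in> U \<Longrightarrow> r' dir_t z + n1' dir_x z + n2' dir_y z = 0"
    and \<psi>_nonneg: "\<And>z. 0 \<le> \<psi> z" and \<psi>_le: "\<And>z. \<psi> z \<le> K"
    and \<psi>'_le: "\<And>z. \<bar>\<psi>' dir_x z\<bar> \<le> K" "\<And>z. \<bar>\<psi>' dir_y z\<bar> \<le> K"
    and \<psi>_supp: "\<And>z. norm z > R \<Longrightarrow> \<psi> z = 0" and \<psi>_U: "\<And>z. \<psi> z \<noteq> 0 \<Longrightarrow> cball z d \<subseteq> U"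
    and d: "d > 0" and \<epsilon>: "\<epsilon>1\<^sup>2 + \<epsilon>2\<^sup>2 \<le> 1"
begin

lemma K_nonneg: "K \<ge> 0" using \<psi>_nonneg[of 0] \<psi>_le[of 0] by linarith

lemma M_nonneg: "M \<ge> 0"
proof -
  have "0 \<le> (LBINT z. (r z)\<^sup>2)" by simp
  then show ?thesis using energy(1) by linarith
qed

lemmas meas [measurable] = bounded_diff_measurable[OF r] bounded_diff_measurable[OF v1] bounded_diff_measurable[OF v2]
  bounded_diff_measurable[OF n1] bounded_diff_measurable[OF n2] bounded_diff_measurable[OF \<psi>]

definition b where "b z = r z - (\<epsilon>1 * v1 z + \<epsilon>2 * v2 z)"

definition B where "B \<zeta> = (LBINT z. \<psi> z * b z * r (z - \<zeta>))"

lemma b_measurable [measurable]: "b \<in> borel_measurable borel"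
  unfolding b_def by measurable

lemma sq_b: "square_integrable lborel b"
  unfolding b_def by (intro square_integrable_diff square_integrable_add square_integrable_cmult sq)

text \<open>As e lies in the unit disc, |v . e| <= |v| by the two-dimensional Lagrange identity. The
  constant is 2 M for \<open>r\<close> plus twice 2 M for the two components of v.\<close>

lemma energy_b: "(LBINT z. (b z)\<^sup>2) \<le> 6 * M"
proof -
  have v: "(\<epsilon>1 * v1 z + \<epsilon>2 * v2 z)\<^sup>2 \<le> (v1 z)\<^sup>2 + (v2 z)\<^sup>2" for z
  proof -
    have "(\<epsilon>1 * v1 z + \<epsilon>2 * v2 z)\<^sup>2 \<le> (\<epsilon>1 * v1 z + \<epsilon>2 * v2 z)\<^sup>2 + (\<epsilon>1 * v2 z - \<epsilon>2 * v1 z)\<^sup>2" by simp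
    also have "\<dots> = (\<epsilon>1\<^sup>2 + \<epsilon>2\<^sup>2) * ((v1 z)\<^sup>2 + (v2 z)\<^sup>2)"
      by (simp add: power2_eq_square algebra_simps)
    also have "\<dots> \<le> 1 * ((v1 z)\<^sup>2 + (v2 z)\<^sup>2)" using \<epsilon> by (intro mult_right_mono) auto
    finally show ?thesis by simp
  qed
  have "(LBINT z. (\<epsilon>1 * v1 z + \<epsilon>2 * v2 z)\<^sup>2) \<le> (LBINT z. (v1 z)\<^sup>2 + (v2 z)\<^sup>2)"
    using v sq by (intro integral_mono square_integrableD square_integrable_add square_integrable_cmult)
      (auto simp: square_integrable_def)
  also have "\<dots> \<le> 2 * M" using energy sq by (simp add: square_integrable_def)
  finally show ?thesis
    using integral_square_diff_le[OF sq(1) square_integrable_add[OF square_integrable_cmult[OF sq(2)] square_integrable_cmult[OF sq(3)]],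
        of \<epsilon>1 \<epsilon>2] energy(1) by (simp add: b_def)
qed

lemma \<psi>b_bound:
  obtains C where "C \<ge> 0" "\<And>z. \<bar>\<psi> z * b z\<bar> \<le> C"
proof -
  have "bounded_diff (\<lambda>z. \<psi> z * b z) (\<lambda>w z. \<psi>' w z * b z + \<psi> z * (r' w z - (\<epsilon>1 * v1' w z + \<epsilon>2 * v2' w z)))"
    unfolding b_def by (intro bounded_diff_mult bounded_diff_diff bounded_diff_add bounded_diff_cmult \<psi> r v1 v2)
  from bounded_diff_bound[OF this] that show thesis by blast
qed

lemma sq_\<psi>b: "square_integrable lborel (\<lambda>z. \<psi> z * b z)"
  using \<psi>_nonneg \<psi>_le by (intro square_integrable_bounded_mult[where C = K] sq_b) auto

lemma energy_\<psi>b: "(LBINT z. (\<psi> z * b z)\<^sup>2) \<le> K\<^sup>2 * (6 * M)"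
proof -
  have "(LBINT z. (\<psi> z * b z)\<^sup>2) \<le> (LBINT z. K\<^sup>2 * (b z)\<^sup>2)"
    using sq_\<psi>b sq_b \<psi>_nonneg \<psi>_le
    by (intro integral_mono) (auto simp: square_integrable_def power_mult_distrib intro!: mult_right_mono power_mono)
  also have "\<dots> \<le> K\<^sup>2 * (6 * M)" using energy_b by (auto intro!: mult_left_mono)
  finally show ?thesis .
qed

text \<open>\<open>(v1, v2 + r)\<close> is curl-free and \<open>(v1, v2 - r)\<close> is divergence-free, so their product is a
  null Lagrangian. Along the segment from \<open>z\<close> to \<open>z - Y\<close> the derivative of the curl-free field
  in direction \<open>Y\<close> is the gradient of its component along \<open>Y\<close>, which is \<open>O(Y)\<close>.\<close>

lemma null_lagrangian_increment:
  fixes \<alpha> \<beta> \<delta> :: real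
  defines "Y \<equiv> \<alpha> *\<^sub>R dir_x + \<beta> *\<^sub>R dir_y"
  assumes Yd: "norm Y \<le> d" and ab: "\<bar>\<alpha>\<bar> \<le> \<delta>" "\<bar>\<beta>\<bar> \<le> \<delta>"
  shows "\<bar>LBINT z. \<psi> z * ((v1 z - v1 (z - Y))\<^sup>2 + (v2 z - v2 (z - Y))\<^sup>2 - (r z - r (z - Y))\<^sup>2)\<bar>
     \<le> \<delta> * (5 * M + 80 * K\<^sup>2 * M)"
proof -
  define g2 where "g2 z = v2 z + r z" for z
  define g2' where "g2' w z = v2' w z + r' w z" for w z
  define D2 where "D2 z = v2 z - r z" for z
  define D2' where "D2' w z = v2' w z - r' w z" for w z
  define \<Delta>1 where "\<Delta>1 z = v1 z - v1 (z + (- Y))" for z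
  define \<Delta>1' where "\<Delta>1' w z = v1' w z - v1' w (z + (- Y))" for w z
  define \<Delta>2 where "\<Delta>2 z = D2 z - D2 (z + (- Y))" for z
  define \<Delta>2' where "\<Delta>2' w z = D2' w z - D2' w (z + (- Y))" for w z
  have bd: "bounded_diff g2 g2'" "bounded_diff D2 D2'"
    unfolding g2_def g2'_def D2_def D2'_def by (intro bounded_diff_add bounded_diff_diff v2 r)+
  have bd\<Delta>: "bounded_diff \<Delta>1 \<Delta>1'" "bounded_diff \<Delta>2 \<Delta>2'"
    unfolding \<Delta>1_def \<Delta>1'_def \<Delta>2_def \<Delta>2'_def by (intro bounded_diff_diff bounded_diff_shift v1 bd)+
  note [measurable] = bounded_diff_measurable[OF bd(1)] bounded_diff_measurable[OF bd(2)]
    bounded_diff_measurable[OF bd\<Delta>(1)] bounded_diff_measurable[OF bd\<Delta>(2)]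
  have sqg: "square_integrable lborel g2" "square_integrable lborel D2"
    unfolding g2_def D2_def by (intro square_integrable_add square_integrable_diff sq)+
  have eg: "(LBINT z. (g2 z)\<^sup>2) \<le> 4 * M" "(LBINT z. (D2 z)\<^sup>2) \<le> 4 * M"
    using integral_square_add_le[OF sq(3,1)] integral_square_diff_le[OF sq(3,1)] energy
    by (auto simp: g2_def D2_def)
  have sq\<Delta>: "square_integrable lborel \<Delta>1" "square_integrable lborel \<Delta>2"
    unfolding \<Delta>1_def \<Delta>2_def by (intro square_integrable_diff square_integrable_shift sq sqg)+
  have incr: "(LBINT z. (f z - f (z + (- Y)))\<^sup>2) \<le> 4 * A"
    if "square_integrable lborel f" "(LBINT z. (f z)\<^sup>2) \<le> A" for f A
  proof -
    have "(LBINT z. (f (z + (- Y)))\<^sup>2) = (LBINT z. (f z)\<^sup>2)"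
      using that by (intro integral_shift[of "\<lambda>z. (f z)\<^sup>2"]) (auto simp: square_integrable_def)
    then show ?thesis
      using integral_square_diff_le[OF that(1) square_integrable_shift[OF that(1), of "- Y"]] that(2) by simp
  qed
  have e\<Delta>: "(LBINT z. (\<Delta>1 z)\<^sup>2) \<le> 4 * M" "(LBINT z. (\<Delta>2 z)\<^sup>2) \<le> 16 * M"
    using incr[OF sq(2) energy(2)] incr[OF sqg(2) eg(2)] by (auto simp: \<Delta>1_def \<Delta>2_def)
  define X where "X z = \<psi>' dir_x z * \<Delta>1 z + \<psi>' dir_y z * \<Delta>2 z" for z
  have sqX1: "square_integrable lborel (\<lambda>z. \<psi>' dir_x z * \<Delta>1 z)" "square_integrable lborel (\<lambda>z. \<psi>' dir_y z * \<Delta>2 z)"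
    using \<psi>'_le by (auto intro!: square_integrable_bounded_mult[where C = K] sq\<Delta>)
  have sqX: "square_integrable lborel X"
    unfolding X_def by (intro square_integrable_add sqX1)
  have mono_K: "(LBINT z. (h z * f z)\<^sup>2) \<le> K\<^sup>2 * A"
    if "square_integrable lborel f" "(LBINT z. (f z)\<^sup>2) \<le> A" "square_integrable lborel (\<lambda>z. h z * f z)" "\<And>z. \<bar>h z\<bar> \<le> K" 
    for f h :: "spacetime \<Rightarrow> real" and A
  proof -
    have "(h z)\<^sup>2 \<le> K\<^sup>2" for z using power_mono[OF that(4)[of z], of 2] by simp
    then have "(LBINT z. (h z * f z)\<^sup>2) \<le> (LBINT z. K\<^sup>2 * (f z)\<^sup>2)"
      using that by (intro integral_mono) (auto simp: square_integrable_def power_mult_distrib intro!: mult_right_mono)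
    also have "\<dots> \<le> K\<^sup>2 * A" using that(2) by (auto intro!: mult_left_mono)
    finally show ?thesis .
  qed
  \<comment> \<open>Origin of 40: the increments have energies at most 4 M and 16 M, the derivatives
    of \<psi> contribute K^2, and squaring the sum costs a factor 2.\<close>
  have eX: "(LBINT z. (X z)\<^sup>2) \<le> 40 * K\<^sup>2 * M"
    using integral_square_add_le[OF sqX1] mono_K[OF sq\<Delta>(1) e\<Delta>(1) sqX1(1) \<psi>'_le(1)]
      mono_K[OF sq\<Delta>(2) e\<Delta>(2) sqX1(2) \<psi>'_le(2)] by (simp add: X_def)
  \<comment> \<open>The divergence-free increment is paired with the curl-free field moved along the
    segment: \<open>G 0 - G 1\<close> is the integral to be estimated, and the mean value theorem
    reduces the claim to a bound on \<open>G'\<close>.\<close>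
  define G where "G s = (LBINT z. \<psi> z * \<Delta>1 z * v1 (z + s *\<^sub>R (- Y))) + (LBINT z. \<psi> z * \<Delta>2 z * g2 (z + s *\<^sub>R (- Y)))" for s
  define G' where "G' s = (LBINT z. \<psi> z * \<Delta>1 z * v1' (- Y) (z + s *\<^sub>R (- Y))) + (LBINT z. \<psi> z * \<Delta>2 z * g2' (- Y) (z + s *\<^sub>R (- Y)))" for s
  have bd\<psi>\<Delta>: "bounded_diff (\<lambda>z. \<psi> z * \<Delta>1 z) (\<lambda>w z. \<psi>' w z * \<Delta>1 z + \<psi> z * \<Delta>1' w z)"
    "bounded_diff (\<lambda>z. \<psi> z * \<Delta>2 z) (\<lambda>w z. \<psi>' w z * \<Delta>2 z + \<psi> z * \<Delta>2' w z)"
    by (intro bounded_diff_mult \<psi> bd\<Delta>)+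
  have supp: "norm z > R \<Longrightarrow> \<psi> z * f z = 0" for z f using \<psi>_supp by simp
  have int: "integrable lborel (\<lambda>z. \<psi> z * f z * h z)" if f: "bounded_diff (\<lambda>z. \<psi> z * f z) f'" 
      and h: "h \<in> borel_measurable borel" "\<And>z. \<bar>h z\<bar> \<le> H" for f f' h H
  proof -
    obtain C where C: "C \<ge> 0" "\<And>z. \<bar>\<psi> z * f z\<bar> \<le> C" using bounded_diff_bound[OF f] by blast
    show ?thesis
    proof (rule integrable_bounded_support[where C = "C * H" and R = R])
      show "\<bar>\<psi> z * f z * h z\<bar> \<le> C * H" for z
        unfolding abs_mult[of "\<psi> z * f z"] using C h(2) by (intro mult_mono) auto
      show "(\<lambda>z. \<psi> z * f z * h z) \<in> borel_measurable borel"
        using bounded_diff_measurable(1)[OF f] h(1) by measurable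
    qed (simp add: \<psi>_supp)
  qed
  have "(G has_real_derivative G' s) (at s)" for s
  proof -
    obtain C1 where "\<And>z. \<bar>\<psi> z * \<Delta>1 z\<bar> \<le> C1" using bounded_diff_bound[OF bd\<psi>\<Delta>(1)] by blast
    moreover obtain C2 where "\<And>z. \<bar>\<psi> z * \<Delta>2 z\<bar> \<le> C2" using bounded_diff_bound[OF bd\<psi>\<Delta>(2)] by blast
    ultimately show ?thesis
      unfolding G_def G'_def
      by (intro DERIV_add deriv_shifted_integral[where R = R] v1 bd(1)) (auto simp: \<psi>_supp)
  qed
  moreover have G'_bound: "\<bar>G' s\<bar> \<le> \<delta> * (5 * M + 80 * K\<^sup>2 * M)" if "0 \<le> s" "s \<le> 1" for s
  proof -
    define S where "S z = z + s *\<^sub>R (- Y)" for z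
    \<comment> \<open>The component along \<open>Y\<close> of the curl-free field (v1, g2) at the
      moved point. Symmetry of the Jacobian makes its spatial gradient the directional derivative of
      that field along \<open>Y\<close>.\<close>
    define h where "h z = \<alpha> * v1 (S z) + \<beta> * g2 (S z)" for z
    define h' where "h' w z = \<alpha> * v1' w (S z) + \<beta> * g2' w (S z)" for w z
    have bdh: "bounded_diff h h'"
      unfolding h_def h'_def S_def by (intro bounded_diff_add bounded_diff_cmult bounded_diff_shift v1 bd)
    have [measurable]: "h \<in> borel_measurable borel" "h' w \<in> borel_measurable borel" for w
      using bounded_diff_measurable[OF bdh] by auto
    have inU: "z \<in> U" "S z \<in> U" "z + (- Y) \<in> U" if "\<psi> z \<noteq> 0" for z
    proof -
      have in_U: "x \<in> U" if "norm (z - x) \<le> d" for x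
      proof -
        have "x \<in> cball z d" using that by (simp add: mem_cball dist_norm)
        then show ?thesis using \<psi>_U[OF \<open>\<psi> z \<noteq> 0\<close>] by blast
      qed
      have "norm (s *\<^sub>R Y) \<le> 1 * norm Y" 
        unfolding norm_scaleR using \<open>0 \<le> s\<close> \<open>s \<le> 1\<close> by (intro mult_right_mono) auto
      then show "z \<in> U" "S z \<in> U" "z + (- Y) \<in> U"
        using Yd d by (auto intro!: in_U simp: S_def)
    qed
    have grad: "v1' (- Y) (S z) = - h' dir_x z" "g2' (- Y) (S z) = - h' dir_y z" if "\<psi> z \<noteq> 0" for z
    proof -
      note l1 = bounded_diff_linear[OF v1, of "S z"] and l2 = bounded_diff_linear[OF bd(1), of "S z"]
      have "v1' (- Y) (S z) = - (\<alpha> * v1' dir_x (S z) + \<beta> * v1' dir_y (S z))"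
        unfolding Y_def by (simp only: linear_neg[OF l1] linear_add[OF l1] linear_cmul[OF l1] real_scaleR_def)
      moreover have "g2' (- Y) (S z) = - (\<alpha> * g2' dir_x (S z) + \<beta> * g2' dir_y (S z))"
        unfolding Y_def by (simp only: linear_neg[OF l2] linear_add[OF l2] linear_cmul[OF l2] real_scaleR_def)
      moreover have "g2' dir_x (S z) = v1' dir_y (S z)"
        using curl0[OF inU(2)[OF that]] by (simp add: g2'_def)
      ultimately show "v1' (- Y) (S z) = - h' dir_x z" "g2' (- Y) (S z) = - h' dir_y z"
        by (auto simp: h'_def)
    qed
    \<comment> \<open>Where \<psi> does not vanish, both \<open>z\<close> and \<open>z - Y\<close>
      lie in \<open>U\<close>, so the increment is divergence-free there. After integration by parts
      only the gradient of \<psi> survives, in the term \<open>X\<close>.\<close>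
    have div\<Delta>: "\<psi> z * (\<Delta>1' dir_x z + \<Delta>2' dir_y z) = 0" for z
      using div0[OF inU(1), of z] div0[OF inU(3), of z]
      by (cases "\<psi> z = 0") (auto simp: \<Delta>1'_def \<Delta>2'_def D2'_def algebra_simps)
    obtain H where H: "\<And>z. \<bar>h z\<bar> \<le> H" using bounded_diff_bound[OF bdh] by blast
    obtain Hx where Hx: "\<And>z. \<bar>h' dir_x z\<bar> \<le> Hx" using bounded_diff_deriv_bound[OF bdh] by blast
    obtain Hy where Hy: "\<And>z. \<bar>h' dir_y z\<bar> \<le> Hy" using bounded_diff_deriv_bound[OF bdh] by blast
    have ibp1: "(LBINT z. (\<psi>' dir_x z * \<Delta>1 z + \<psi> z * \<Delta>1' dir_x z) * h z + \<psi> z * \<Delta>1 z * h' dir_x z) = 0"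
      using integral_directional_derivative_eq_0[OF bounded_diff_mult[OF bd\<psi>\<Delta>(1) bdh], of R "\<lambda>_. 1" 1 dir_x] \<psi>_supp
      by simp
    have ibp2: "(LBINT z. (\<psi>' dir_y z * \<Delta>2 z + \<psi> z * \<Delta>2' dir_y z) * h z + \<psi> z * \<Delta>2 z * h' dir_y z) = 0"
      using integral_directional_derivative_eq_0[OF bounded_diff_mult[OF bd\<psi>\<Delta>(2) bdh], of R "\<lambda>_. 1" 1 dir_y] \<psi>_supp
      by simp
    have i1: "integrable lborel (\<lambda>z. \<psi> z * \<Delta>1 z * h' dir_x z)" "integrable lborel (\<lambda>z. \<psi> z * \<Delta>2 z * h' dir_y z)"
      using int[OF bd\<psi>\<Delta>(1) _ Hx] int[OF bd\<psi>\<Delta>(2) _ Hy] by auto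
    have intd: "integrable lborel (\<lambda>z. f' w z * h z)" if f: "bounded_diff f f'" and f0: "\<And>z. norm z > R \<Longrightarrow> f z = 0" for f f' w
    proof -
      note [measurable] = bounded_diff_measurable[OF f]
      obtain C where C: "C \<ge> 0" "\<And>z. \<bar>f' w z\<bar> \<le> C" using bounded_diff_deriv_bound[OF f] by blast
      show ?thesis
        by (rule integrable_bounded_support[where C = "C * H" and R = R])
          (auto simp: abs_mult bounded_diff_deriv_eq_0[OF f f0] intro!: mult_mono C H)
    qed
    have i2: "integrable lborel (\<lambda>z. (\<psi>' dir_x z * \<Delta>1 z + \<psi> z * \<Delta>1' dir_x z) * h z)"
      "integrable lborel (\<lambda>z. (\<psi>' dir_y z * \<Delta>2 z + \<psi> z * \<Delta>2' dir_y z) * h z)"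
      using intd[OF bd\<psi>\<Delta>(1)] intd[OF bd\<psi>\<Delta>(2)] \<psi>_supp by auto
    have "G' s = - ((LBINT z. \<psi> z * \<Delta>1 z * h' dir_x z) + (LBINT z. \<psi> z * \<Delta>2 z * h' dir_y z))"
    proof -
      have "\<psi> z * \<Delta>1 z * v1' (- Y) (S z) = - (\<psi> z * \<Delta>1 z * h' dir_x z)"
        "\<psi> z * \<Delta>2 z * g2' (- Y) (S z) = - (\<psi> z * \<Delta>2 z * h' dir_y z)" for z
        using grad[of z] by (cases "\<psi> z = 0"; simp)+
      then show ?thesis unfolding G'_def S_def[symmetric] by simp
    qed
    also have "\<dots> = (LBINT z. (\<psi>' dir_x z * \<Delta>1 z + \<psi> z * \<Delta>1' dir_x z) * h z) +
        (LBINT z. (\<psi>' dir_y z * \<Delta>2 z + \<psi> z * \<Delta>2' dir_y z) * h z)"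
      using ibp1 ibp2 Bochner_Integration.integral_add[OF i2(1) i1(1)] Bochner_Integration.integral_add[OF i2(2) i1(2)] by linarith
    also have "\<dots> = (LBINT z. (\<psi>' dir_x z * \<Delta>1 z + \<psi> z * \<Delta>1' dir_x z) * h z + (\<psi>' dir_y z * \<Delta>2 z + \<psi> z * \<Delta>2' dir_y z) * h z)"
      by (rule Bochner_Integration.integral_add[OF i2, symmetric])
    also have "\<dots> = (LBINT z. \<alpha> * (v1 (S z) * X z) + \<beta> * (g2 (S z) * X z))"
    proof (rule Bochner_Integration.integral_cong[OF refl])
      fix z
      have "(\<psi>' dir_x z * \<Delta>1 z + \<psi> z * \<Delta>1' dir_x z) * h z + (\<psi>' dir_y z * \<Delta>2 z + \<psi> z * \<Delta>2' dir_y z) * h z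
          = X z * h z + (\<psi> z * (\<Delta>1' dir_x z + \<Delta>2' dir_y z)) * h z"
        by (simp add: X_def algebra_simps)
      then show "(\<psi>' dir_x z * \<Delta>1 z + \<psi> z * \<Delta>1' dir_x z) * h z + (\<psi>' dir_y z * \<Delta>2 z + \<psi> z * \<Delta>2' dir_y z) * h z
          = \<alpha> * (v1 (S z) * X z) + \<beta> * (g2 (S z) * X z)"
        unfolding div\<Delta> by (simp add: h_def algebra_simps)
    qed
    also have "\<dots> = \<alpha> * (LBINT z. v1 (S z) * X z) + \<beta> * (LBINT z. g2 (S z) * X z)"
    proof -
      have "integrable lborel (\<lambda>z. v1 (S z) * X z)" "integrable lborel (\<lambda>z. g2 (S z) * X z)"
        unfolding S_def by (intro square_integrable_mult square_integrable_shift sq sqg sqX)+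
      then show ?thesis by simp
    qed
    finally have eq: "G' s = \<alpha> * (LBINT z. v1 (S z) * X z) + \<beta> * (LBINT z. g2 (S z) * X z)" .
    have "(LBINT z. (v1 (S z))\<^sup>2) \<le> M" "(LBINT z. (g2 (S z))\<^sup>2) \<le> 4 * M"
      using integral_shift[of "\<lambda>z. (v1 z)\<^sup>2" "s *\<^sub>R (- Y)"] integral_shift[of "\<lambda>z. (g2 z)\<^sup>2" "s *\<^sub>R (- Y)"] energy(2) eg(1)
      by (auto simp: S_def)
    then have "\<bar>LBINT z. v1 (S z) * X z\<bar> \<le> M + 40 * K\<^sup>2 * M" "\<bar>LBINT z. g2 (S z) * X z\<bar> \<le> 4 * M + 40 * K\<^sup>2 * M"
      using abs_integral_mult_le[OF square_integrable_shift[OF sq(2)] sqX _ eX, of "s *\<^sub>R (- Y)" M]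
        abs_integral_mult_le[OF square_integrable_shift[OF sqg(1)] sqX _ eX, of "s *\<^sub>R (- Y)" "4 * M"]
      by (simp_all only: S_def)
    then have "\<bar>\<alpha> * (LBINT z. v1 (S z) * X z)\<bar> \<le> \<delta> * (M + 40 * K\<^sup>2 * M)"
      "\<bar>\<beta> * (LBINT z. g2 (S z) * X z)\<bar> \<le> \<delta> * (4 * M + 40 * K\<^sup>2 * M)"
      unfolding abs_mult using ab by (auto intro!: mult_mono)
    then show ?thesis unfolding eq by (simp add: algebra_simps)
  qed
  ultimately obtain s where "0 < s" "s < 1" "G 1 - G 0 = (1 - 0) * G' s"
    using MVT2[of 0 1 G G'] by auto
  then have "\<bar>G 0 - G 1\<bar> \<le> \<delta> * (5 * M + 80 * K\<^sup>2 * M)"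
    using G'_bound[of s] by simp
  moreover have "G 0 - G 1 = (LBINT z. \<psi> z * ((v1 z - v1 (z - Y))\<^sup>2 + (v2 z - v2 (z - Y))\<^sup>2 - (r z - r (z - Y))\<^sup>2))"
  proof -
    obtain A1 where A1: "\<And>z. \<bar>v1 z\<bar> \<le> A1" using bounded_diff_bound[OF v1] by blast
    obtain A2 where A2: "\<And>z. \<bar>g2 z\<bar> \<le> A2" using bounded_diff_bound[OF bd(1)] by blast
    have i: "integrable lborel (\<lambda>z. \<psi> z * \<Delta>1 z * v1 (z + c))" "integrable lborel (\<lambda>z. \<psi> z * \<Delta>2 z * g2 (z + c))" for c
      by (rule int[OF bd\<psi>\<Delta>(1), where H = A1], measurable, rule A1) (rule int[OF bd\<psi>\<Delta>(2), where H = A2], measurable, rule A2)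
    have "G 0 - G 1 = ((LBINT z. \<psi> z * \<Delta>1 z * v1 (z + 0)) - (LBINT z. \<psi> z * \<Delta>1 z * v1 (z + (- Y))))
        + ((LBINT z. \<psi> z * \<Delta>2 z * g2 (z + 0)) - (LBINT z. \<psi> z * \<Delta>2 z * g2 (z + (- Y))))"
      by (simp add: G_def)
    also have "\<dots> = (LBINT z. \<psi> z * \<Delta>1 z * v1 (z + 0) - \<psi> z * \<Delta>1 z * v1 (z + (- Y)))
        + (LBINT z. \<psi> z * \<Delta>2 z * g2 (z + 0) - \<psi> z * \<Delta>2 z * g2 (z + (- Y)))"
      by (simp only: Bochner_Integration.integral_diff[OF i(1) i(1)] Bochner_Integration.integral_diff[OF i(2) i(2)])
    also have "\<dots> = (LBINT z. (\<psi> z * \<Delta>1 z * v1 (z + 0) - \<psi> z * \<Delta>1 z * v1 (z + (- Y)))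
        + (\<psi> z * \<Delta>2 z * g2 (z + 0) - \<psi> z * \<Delta>2 z * g2 (z + (- Y))))"
      by (rule Bochner_Integration.integral_add[symmetric, OF Bochner_Integration.integrable_diff[OF i(1) i(1)] Bochner_Integration.integrable_diff[OF i(2) i(2)]])
    also have "\<dots> = (LBINT z. \<psi> z * ((v1 z - v1 (z - Y))\<^sup>2 + (v2 z - v2 (z - Y))\<^sup>2 - (r z - r (z - Y))\<^sup>2))"
      by (rule Bochner_Integration.integral_cong[OF refl])
        (simp add: \<Delta>1_def \<Delta>2_def g2_def D2_def power2_eq_square algebra_simps)
    finally show ?thesis .
  qed
  ultimately show ?thesis by simp
qed

end

section \<open>Averages of the mixed terms over small shifts\<close>

lemma norm_time_scaling:
  assumes "\<bar>\<theta>\<bar> \<le> 1"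
  shows "norm (fst \<zeta>, \<theta> * snd \<zeta>) \<le> norm (\<zeta> :: spacetime)"
proof -
  have "\<bar>\<theta> * snd \<zeta>\<bar> \<le> \<bar>snd \<zeta>\<bar>"
    using assms by (simp add: abs_mult mult_left_le_one_le)
  then show ?thesis
    unfolding norm_prod_def by (auto intro!: real_sqrt_le_mono add_mono simp: abs_le_square_iff)
qed

lemma measurable_spacetime [measurable]:
  "(\<lambda>\<zeta>::spacetime. (fst \<zeta>, \<theta> * snd \<zeta>)) \<in> borel_measurable borel"
  "(\<lambda>\<zeta>::spacetime. (fst \<zeta>, 0::real)) \<in> borel_measurable borel"
  "(\<lambda>\<zeta>::spacetime. snd \<zeta>) \<in> borel_measurable borel"
  by (intro borel_measurable_continuous_onI continuous_intros)+

lemma space_direction_decomp: "(y, 0) = (y $ 1) *\<^sub>R dir_x + (y $ 2) *\<^sub>R dir_y"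
  by (simp add: vec_eq_iff forall_2 axis_def)

definition kern where "kern \<delta> = (mollifier \<delta> :: spacetime \<Rightarrow> real)"
definition kern' where "kern' \<delta> w \<zeta> = frechet_derivative (kern \<delta>) (at \<zeta>) w"

definition gradient_mass where
  "gradient_mass \<delta> = (LBINT \<zeta>. \<bar>kern' \<delta> dir_x \<zeta>\<bar> + \<bar>kern' \<delta> dir_y \<zeta>\<bar>)"

lemma bounded_diff_kern: "\<delta> > 0 \<Longrightarrow> bounded_diff (kern \<delta>) (kern' \<delta>)"
  unfolding kern_def kern'_def[abs_def] by (rule bounded_diff_mollifier)

lemma kern_eq_0: "\<delta> > 0 \<Longrightarrow> norm \<zeta> \<ge> \<delta> \<Longrightarrow> kern \<delta> \<zeta> = 0"
  unfolding kern_def by (rule mollifier_eq_0)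

lemma linear_time_scaling: "linear (\<lambda>\<zeta>::spacetime. (fst \<zeta>, \<theta> * snd \<zeta>))"
  by (intro linearI) (auto simp: algebra_simps)

lemma integrable_kern_mult:
  assumes "\<delta> > 0" and [measurable]: "f \<in> borel_measurable borel" and H: "\<And>z. \<bar>f z\<bar> \<le> H"
  shows "integrable lborel (\<lambda>\<zeta>. kern \<delta> \<zeta> * f \<zeta>)"
proof -
  note [measurable] = bounded_diff_measurable[OF bounded_diff_kern[OF \<open>\<delta> > 0\<close>]]
  obtain C where C: "C \<ge> 0" "\<And>z. \<bar>kern \<delta> z\<bar> \<le> C" using bounded_diff_bound[OF bounded_diff_kern[OF \<open>\<delta> > 0\<close>]] by blast
  show ?thesis
    by (rule integrable_bounded_support[where C = "C * H" and R = \<delta>])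
      (use kern_eq_0[OF \<open>\<delta> > 0\<close>] in \<open>auto simp: abs_mult intro!: mult_mono C H\<close>)
qed

context smooth_solution
begin

lemma integrable_weighted_product:
  assumes p: "square_integrable lborel p" and q: "square_integrable lborel q"
  shows "integrable lborel (\<lambda>z. \<psi> (z + c) * (p z * q z))"
proof -
  have "square_integrable lborel (\<lambda>z. \<psi> (z + c) * p z)"
    by (rule square_integrable_bounded_mult[where C = K, OF p]) (use \<psi>_nonneg \<psi>_le in auto)
  from square_integrable_mult[OF this q] show ?thesis by (simp add: mult.assoc)
qed

text \<open>A change of variables that undoes a shift of \<open>r\<close> and \<open>b\<close> moves
  the shift onto the weight. \<psi> varies by at most 2 K \<delta> over \<open>Y\<close>, since both
  components of \<open>Y\<close> are at most \<delta> and both spatial derivatives of \<psi> are at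
  most K in size.\<close>

lemma weight_shift_error:
  fixes \<alpha> \<beta> \<delta> :: real
  defines "Y \<equiv> \<alpha> *\<^sub>R dir_x + \<beta> *\<^sub>R dir_y"
  assumes ab: "\<bar>\<alpha>\<bar> \<le> \<delta>" "\<bar>\<beta>\<bar> \<le> \<delta>"
    and p: "square_integrable lborel p" "(LBINT z. (p z)\<^sup>2) \<le> P"
    and q: "square_integrable lborel q" "(LBINT z. (q z)\<^sup>2) \<le> Q"
  shows "\<bar>(LBINT z. \<psi> (z + Y) * (p z * q z)) - (LBINT z. \<psi> z * (p z * q z))\<bar> \<le> 2 * K * \<delta> * (P + Q)"
proof -
  have lip: "\<bar>\<psi> (z + Y) - \<psi> z\<bar> \<le> 2 * K * \<delta>" for z
  proof (rule bounded_diff_lipschitz[OF \<psi>])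
    fix x
    note l = bounded_diff_linear[OF \<psi>, of x]
    have "\<psi>' Y x = \<alpha> * \<psi>' dir_x x + \<beta> * \<psi>' dir_y x"
      unfolding Y_def by (simp only: linear_add[OF l] linear_cmul[OF l] real_scaleR_def)
    also have "\<bar>\<dots>\<bar> \<le> \<delta> * K + \<delta> * K"
      by (rule order_trans[OF abs_triangle_ineq], unfold abs_mult) 
        (use ab \<psi>'_le in \<open>intro add_mono mult_mono; auto\<close>)
    finally show "\<bar>\<psi>' Y x\<bar> \<le> 2 * K * \<delta>" by simp
  qed
  have "(LBINT z. \<psi> (z + Y) * (p z * q z)) - (LBINT z. \<psi> z * (p z * q z))
      = (LBINT z. \<psi> (z + Y) * (p z * q z) - \<psi> z * (p z * q z))"
    using integrable_weighted_product[OF p(1) q(1), of Y] integrable_weighted_product[OF p(1) q(1), of 0] by simp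
  also have "\<bar>\<dots>\<bar> \<le> (LBINT z. \<bar>\<psi> (z + Y) * (p z * q z) - \<psi> z * (p z * q z)\<bar>)"
    by (rule integral_abs_bound)
  also have "\<dots> \<le> (LBINT z. 2 * K * \<delta> * ((p z)\<^sup>2 + (q z)\<^sup>2))"
  proof (rule integral_mono)
    show "integrable lborel (\<lambda>z. \<bar>\<psi> (z + Y) * (p z * q z) - \<psi> z * (p z * q z)\<bar>)"
      using integrable_weighted_product[OF p(1) q(1), of Y] integrable_weighted_product[OF p(1) q(1), of 0] by simp
    show "integrable lborel (\<lambda>z. 2 * K * \<delta> * ((p z)\<^sup>2 + (q z)\<^sup>2))"
      using p q by (simp add: square_integrable_def)
    show "\<bar>\<psi> (z + Y) * (p z * q z) - \<psi> z * (p z * q z)\<bar> \<le> 2 * K * \<delta> * ((p z)\<^sup>2 + (q z)\<^sup>2)" for z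
    proof -
      have "\<bar>\<psi> (z + Y) * (p z * q z) - \<psi> z * (p z * q z)\<bar> = \<bar>\<psi> (z + Y) - \<psi> z\<bar> * \<bar>p z * q z\<bar>"
        by (simp add: abs_mult[symmetric] algebra_simps)
      also have "\<dots> \<le> 2 * K * \<delta> * ((p z)\<^sup>2 + (q z)\<^sup>2)"
        using lip[of z] abs_mult_le_weighted_squares[of 1 "p z" "q z"] ab(1) K_nonneg by (intro mult_mono) auto
      finally show ?thesis .
    qed
  qed
  also have "\<dots> = 2 * K * \<delta> * ((LBINT z. (p z)\<^sup>2) + (LBINT z. (q z)\<^sup>2))"
    using p q by (simp add: square_integrable_def)
  also have "\<dots> \<le> 2 * K * \<delta> * (P + Q)"
    using p q ab(1) K_nonneg by (intro mult_left_mono add_mono) auto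
  finally show ?thesis .
qed

text \<open>The first two terms come from \<open>null_lagrangian_increment\<close>; the last is
  twice 14 K M, from two weight shifts with energies \<open>M\<close> for \<open>r\<close> and
  \<open>6 * M\<close> for \<open>b\<close>.\<close>

definition C0 where "C0 = 5 * M + 80 * K\<^sup>2 * M + 28 * K * M"

text \<open>Expanding (r - r_Y) (b - b_Y) under the weight gives twice the pairing of
  \<open>r\<close> with \<open>b\<close> minus the mixed terms \<open>B Y\<close> and
  \<open>B (- Y)\<close>, up to weight shifts. The product itself is bounded below by the null
  Lagrangian of the increments, whose integral is small.\<close>

lemma pairing_lower_bound:
  fixes \<alpha> \<beta> \<delta> :: real
  defines "Y \<equiv> \<alpha> *\<^sub>R dir_x + \<beta> *\<^sub>R dir_y"
  assumes Yd: "norm Y \<le> d" and ab: "\<bar>\<alpha>\<bar> \<le> \<delta>" "\<bar>\<beta>\<bar> \<le> \<delta>"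
  shows "2 * (LBINT z. \<psi> z * (r z * b z)) \<ge> B Y + B (- Y) - C0 * \<delta>"
proof -
  define X where "X = (LBINT z. \<psi> z * (r z * b z))"
  define rY where "rY z = r (z + (- Y))" for z
  define bY where "bY z = b (z + (- Y))" for z
  have sqY: "square_integrable lborel rY" "square_integrable lborel bY"
    unfolding rY_def bY_def by (intro square_integrable_shift sq sq_b)+
  note intw = integrable_weighted_product[where c = 0, simplified]
  have i: "integrable lborel (\<lambda>z. \<psi> z * (r z * b z))" "integrable lborel (\<lambda>z. \<psi> z * (rY z * bY z))"
    "integrable lborel (\<lambda>z. \<psi> z * (rY z * b z))" "integrable lborel (\<lambda>z. \<psi> z * (r z * bY z))"
    by (intro intw sq sq_b sqY)+
  define I where "I = (LBINT z. \<psi> z * ((r z - rY z) * (b z - bY z)))"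
  have "I = (LBINT z. (\<psi> z * (r z * b z) + \<psi> z * (rY z * bY z)) - (\<psi> z * (rY z * b z) + \<psi> z * (r z * bY z)))"
    unfolding I_def by (intro Bochner_Integration.integral_cong) (auto simp: algebra_simps)
  also have "\<dots> = X + (LBINT z. \<psi> z * (rY z * bY z)) - ((LBINT z. \<psi> z * (rY z * b z)) + (LBINT z. \<psi> z * (r z * bY z)))"
    using i by (simp add: X_def)
  finally have I: "I = X + (LBINT z. \<psi> z * (rY z * bY z)) - ((LBINT z. \<psi> z * (rY z * b z)) + (LBINT z. \<psi> z * (r z * bY z)))" .
  have "(LBINT z. \<psi> z * (rY z * bY z)) = (LBINT z. \<psi> (z + Y) * (r z * b z))"
    using integral_shift[of "\<lambda>z. \<psi> (z + Y) * (r z * b z)" "- Y"] by (simp add: rY_def bY_def)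
  then have e1: "\<bar>(LBINT z. \<psi> z * (rY z * bY z)) - X\<bar> \<le> 2 * K * \<delta> * (M + 6 * M)"
    unfolding X_def Y_def using weight_shift_error[OF ab sq(1) energy(1) sq_b energy_b] by simp
  have "(LBINT z. \<psi> z * (r z * bY z)) = (LBINT z. \<psi> (z + Y) * (r (z + Y) * b z))"
    using integral_shift[of "\<lambda>z. \<psi> (z + Y) * (r (z + Y) * b z)" "- Y"] by (simp add: bY_def)
  moreover have "B (- Y) = (LBINT z. \<psi> z * (r (z + Y) * b z))"
    unfolding B_def by (intro Bochner_Integration.integral_cong) auto
  moreover have "(LBINT z. (r (z + Y))\<^sup>2) \<le> M"
    using integral_shift[of "\<lambda>z. (r z)\<^sup>2" Y] energy(1) by simp
  ultimately have e2: "\<bar>(LBINT z. \<psi> z * (r z * bY z)) - B (- Y)\<bar> \<le> 2 * K * \<delta> * (M + 6 * M)"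
    using weight_shift_error[OF ab square_integrable_shift[OF sq(1)] _ sq_b energy_b, of Y M, folded Y_def]
    by (simp only:)
  have BY: "B Y = (LBINT z. \<psi> z * (rY z * b z))"
    unfolding B_def rY_def by (intro Bochner_Integration.integral_cong) auto
  define N where "N z = (v1 z - v1 (z - Y))\<^sup>2 + (v2 z - v2 (z - Y))\<^sup>2 - (r z - r (z - Y))\<^sup>2" for z
  have intN: "integrable lborel (\<lambda>z. \<psi> z * N z)"
  proof -
    have s: "integrable lborel (\<lambda>z. \<psi> z * ((f z - f (z + (- Y))) * (f z - f (z + (- Y)))))" if "square_integrable lborel f" for f
      by (intro intw square_integrable_diff square_integrable_shift that)
    show ?thesis
      using Bochner_Integration.integrable_diff[OF Bochner_Integration.integrable_add[OF s[OF sq(2)] s[OF sq(3)]] s[OF sq(1)]]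
      by (simp add: N_def power2_eq_square algebra_simps)
  qed
  have point: "(r z - rY z) * (b z - bY z) \<ge> - N z / 2" for z
  proof -
    define p where "p = r z - rY z"
    define w1 where "w1 = v1 z - v1 (z - Y)"
    define w2 where "w2 = v2 z - v2 (z - Y)"
    have bz: "b z - bY z = p - (\<epsilon>1 * w1 + \<epsilon>2 * w2)"
      by (simp add: b_def bY_def rY_def p_def w1_def w2_def algebra_simps)
    have Nz: "N z = w1\<^sup>2 + w2\<^sup>2 - p\<^sup>2" by (simp add: N_def w1_def w2_def p_def rY_def)
    \<comment> \<open>Here |e| <= 1 is used: expanding gives 2 p (w . e) <= p^2 + |w|^2, hence p (p
      - w . e) >= (p^2 - |w|^2) / 2.\<close>
    have "0 \<le> (w1 - p * \<epsilon>1)\<^sup>2 + (w2 - p * \<epsilon>2)\<^sup>2 + p\<^sup>2 * (1 - (\<epsilon>1\<^sup>2 + \<epsilon>2\<^sup>2))"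
      using \<epsilon> by simp
    then show ?thesis unfolding p_def[symmetric] bz Nz
      by (simp add: power2_eq_square field_simps)
  qed
  have "(LBINT z. - (\<psi> z * N z) / 2) \<le> I"
    unfolding I_def
  proof (rule integral_mono)
    show "integrable lborel (\<lambda>z. \<psi> z * ((r z - rY z) * (b z - bY z)))"
      by (intro intw square_integrable_diff sq sq_b sqY)
    show "- (\<psi> z * N z) / 2 \<le> \<psi> z * ((r z - rY z) * (b z - bY z))" for z
      using mult_left_mono[OF point[of z] \<psi>_nonneg[of z]] by simp
  qed (use intN in simp)
  moreover have "\<bar>LBINT z. \<psi> z * N z\<bar> \<le> \<delta> * (5 * M + 80 * K\<^sup>2 * M)"
    using null_lagrangian_increment[OF _ ab] Yd unfolding Y_def[symmetric] N_def by simp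
  moreover have "\<delta> \<ge> 0" using ab(1) by linarith
  then have "\<delta> * (5 * M + 80 * K\<^sup>2 * M) \<ge> 0" using M_nonneg by simp
  ultimately have "I \<ge> - (\<delta> * (5 * M + 80 * K\<^sup>2 * M))" by simp
  then show ?thesis
    using I e1 e2 BY unfolding X_def[symmetric] C0_def by (simp add: algebra_simps abs_le_iff)
qed

text \<open>\<open>B\<close> is the case \<open>f = r\<close>. General \<open>f\<close> is allowed
  because the transport equation expresses the time derivative of \<open>B\<close> through the same
  integral for derivatives of the fluxes \<open>n1\<close> and \<open>n2\<close>.\<close>

definition corr where "corr f \<zeta> = (LBINT z. \<psi> z * b z * f (z - \<zeta>))"

lemma integrable_corr:
  assumes [measurable]: "f \<in> borel_measurable borel" and "\<And>z. \<bar>f z\<bar> \<le> H"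
  shows "integrable lborel (\<lambda>z. \<psi> z * b z * f (z - \<zeta>))"
proof -
  obtain C where C: "C \<ge> 0" "\<And>z. \<bar>\<psi> z * b z\<bar> \<le> C" using \<psi>b_bound by blast
  have "\<bar>\<psi> z * b z * f (z - \<zeta>)\<bar> \<le> C * H" for z
    unfolding abs_mult[of "\<psi> z * b z"] using C assms(2) by (intro mult_mono) auto
  then show ?thesis by (intro integrable_bounded_support[where C = "C * H" and R = R]) (auto simp: \<psi>_supp)
qed

lemma abs_corr_le:
  assumes f: "square_integrable lborel f" "(LBINT z. (f z)\<^sup>2) \<le> A"
  shows "\<bar>corr f \<zeta>\<bar> \<le> K\<^sup>2 * (6 * M) + A"
proof -
  have "(LBINT z. (f (z + (- \<zeta>)))\<^sup>2) \<le> A"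
    using integral_shift[of "\<lambda>z. (f z)\<^sup>2" "- \<zeta>"] f by (auto simp: square_integrable_def)
  from abs_integral_mult_le[OF sq_\<psi>b square_integrable_shift[OF f(1)] energy_\<psi>b this]
  show ?thesis by (simp add: corr_def)
qed

lemma bounded_diff_corr:
  assumes f: "bounded_diff f f'"
  shows "bounded_diff (corr f) (\<lambda>w \<zeta>. - corr (f' w) \<zeta>)"
proof -
  note [measurable] = bounded_diff_measurable[OF f]
  obtain C where C: "C \<ge> 0" "\<And>z. \<bar>\<psi> z * b z\<bar> \<le> C" using \<psi>b_bound by blast
  have bound: "\<exists>C. \<forall>\<zeta>. \<bar>corr g \<zeta>\<bar> \<le> C" if [measurable]: "g \<in> borel_measurable borel" and H: "\<And>z. \<bar>g z\<bar> \<le> H" for g H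
  proof -
    have "\<bar>corr g \<zeta>\<bar> \<le> (\<integral>z. C * H * indicator (cball 0 R) z \<partial>(lborel :: spacetime measure))" for \<zeta>
      unfolding corr_def
    proof (rule order_trans[OF integral_abs_bound], rule integral_mono)
      show "integrable lborel (\<lambda>z. \<bar>\<psi> z * b z * g (z - \<zeta>)\<bar>)" using integrable_corr[OF that] by simp
      show "\<bar>\<psi> z * b z * g (z - \<zeta>)\<bar> \<le> C * H * indicator (cball 0 R) z" for z
        using \<psi>_supp[of z] unfolding abs_mult[of "\<psi> z * b z"]
        by (cases "norm z > R") (auto intro!: mult_mono C H)
    qed (auto intro!: integrable_mult_right integrable_real_indicator emeasure_bounded_finite)
    then show ?thesis by blast
  qed
  have meas: "corr g \<in> borel_measurable borel" if [measurable]: "g \<in> borel_measurable borel" for g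
    unfolding corr_def by measurable
  obtain H where H: "\<And>z. \<bar>f z\<bar> \<le> H" using bounded_diff_bound[OF f] by blast
  have H': "\<exists>H. \<forall>z. \<bar>f' w z\<bar> \<le> H" for w using f unfolding bounded_diff_def by blast
  have b1: "\<exists>C. \<forall>\<zeta>. \<bar>corr f \<zeta>\<bar> \<le> C" using bound[OF _ H] by measurable
  have b2: "\<exists>C. \<forall>\<zeta>. \<bar>- corr (f' w) \<zeta>\<bar> \<le> C" for w
  proof -
    obtain H where "\<And>z. \<bar>f' w z\<bar> \<le> H" using H' by blast
    from bound[OF bounded_diff_measurable(2)[OF f] this] show ?thesis by simp
  qed
  have int: "integrable lborel (\<lambda>z. \<psi> z * b z * f' w (z - \<zeta>))" for w \<zeta>
  proof -
    obtain H where "\<And>z. \<bar>f' w z\<bar> \<le> H" using H' by blast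
    from integrable_corr[OF bounded_diff_measurable(2)[OF f] this] show ?thesis .
  qed
  have lin: "linear (\<lambda>w. - corr (f' w) \<zeta>)" for \<zeta>
  proof (rule linearI)
    note l = bounded_diff_linear[OF f]
    show "- corr (f' (x + y)) \<zeta> = - corr (f' x) \<zeta> + - corr (f' y) \<zeta>" for x y
      using int[of x \<zeta>] int[of y \<zeta>] by (simp add: corr_def linear_add[OF l] distrib_left)
    show "- corr (f' (c *\<^sub>R x)) \<zeta> = c *\<^sub>R (- corr (f' x) \<zeta>)" for x c
      using int[of x \<zeta>] by (simp add: corr_def linear_cmul[OF l] mult.left_commute[of _ c])
  qed
  have deriv: "((\<lambda>s. corr f (\<zeta> + s *\<^sub>R w)) has_real_derivative - corr (f' w) (\<zeta> + s0 *\<^sub>R w)) (at s0)" for \<zeta> w s0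
  proof -
    have bd: "bounded_diff (\<lambda>z. f (z + (- \<zeta>))) (\<lambda>w z. f' w (z + (- \<zeta>)))" by (rule bounded_diff_shift[OF f])
    have "((\<lambda>s. LBINT z. \<psi> z * b z * f (z + s *\<^sub>R (- w) + (- \<zeta>))) has_real_derivative
      (LBINT z. \<psi> z * b z * f' (- w) (z + s0 *\<^sub>R (- w) + (- \<zeta>)))) (at s0)"
      by (rule deriv_shifted_integral[OF bd, where R = R and C = C]) (auto simp: \<psi>_supp C)
    moreover have eq: "z - (\<zeta> + s *\<^sub>R w) = z + s *\<^sub>R (- w) + (- \<zeta>)" for z s by simp
    ultimately show ?thesis
      unfolding corr_def eq by (simp add: linear_neg[OF bounded_diff_linear[OF f]])
  qed
  show ?thesis
    unfolding bounded_diff_def using b1 b2 lin deriv by (auto intro!: meas)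
qed

text \<open>The factor \<theta> shrinks the time extent of the shifts: \<theta> = 0 leaves spatial
  shifts, for which the lower bound on the pairing holds, while \<theta> > 0 gives space-time
  averages, which weak convergence controls.\<close>

definition avg where "avg \<delta> \<theta> = (LBINT \<zeta>. kern \<delta> \<zeta> * B (fst \<zeta>, \<theta> * snd \<zeta>))"

lemma B_eq_corr: "B = corr r"
  by (simp add: B_def corr_def fun_eq_iff)

text \<open>The lower bound for one shift is averaged over the kernel, whose time variable is simply
  integrated out. The kernel is even, so \<open>B Y\<close> and \<open>B (- Y)\<close> have the same
  average and the factor 2 cancels.\<close>

lemma pairing_ge_avg:
  assumes \<delta>: "0 < \<delta>" "\<delta> \<le> d"
  shows "(LBINT z. \<psi> z * (r z * b z)) \<ge> avg \<delta> 0 - C0 * \<delta>"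
proof -
  define X where "X = (LBINT z. \<psi> z * (r z * b z))"
  have bdB: "bounded_diff B (\<lambda>w \<zeta>. - corr (r' w) \<zeta>)" unfolding B_eq_corr by (rule bounded_diff_corr[OF r])
  note [measurable] = bounded_diff_measurable(1)[OF bdB] bounded_diff_measurable[OF bounded_diff_kern[OF \<delta>(1)]]
  obtain H where H: "\<And>z. \<bar>B z\<bar> \<le> H" using bounded_diff_bound[OF bdB] by blast
  have Jint: "integrable lborel (kern \<delta>)" "(LBINT \<zeta>. kern \<delta> \<zeta>) = 1"
    using integrable_mollifier[OF \<delta>(1)] integral_mollifier[OF \<delta>(1)] by (auto simp: kern_def)
  have i: "integrable lborel (\<lambda>\<zeta>. kern \<delta> \<zeta> * B (fst \<zeta>, 0))" "integrable lborel (\<lambda>\<zeta>. kern \<delta> \<zeta> * B (- (fst \<zeta>, 0)))"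
    by (rule integrable_kern_mult[where H = H, OF \<delta>(1) _ H], 
        rule measurable_compose[OF _ bounded_diff_measurable(1)[OF bdB]], 
        intro borel_measurable_continuous_onI continuous_intros)+
  have "(LBINT \<zeta>. kern \<delta> \<zeta> * B (- (fst \<zeta>, 0))) = (LBINT \<zeta>. kern \<delta> (0 - \<zeta>) * B (- (fst (0 - \<zeta>), 0)))"
    by (rule integral_reflect[symmetric]) measurable
  also have "\<dots> = avg \<delta> 0" by (simp add: avg_def kern_def mollifier_minus)
  finally have a: "(LBINT \<zeta>. kern \<delta> \<zeta> * B (- (fst \<zeta>, 0))) = avg \<delta> 0" .
  have "avg \<delta> 0 + avg \<delta> 0 - C0 * \<delta> = (LBINT \<zeta>. kern \<delta> \<zeta> * B (fst \<zeta>, 0) + kern \<delta> \<zeta> * B (- (fst \<zeta>, 0)) - C0 * \<delta> * kern \<delta> \<zeta>)"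
    using i Jint a by (simp add: avg_def)
  also have "\<dots> \<le> (LBINT \<zeta>. 2 * X * kern \<delta> \<zeta>)"
  proof (rule integral_mono)
    show "integrable lborel (\<lambda>\<zeta>. kern \<delta> \<zeta> * B (fst \<zeta>, 0) + kern \<delta> \<zeta> * B (- (fst \<zeta>, 0)) - C0 * \<delta> * kern \<delta> \<zeta>)"
      using i Jint by auto
    show "integrable lborel (\<lambda>\<zeta>. 2 * X * kern \<delta> \<zeta>)" using Jint by simp
    fix \<zeta> :: spacetime
    show "kern \<delta> \<zeta> * B (fst \<zeta>, 0) + kern \<delta> \<zeta> * B (- (fst \<zeta>, 0)) - C0 * \<delta> * kern \<delta> \<zeta> \<le> 2 * X * kern \<delta> \<zeta>"
    proof (cases "norm \<zeta> < \<delta>")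
      case True
      have f: "norm (fst \<zeta>) < \<delta>" using True norm_fst_le[of "fst \<zeta>" "snd \<zeta>"] by simp
      have c: "\<bar>fst \<zeta> $ i\<bar> \<le> \<delta>" for i using f component_le_norm_cart[of "fst \<zeta>" i] by simp
      have n: "norm ((fst \<zeta> $ 1) *\<^sub>R dir_x + (fst \<zeta> $ 2) *\<^sub>R dir_y) \<le> d"
        using f \<delta> unfolding space_direction_decomp[symmetric] by simp
      have "B (fst \<zeta>, 0) + B (- (fst \<zeta>, 0)) - C0 * \<delta> \<le> 2 * X"
        using pairing_lower_bound[OF n c c] unfolding space_direction_decomp[symmetric] X_def .
      moreover have "kern \<delta> \<zeta> \<ge> 0" by (simp add: kern_def mollifier_nonneg)
      ultimately have "kern \<delta> \<zeta> * (B (fst \<zeta>, 0) + B (- (fst \<zeta>, 0)) - C0 * \<delta>) \<le> kern \<delta> \<zeta> * (2 * X)"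
        by (rule mult_left_mono)
      then show ?thesis by (simp add: algebra_simps)
    qed (use kern_eq_0[OF \<delta>(1)] in simp)
  qed
  also have "\<dots> = 2 * X" using Jint by simp
  finally have "avg \<delta> 0 - C0 * \<delta> / 2 \<le> X" by simp
  moreover have "C0 * \<delta> \<ge> 0" using M_nonneg K_nonneg \<delta> by (simp add: C0_def)
  ultimately show ?thesis unfolding X_def[symmetric] by linarith
qed

text \<open>The transport equation turns the time derivative of \<open>B\<close> into the spatial divergence of a
  bounded field, and the divergence falls on the averaging kernel.\<close>

lemma avg_time_scaling:
  assumes \<delta>: "0 < \<delta>" "\<delta> \<le> d" and \<theta>: "0 < \<theta>" "\<theta> \<le> 1"
  shows "\<bar>avg \<delta> 0 - avg \<delta> \<theta>\<bar> \<le> \<theta> * (\<delta> * (K\<^sup>2 * (6 * M) + M) * gradient_mass \<delta>)"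
proof -
  define A where "A = K\<^sup>2 * (6 * M) + M"
  have A0: "A \<ge> 0" using M_nonneg by (simp add: A_def)
  define S where "S \<theta> \<zeta> = (fst \<zeta>, \<theta> * snd \<zeta>)" for \<theta> and \<zeta> :: spacetime
  have linS: "linear (S \<theta>)" for \<theta> unfolding S_def by (rule linear_time_scaling)
  have Sdir: "S \<theta> dir_x = dir_x" "S \<theta> dir_y = dir_y" for \<theta> by (auto simp: S_def)
  note bdJ = bounded_diff_kern[OF \<delta>(1)]
  have bdB: "bounded_diff B (\<lambda>w \<zeta>. - corr (r' w) \<zeta>)" unfolding B_eq_corr by (rule bounded_diff_corr[OF r])
  define B' where "B' w \<zeta> = - corr (r' w) \<zeta>" for w \<zeta>
  have bdB': "bounded_diff B B'" using bdB by (simp add: B'_def[abs_def])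
  note [measurable] = bounded_diff_measurable[OF bdB'] bounded_diff_measurable[OF bdJ]
  obtain H where H: "H \<ge> 0" "\<And>z. \<bar>B z\<bar> \<le> H" using bounded_diff_bound[OF bdB'] by blast
  obtain H' where H': "H' \<ge> 0" "\<And>z. \<bar>B' dir_t z\<bar> \<le> H'" using bounded_diff_deriv_bound[OF bdB'] by blast
  obtain C where C: "C \<ge> 0" "\<And>z. \<bar>kern \<delta> z\<bar> \<le> C" using bounded_diff_bound[OF bdJ] by blast
  have Jsupp: "norm \<zeta> > \<delta> \<Longrightarrow> kern \<delta> \<zeta> = 0" for \<zeta> using kern_eq_0[OF \<delta>(1)] by simp
  define a' where "a' \<theta> = (LBINT \<zeta>. kern \<delta> \<zeta> * (snd \<zeta> * B' dir_t (S \<theta> \<zeta>)))" for \<theta>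
  have [measurable]: "S \<theta> \<in> borel_measurable borel" for \<theta>
    using linS by (intro borel_measurable_continuous_onI linear_continuous_on) (simp add: linear_conv_bounded_linear)
  have snd_le: "\<bar>snd \<zeta>\<bar> \<le> norm \<zeta>" for \<zeta> :: spacetime using norm_snd_le[of "snd \<zeta>" "fst \<zeta>"] by simp
  have "(avg \<delta> has_real_derivative a' \<theta>) (at \<theta>)" for \<theta>
    unfolding avg_def[abs_def] a'_def S_def[symmetric]
  proof (rule has_real_derivative_integral[where w = "\<lambda>\<zeta>. C * (\<delta> * H') * indicator (cball 0 \<delta>) \<zeta>"])
    fix s
    show "integrable lborel (\<lambda>\<zeta>. kern \<delta> \<zeta> * B (S s \<zeta>))"
      by (intro integrable_kern_mult[where H = H] \<delta> H) measurable
    show "((\<lambda>s. kern \<delta> \<zeta> * B (S s \<zeta>)) has_real_derivative kern \<delta> \<zeta> * (snd \<zeta> * B' dir_t (S s \<zeta>))) (at s)" for \<zeta>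
    proof -
      have "S s \<zeta> = (fst \<zeta>, 0) + s *\<^sub>R (snd \<zeta> *\<^sub>R dir_t)" for s by (simp add: S_def)
      moreover have "B' (snd \<zeta> *\<^sub>R dir_t) x = snd \<zeta> * B' dir_t x" for x
        using linear_cmul[OF bounded_diff_linear[OF bdB']] by (simp del: scaleR_Pair)
      ultimately show ?thesis
        using bounded_diff_deriv[OF bdB', where z = "(fst \<zeta>, 0)" and w = "snd \<zeta> *\<^sub>R dir_t" and s = s]
        by (intro DERIV_cmult) (simp del: scaleR_Pair add_Pair)
    qed
    show "\<bar>kern \<delta> \<zeta> * (snd \<zeta> * B' dir_t (S s \<zeta>))\<bar> \<le> C * (\<delta> * H') * indicator (cball 0 \<delta>) \<zeta>" for \<zeta>
      using Jsupp[of \<zeta>] snd_le[of \<zeta>] \<delta>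
      by (cases "norm \<zeta> > \<delta>") (auto simp: abs_mult intro!: mult_mono C H')
  qed (auto intro!: integrable_mult_right integrable_real_indicator emeasure_bounded_finite)
  moreover have "\<bar>a' \<theta>\<bar> \<le> \<delta> * A * gradient_mass \<delta>" if th: "0 \<le> \<theta>" "\<theta> \<le> 1" for \<theta>
  proof -
    \<comment> \<open>The time coordinate clipped to [-\<delta>, \<delta>]. It agrees with
      \<open>snd \<zeta>\<close> where the kernel does not vanish, but is bounded, and it is
      constant in the spatial directions as the integration by parts requires.\<close>
    define h where "h \<zeta> = max (- \<delta>) (min \<delta> (snd \<zeta>))" for \<zeta> :: spacetime
    have [measurable]: "h \<in> borel_measurable borel"
      unfolding h_def by (intro borel_measurable_continuous_onI continuous_intros)
    have h_le: "\<bar>h \<zeta>\<bar> \<le> \<delta>" for \<zeta> using \<delta> by (auto simp: h_def)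
    have h_inv: "h (z + s *\<^sub>R dir_x) = h z" "h (z + s *\<^sub>R dir_y) = h z" for z s by (auto simp: h_def)
    have h_snd: "kern \<delta> \<zeta> * snd \<zeta> = kern \<delta> \<zeta> * h \<zeta>" for \<zeta>
      using Jsupp[of \<zeta>] snd_le[of \<zeta>] by (cases "norm \<zeta> > \<delta>") (auto simp: h_def)
    \<comment> \<open>Correlations of the fluxes at the scaled shift. \<open>S \<theta>\<close>
      fixes the spatial directions, so spatial derivatives are those in the unscaled variable, and
      the energy bounds give the bound \<open>A\<close>, which is the same for every member of the
      sequence.\<close>
    define V1 where "V1 \<zeta> = corr n1 (S \<theta> \<zeta>)" for \<zeta>
    define V2 where "V2 \<zeta> = corr n2 (S \<theta> \<zeta>)" for \<zeta>
    define V1' where "V1' w \<zeta> = - corr (n1' (S \<theta> w)) (S \<theta> \<zeta>)" for w \<zeta>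
    define V2' where "V2' w \<zeta> = - corr (n2' (S \<theta> w)) (S \<theta> \<zeta>)" for w \<zeta>
    have bdV: "bounded_diff V1 V1'" "bounded_diff V2 V2'"
      unfolding V1_def V2_def V1'_def V2'_def
      by (rule bounded_diff_compose_linear[OF bounded_diff_corr[OF n1] linS] bounded_diff_compose_linear[OF bounded_diff_corr[OF n2] linS])+
    note [measurable] = bounded_diff_measurable[OF bdV(1)] bounded_diff_measurable[OF bdV(2)]
    have Vle: "\<bar>V1 \<zeta>\<bar> \<le> A" "\<bar>V2 \<zeta>\<bar> \<le> A" for \<zeta>
      unfolding V1_def V2_def A_def by (intro abs_corr_le sq energy)+
    have eq: "kern \<delta> \<zeta> * (snd \<zeta> * B' dir_t (S \<theta> \<zeta>)) = - (h \<zeta> * (kern \<delta> \<zeta> * V1' dir_x \<zeta>) + h \<zeta> * (kern \<delta> \<zeta> * V2' dir_y \<zeta>))" for \<zeta>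
    proof (cases "norm \<zeta> > \<delta>")
      case False
      then have nS: "norm (S \<theta> \<zeta>) \<le> d"
        using norm_time_scaling[of \<theta> \<zeta>] th \<delta> by (simp add: S_def)
      have p: "\<psi> z * b z * r' dir_t (z - S \<theta> \<zeta>) = - (\<psi> z * b z * n1' dir_x (z - S \<theta> \<zeta>) + \<psi> z * b z * n2' dir_y (z - S \<theta> \<zeta>))" for z
      proof (cases "\<psi> z = 0")
        case False
        have "z - S \<theta> \<zeta> \<in> cball z d" using nS by (simp add: dist_norm)
        then have "z - S \<theta> \<zeta> \<in> U" using \<psi>_U[OF False] by blast
        from transport[OF this] have t: "r' dir_t (z - S \<theta> \<zeta>) = - (n1' dir_x (z - S \<theta> \<zeta>) + n2' dir_y (z - S \<theta> \<zeta>))" by linarith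
        show ?thesis unfolding t by (simp add: algebra_simps)
      qed simp
      obtain N1 where N1: "\<And>z. \<bar>n1' dir_x z\<bar> \<le> N1" using bounded_diff_deriv_bound[OF n1] by blast
      obtain N2 where N2: "\<And>z. \<bar>n2' dir_y z\<bar> \<le> N2" using bounded_diff_deriv_bound[OF n2] by blast
      have "corr (r' dir_t) (S \<theta> \<zeta>) = - (corr (n1' dir_x) (S \<theta> \<zeta>) + corr (n2' dir_y) (S \<theta> \<zeta>))"
        unfolding corr_def p
        using integrable_corr[OF bounded_diff_measurable(2)[OF n1] N1] integrable_corr[OF bounded_diff_measurable(2)[OF n2] N2] by simp
      then have "B' dir_t (S \<theta> \<zeta>) = - (V1' dir_x \<zeta> + V2' dir_y \<zeta>)"
        by (simp add: B'_def V1'_def V2'_def Sdir)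
      then have "kern \<delta> \<zeta> * (snd \<zeta> * B' dir_t (S \<theta> \<zeta>)) = (kern \<delta> \<zeta> * snd \<zeta>) * - (V1' dir_x \<zeta> + V2' dir_y \<zeta>)" by simp
      then show ?thesis unfolding h_snd by (simp add: algebra_simps)
    qed (simp add: Jsupp)
    have ibp1: "(LBINT \<zeta>. h \<zeta> * (kern' \<delta> dir_x \<zeta> * V1 \<zeta> + kern \<delta> \<zeta> * V1' dir_x \<zeta>)) = 0"
      by (rule integral_directional_derivative_eq_0[OF bounded_diff_mult[OF bdJ bdV(1)], of \<delta> h \<delta> dir_x])
        (use h_le h_inv in \<open>auto simp: Jsupp\<close>)
    have ibp2: "(LBINT \<zeta>. h \<zeta> * (kern' \<delta> dir_y \<zeta> * V2 \<zeta> + kern \<delta> \<zeta> * V2' dir_y \<zeta>)) = 0"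
      by (rule integral_directional_derivative_eq_0[OF bounded_diff_mult[OF bdJ bdV(2)], of \<delta> h \<delta> dir_y])
        (use h_le h_inv in \<open>auto simp: Jsupp\<close>)
    have intJ': "integrable lborel (\<lambda>\<zeta>. kern' \<delta> w \<zeta>)" for w
    proof -
      obtain D where D: "\<And>z. \<bar>kern' \<delta> w z\<bar> \<le> D" using bounded_diff_deriv_bound[OF bdJ] by blast
      show ?thesis
        by (rule integrable_bounded_support[where C = D and R = \<delta>]) (auto simp: D bounded_diff_deriv_eq_0[OF bdJ Jsupp])
    qed
    have intbd: "integrable lborel (\<lambda>\<zeta>. h \<zeta> * (k \<zeta> * V \<zeta>))" if k: "integrable lborel k" and [measurable]: "V \<in> borel_measurable borel" 
      and W: "\<And>\<zeta>. \<bar>V \<zeta>\<bar> \<le> W" for k V :: "spacetime \<Rightarrow> real" and W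
    proof (rule Bochner_Integration.integrable_bound)
      show "integrable lborel (\<lambda>\<zeta>. \<delta> * W * \<bar>k \<zeta>\<bar>)" using k by simp
      show "(\<lambda>\<zeta>. h \<zeta> * (k \<zeta> * V \<zeta>)) \<in> borel_measurable lborel" using k by measurable
      have W0: "W \<ge> 0" using W[of 0] by linarith
      have "\<bar>h \<zeta> * (k \<zeta> * V \<zeta>)\<bar> \<le> \<delta> * (\<bar>k \<zeta>\<bar> * W)" for \<zeta>
        unfolding abs_mult using \<delta> by (intro mult_mono h_le W order_refl) auto
      then show "AE \<zeta> in lborel. norm (h \<zeta> * (k \<zeta> * V \<zeta>)) \<le> norm (\<delta> * W * \<bar>k \<zeta>\<bar>)"
        using \<delta> W0 by (auto intro!: AE_I2 simp: abs_mult mult_ac)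
    qed
    have intJ: "integrable lborel (kern \<delta>)" using integrable_mollifier[OF \<delta>(1)] by (simp add: kern_def)
    obtain W1 where W1: "\<And>z. \<bar>V1' dir_x z\<bar> \<le> W1" using bounded_diff_deriv_bound[OF bdV(1)] by blast
    obtain W2 where W2: "\<And>z. \<bar>V2' dir_y z\<bar> \<le> W2" using bounded_diff_deriv_bound[OF bdV(2)] by blast
    have i: "integrable lborel (\<lambda>\<zeta>. h \<zeta> * (kern' \<delta> dir_x \<zeta> * V1 \<zeta>))" "integrable lborel (\<lambda>\<zeta>. h \<zeta> * (kern' \<delta> dir_y \<zeta> * V2 \<zeta>))"
      "integrable lborel (\<lambda>\<zeta>. h \<zeta> * (kern \<delta> \<zeta> * V1' dir_x \<zeta>))" "integrable lborel (\<lambda>\<zeta>. h \<zeta> * (kern \<delta> \<zeta> * V2' dir_y \<zeta>))"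
      using intbd[OF intJ' _ Vle(1)] intbd[OF intJ' _ Vle(2)] intbd[OF intJ _ W1] intbd[OF intJ _ W2] by auto
    have "a' \<theta> = - ((LBINT \<zeta>. h \<zeta> * (kern \<delta> \<zeta> * V1' dir_x \<zeta>)) + (LBINT \<zeta>. h \<zeta> * (kern \<delta> \<zeta> * V2' dir_y \<zeta>)))"
      unfolding a'_def eq using i by simp
    also have "\<dots> = (LBINT \<zeta>. h \<zeta> * (kern' \<delta> dir_x \<zeta> * V1 \<zeta>)) + (LBINT \<zeta>. h \<zeta> * (kern' \<delta> dir_y \<zeta> * V2 \<zeta>))"
      using ibp1 ibp2 i by (simp add: distrib_left)
    also have "\<dots> = (LBINT \<zeta>. h \<zeta> * (kern' \<delta> dir_x \<zeta> * V1 \<zeta>) + h \<zeta> * (kern' \<delta> dir_y \<zeta> * V2 \<zeta>))"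
      using i by simp
    finally have a'_eq: "a' \<theta> = (LBINT \<zeta>. h \<zeta> * (kern' \<delta> dir_x \<zeta> * V1 \<zeta>) + h \<zeta> * (kern' \<delta> dir_y \<zeta> * V2 \<zeta>))" .
    have "\<bar>a' \<theta>\<bar> \<le> (LBINT \<zeta>. \<bar>h \<zeta> * (kern' \<delta> dir_x \<zeta> * V1 \<zeta>) + h \<zeta> * (kern' \<delta> dir_y \<zeta> * V2 \<zeta>)\<bar>)"
      unfolding a'_eq by (rule integral_abs_bound)
    also have "\<dots> \<le> (LBINT \<zeta>. \<delta> * A * (\<bar>kern' \<delta> dir_x \<zeta>\<bar> + \<bar>kern' \<delta> dir_y \<zeta>\<bar>))"
    proof (rule integral_mono)
      show "integrable lborel (\<lambda>\<zeta>. \<bar>h \<zeta> * (kern' \<delta> dir_x \<zeta> * V1 \<zeta>) + h \<zeta> * (kern' \<delta> dir_y \<zeta> * V2 \<zeta>)\<bar>)" using i by simp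
      show "integrable lborel (\<lambda>\<zeta>. \<delta> * A * (\<bar>kern' \<delta> dir_x \<zeta>\<bar> + \<bar>kern' \<delta> dir_y \<zeta>\<bar>))" using intJ' by simp
      fix \<zeta> :: spacetime
      have "\<bar>h \<zeta> * (kern' \<delta> dir_x \<zeta> * V1 \<zeta>)\<bar> \<le> \<delta> * (\<bar>kern' \<delta> dir_x \<zeta>\<bar> * A)" "\<bar>h \<zeta> * (kern' \<delta> dir_y \<zeta> * V2 \<zeta>)\<bar> \<le> \<delta> * (\<bar>kern' \<delta> dir_y \<zeta>\<bar> * A)"
        unfolding abs_mult using \<delta> by (intro mult_mono h_le Vle order_refl; simp)+
      then show "\<bar>h \<zeta> * (kern' \<delta> dir_x \<zeta> * V1 \<zeta>) + h \<zeta> * (kern' \<delta> dir_y \<zeta> * V2 \<zeta>)\<bar> \<le> \<delta> * A * (\<bar>kern' \<delta> dir_x \<zeta>\<bar> + \<bar>kern' \<delta> dir_y \<zeta>\<bar>)"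
        using abs_triangle_ineq[of "h \<zeta> * (kern' \<delta> dir_x \<zeta> * V1 \<zeta>)" "h \<zeta> * (kern' \<delta> dir_y \<zeta> * V2 \<zeta>)"] 
        by (simp add: algebra_simps)
    qed
    also have "\<dots> = \<delta> * A * gradient_mass \<delta>" by (simp add: gradient_mass_def)
    finally show ?thesis .
  qed
  ultimately obtain s where "0 < s" "s < \<theta>" "avg \<delta> \<theta> - avg \<delta> 0 = (\<theta> - 0) * a' s"
    "\<bar>a' s\<bar> \<le> \<delta> * A * gradient_mass \<delta>"
    using MVT2[of 0 \<theta> "avg \<delta>" a'] \<theta> by (metis less_eq_real_def order_trans)
  then have "avg \<delta> 0 - avg \<delta> \<theta> = - (\<theta> * a' s)" by simp
  then have "\<bar>avg \<delta> 0 - avg \<delta> \<theta>\<bar> = \<theta> * \<bar>a' s\<bar>" using \<theta> by (simp add: abs_mult)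
  also have "\<dots> \<le> \<theta> * (\<delta> * A * gradient_mass \<delta>)"
    using \<theta> \<open>\<bar>a' s\<bar> \<le> _\<close> by (intro mult_left_mono) auto
  finally show ?thesis by (simp add: A_def)
qed

text \<open>Fubini moves the average onto \<open>r\<close>: the averaged mixed term becomes the
  pairing of \<open>\<psi> z * b z\<close>, which has bounded energy, with the smoothed density
  \<open>N\<close>. What remains is the energy of \<open>N\<close> on a ball outside which \<psi>
  vanishes, a quantity that weak convergence can make small.\<close>

lemma avg_le:
  assumes \<delta>: "0 < \<delta>" and "a > 0" and H: "\<And>z. norm z \<le> R \<Longrightarrow> \<bar>N z\<bar> \<le> H"
    and N: "\<And>z. N z = (LBINT \<zeta>. kern \<delta> \<zeta> * r (z - (fst \<zeta>, \<theta> * snd \<zeta>)))"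
  shows "\<bar>avg \<delta> \<theta>\<bar> \<le> a * (K\<^sup>2 * (6 * M)) + (LBINT z. (indicator (cball 0 R) z * N z)\<^sup>2) / a"
proof -
  define S where "S \<zeta> = (fst \<zeta>, \<theta> * snd \<zeta>)" for \<zeta> :: spacetime
  note bdJ = bounded_diff_kern[OF \<delta>]
  note [measurable] = bounded_diff_measurable[OF bdJ]
  have [measurable]: "S \<in> borel_measurable borel" unfolding S_def using linear_time_scaling
    by (intro borel_measurable_continuous_onI linear_continuous_on) (simp add: linear_conv_bounded_linear)
  have [measurable]: "N \<in> borel_measurable borel" unfolding N S_def[symmetric] by measurable
  obtain CJ where CJ: "CJ \<ge> 0" "\<And>z. \<bar>kern \<delta> z\<bar> \<le> CJ" using bounded_diff_bound[OF bdJ] by blast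
  obtain Cr where Cr: "Cr \<ge> 0" "\<And>z. \<bar>r z\<bar> \<le> Cr" using bounded_diff_bound[OF r] by blast
  obtain Cb where Cb: "Cb \<ge> 0" "\<And>z. \<bar>\<psi> z * b z\<bar> \<le> Cb" using \<psi>b_bound by blast
  have Jsupp: "norm \<zeta> > \<delta> \<Longrightarrow> kern \<delta> \<zeta> = 0" for \<zeta> using kern_eq_0[OF \<delta>] by simp
  have int: "integrable (lborel \<Otimes>\<^sub>M lborel) (\<lambda>(z, \<zeta>). (\<psi> z * b z) * (kern \<delta> \<zeta> * r (z - S \<zeta>)))"
    unfolding lborel_prod
  proof (rule integrable_bounded_support[where C = "Cb * (CJ * Cr)" and R = "\<bar>R\<bar> + \<delta>"])
    have "(\<lambda>(z, \<zeta>). (\<psi> z * b z) * (kern \<delta> \<zeta> * r (z - S \<zeta>))) \<in> borel_measurable (borel \<Otimes>\<^sub>M borel)" by measurable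
    then show "(\<lambda>(z, \<zeta>). (\<psi> z * b z) * (kern \<delta> \<zeta> * r (z - S \<zeta>))) \<in> borel_measurable borel" by (simp add: borel_prod)
    fix p :: "spacetime \<times> spacetime"
    obtain z \<zeta> where p: "p = (z, \<zeta>)" by (rule prod.exhaust)
    show "\<bar>case p of (z, \<zeta>) \<Rightarrow> (\<psi> z * b z) * (kern \<delta> \<zeta> * r (z - S \<zeta>))\<bar> \<le> Cb * (CJ * Cr)"
      unfolding p prod.case abs_mult[of "\<psi> z * b z"] abs_mult[of "kern \<delta> \<zeta>"]
      by (intro mult_mono Cb CJ Cr) (use CJ Cr in auto)
    assume "norm p > \<bar>R\<bar> + \<delta>"
    then have "norm z > R \<or> norm \<zeta> > \<delta>"
      using norm_Pair_le[of z \<zeta>] unfolding p by linarith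
    then show "(case p of (z, \<zeta>) \<Rightarrow> (\<psi> z * b z) * (kern \<delta> \<zeta> * r (z - S \<zeta>))) = 0"
      by (auto simp: p \<psi>_supp Jsupp)
  qed
  have "avg \<delta> \<theta> = (LBINT \<zeta>. (LBINT z. (\<psi> z * b z) * (kern \<delta> \<zeta> * r (z - S \<zeta>))))"
    unfolding avg_def B_def S_def by (simp add: integral_mult_right_zero[symmetric] mult_ac del: integral_mult_right_zero)
  also have "\<dots> = (LBINT z. (LBINT \<zeta>. (\<psi> z * b z) * (kern \<delta> \<zeta> * r (z - S \<zeta>))))"
    by (rule lborel_pair.Fubini_integral[OF int])
  also have "\<dots> = (LBINT z. (\<psi> z * b z) * N z)"
    by (simp add: N S_def)
  also have "\<dots> = (LBINT z. (\<psi> z * b z) * (indicator (cball 0 R) z * N z))"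
    by (intro Bochner_Integration.integral_cong) (auto simp: indicator_def \<psi>_supp not_le)
  finally have "avg \<delta> \<theta> = (LBINT z. (\<psi> z * b z) * (indicator (cball 0 R) z * N z))" .
  moreover have "square_integrable lborel (\<lambda>z. indicator (cball 0 R) z * N z)"
    by (rule square_integrable_bounded_support[where C = "\<bar>H\<bar>" and R = R]) (use H in \<open>fastforce simp: indicator_def\<close>)+
  ultimately have "\<bar>avg \<delta> \<theta>\<bar> \<le> a * (LBINT z. (\<psi> z * b z)\<^sup>2) + (LBINT z. (indicator (cball 0 R) z * N z)\<^sup>2) / a"
    using integral_mult_le_weighted_squares[OF sq_\<psi>b _ \<open>a > 0\<close>] by simp
  also have "a * (LBINT z. (\<psi> z * b z)\<^sup>2) \<le> a * (K\<^sup>2 * (6 * M))"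
    using \<open>a > 0\<close> energy_\<psi>b by (intro mult_left_mono) auto
  finally show ?thesis by simp
qed

end

section \<open>Rescaling in time and passage to the limit\<close>

lemma integral_time_scaling:
  fixes f :: "spacetime \<Rightarrow> real"
  assumes [measurable]: "f \<in> borel_measurable borel" and "\<theta> > 0"
  shows "(LBINT \<zeta>. f (fst \<zeta>, \<theta> * snd \<zeta>)) = (LBINT \<zeta>. f \<zeta>) / \<theta>"
proof -
  define c where "c j = (if j = dir_t then \<theta> else 1)" for j :: spacetime
  define T where "T x = 0 + (\<Sum>j\<in>Basis. (c j * (x \<bullet> j)) *\<^sub>R j)" for x :: spacetime
  have T: "T = (\<lambda>\<zeta>. (fst \<zeta>, \<theta> * snd \<zeta>))"
  proof (rule ext, rule euclidean_eqI)
    fix x and j :: spacetime assume j: "j \<in> Basis"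
    have "T x \<bullet> j = c j * (x \<bullet> j)"
      using j by (simp add: T_def inner_sum_left inner_Basis if_distrib sum.delta cong: if_cong)
    also have "\<dots> = (fst x, \<theta> * snd x) \<bullet> j"
      using j by (auto simp: c_def Basis_prod_def inner_prod_def)
    finally show "T x \<bullet> j = (fst x, \<theta> * snd x) \<bullet> j" .
  qed
  have t: "dir_t \<in> Basis" by (auto simp: Basis_prod_def)
  have "(\<Prod>j\<in>(Basis::spacetime set). \<bar>c j\<bar>) = (\<Prod>j\<in>(Basis::spacetime set). if j = dir_t then \<theta> else 1)"
    using \<open>\<theta> > 0\<close> by (intro prod.cong) (auto simp: c_def)
  also have "\<dots> = \<theta>" using t by (simp add: prod.delta)
  finally have p: "(\<Prod>j\<in>(Basis::spacetime set). \<bar>c j\<bar>) = \<theta>" .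
  have [measurable]: "T \<in> borel_measurable borel" unfolding T by measurable
  have "lborel = density (distr lborel borel T) (\<lambda>_. ennreal \<theta>)"
    using lborel_affine_euclidean[of c 0] \<open>\<theta> > 0\<close> p unfolding T_def by (auto simp: c_def)
  then have "(LBINT \<zeta>. f \<zeta>) = (\<integral>\<zeta>. f \<zeta> \<partial>density (distr lborel borel T) (\<lambda>_. ennreal \<theta>))" by simp
  also have "\<dots> = \<theta> * (LBINT \<zeta>. f (T \<zeta>))"
    using \<open>\<theta> > 0\<close> by (simp add: integral_density integral_distr)
  finally show ?thesis using \<open>\<theta> > 0\<close> by (simp add: T)
qed

text \<open>For \<theta> > 0 the average is a convolution with a bounded kernel of bounded support,
  obtained by rescaling the time variable and dividing by the Jacobian \<theta>. At \<theta> = 0 the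
  average is over a measure concentrated on spatial shifts, and no such kernel exists.\<close>

lemma time_scaled_average:
  assumes "0 < \<delta>" "0 < \<theta>"
  obtains \<kappa> where "square_integrable lborel \<kappa>"
    "\<And>f z. f \<in> borel_measurable borel \<Longrightarrow> (LBINT \<zeta>. kern \<delta> \<zeta> * f (z - (fst \<zeta>, \<theta> * snd \<zeta>))) = conv \<kappa> f z"
proof -
  note bd = bounded_diff_kern[OF \<open>0 < \<delta>\<close>]
  note [measurable] = bounded_diff_measurable[OF bd]
  define \<kappa> where "\<kappa> \<zeta> = kern \<delta> (fst \<zeta>, (1 / \<theta>) * snd \<zeta>) / \<theta>" for \<zeta>
  have [measurable]: "\<kappa> \<in> borel_measurable borel" unfolding \<kappa>_def by measurable
  obtain C where C: "\<And>z. \<bar>kern \<delta> z\<bar> \<le> C" using bounded_diff_bound[OF bd] by blast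
  show ?thesis
  proof (rule that[of \<kappa>])
    show "square_integrable lborel \<kappa>"
    proof (rule square_integrable_bounded_support[where C = "C / \<theta>" and R = "\<delta> + \<theta> * \<delta>"])
      show "\<bar>\<kappa> \<zeta>\<bar> \<le> C / \<theta>" for \<zeta> using C \<open>0 < \<theta>\<close> by (simp add: \<kappa>_def divide_right_mono)
      fix \<zeta> :: spacetime assume far: "norm \<zeta> > \<delta> + \<theta> * \<delta>"
      have "norm (fst \<zeta>, (1 / \<theta>) * snd \<zeta>) \<ge> \<delta>"
      proof (rule ccontr)
        assume "\<not> ?thesis"
        then have "norm (fst \<zeta>) < \<delta>" "\<bar>(1 / \<theta>) * snd \<zeta>\<bar> < \<delta>"
          using norm_fst_le[of "fst \<zeta>" "(1 / \<theta>) * snd \<zeta>"] norm_snd_le[of "(1 / \<theta>) * snd \<zeta>" "fst \<zeta>"] by auto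
        then have "norm (fst \<zeta>) < \<delta>" "\<bar>snd \<zeta>\<bar> < \<theta> * \<delta>" using \<open>0 < \<theta>\<close> by (auto simp: abs_mult field_simps)
        with far norm_Pair_le[of "fst \<zeta>" "snd \<zeta>"] show False by simp
      qed
      then show "\<kappa> \<zeta> = 0" using kern_eq_0[OF \<open>0 < \<delta>\<close>] by (simp add: \<kappa>_def)
    qed measurable
    fix f :: "spacetime \<Rightarrow> real" and z assume [measurable]: "f \<in> borel_measurable borel"
    have "(LBINT \<zeta>. kern \<delta> \<zeta> * f (z - (fst \<zeta>, \<theta> * snd \<zeta>)))
        = (LBINT \<zeta>. (\<lambda>\<zeta>. kern \<delta> (fst \<zeta>, (1 / \<theta>) * snd \<zeta>) * f (z - \<zeta>)) (fst \<zeta>, \<theta> * snd \<zeta>))"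
      using \<open>0 < \<theta>\<close> by simp
    also have "\<dots> = (LBINT \<zeta>. kern \<delta> (fst \<zeta>, (1 / \<theta>) * snd \<zeta>) * f (z - \<zeta>)) / \<theta>"
      by (rule integral_time_scaling) (use \<open>0 < \<theta>\<close> in measurable)
    also have "\<dots> = (LBINT \<zeta>. \<kappa> \<zeta> * f (z - \<zeta>))"
      by (simp add: \<kappa>_def)
    also have "\<dots> = (LBINT y. \<kappa> (z - y) * f (z - (z - y)))"
      by (rule integral_reflect[symmetric]) measurable
    finally show "(LBINT \<zeta>. kern \<delta> \<zeta> * f (z - (fst \<zeta>, \<theta> * snd \<zeta>))) = conv \<kappa> f z"
      by (simp add: conv_def)
  qed
qed

text \<open>The order of choices matters: \<delta> makes the increment error small; \<theta> is
  chosen after \<delta> because the cost of averaging in time contains the gradient mass of the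
  kernel at scale \<delta>; only with both fixed does k tend to infinity. Four errors of \<eta> / 4
  add up to \<eta>.\<close>

theorem compensated_compactness:
  assumes sol: "\<And>k. smooth_solution (r k) (v1 k) (v2 k) (n1 k) (n2 k) \<psi> (r' k) (v1' k) (v2' k) (n1' k) (n2' k) \<psi>' U d R M K \<epsilon>1 \<epsilon>2"
    and weak: "\<And>g. square_integrable lborel g \<Longrightarrow> (\<lambda>k. LBINT z. g z * r k z) \<longlonglongrightarrow> 0"
    and "\<eta> > 0"
  shows "\<forall>\<^sub>F k in sequentially. (LBINT z. \<psi> z * (r k z * (r k z - (\<epsilon>1 * v1 k z + \<epsilon>2 * v2 k z)))) \<ge> - \<eta>"
proof -
  interpret S: smooth_solution "r k" "v1 k" "v2 k" "n1 k" "n2 k" \<psi> "r' k" "v1' k" "v2' k" "n1' k" "n2' k" \<psi>' U d R M K \<epsilon>1 \<epsilon>2 for k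
    by (rule sol)
  define C where "C = smooth_solution.C0 M K"
  have C0: "C \<ge> 0" using S.M_nonneg S.K_nonneg by (simp add: C_def S.C0_def)
  define \<delta> where "\<delta> = min d (\<eta> / (4 * (C + 1)))"
  have \<delta>: "0 < \<delta>" "\<delta> \<le> d" using S.d C0 \<open>\<eta> > 0\<close> by (auto simp: \<delta>_def)
  have frac: "x * (\<eta> / (4 * (x + 1))) \<le> \<eta> / 4" if "x \<ge> 0" for x
    using that \<open>\<eta> > 0\<close> by (simp add: field_simps)
  have "C * \<delta> \<le> C * (\<eta> / (4 * (C + 1)))" using C0 by (intro mult_left_mono) (auto simp: \<delta>_def)
  with frac[OF C0] have e1: "C * \<delta> \<le> \<eta> / 4" by linarith
  define G where "G = \<delta> * (K\<^sup>2 * (6 * M) + M) * gradient_mass \<delta>"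
  have "gradient_mass \<delta> \<ge> 0" unfolding gradient_mass_def by (intro Bochner_Integration.integral_nonneg) auto
  then have G0: "G \<ge> 0" using S.M_nonneg \<delta> by (simp add: G_def)
  define \<theta> where "\<theta> = min 1 (\<eta> / (4 * (G + 1)))"
  have \<theta>: "0 < \<theta>" "\<theta> \<le> 1" using G0 \<open>\<eta> > 0\<close> by (auto simp: \<theta>_def)
  have "G * \<theta> \<le> G * (\<eta> / (4 * (G + 1)))" using G0 by (intro mult_left_mono) (auto simp: \<theta>_def)
  from order_trans[OF this frac[OF G0]] have e2: "\<theta> * G \<le> \<eta> / 4" by (simp only: mult.commute)
  define A where "A = K\<^sup>2 * (6 * M)"
  have A0: "A \<ge> 0" using S.M_nonneg by (simp add: A_def)
  define a where "a = \<eta> / (4 * (A + 1))"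
  have a: "a > 0" using A0 \<open>\<eta> > 0\<close> by (simp add: a_def)
  have e3: "a * A \<le> \<eta> / 4" using frac[OF A0] by (simp add: a_def mult.commute)
  obtain \<kappa> where \<kappa>: "square_integrable lborel \<kappa>"
    "\<And>f z. f \<in> borel_measurable borel \<Longrightarrow> (LBINT \<zeta>. kern \<delta> \<zeta> * f (z - (fst \<zeta>, \<theta> * snd \<zeta>))) = conv \<kappa> f z"
    using time_scaled_average[OF \<delta>(1) \<theta>(1)] by blast
  have [measurable]: "\<kappa> \<in> borel_measurable borel" using \<kappa>(1) by (simp add: square_integrable_def)
  define N where "N k z = conv \<kappa> (r k) z" for k z
  define H where "H = sqrt (LBINT y. (\<kappa> y)\<^sup>2) * sqrt M"
  have N_le: "\<bar>N k z\<bar> \<le> H" for k z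
    unfolding N_def H_def
    by (rule order_trans[OF abs_conv_le[OF \<kappa>(1) S.sq(1)]]) (intro mult_left_mono real_sqrt_le_mono S.energy, simp)
  \<comment> \<open>For fixed \<open>z\<close> the smoothed density is \<open>r k\<close> tested
    against the reflected kernel, so weak convergence gives pointwise convergence; the uniform bound
    \<open>H\<close> makes it strong on the ball.\<close>
  have N_lim: "(\<lambda>k. N k z) \<longlonglongrightarrow> 0" for z
    using weak[OF square_integrable_reflect[OF \<kappa>(1), of z]] by (simp add: N_def conv_def)
  have [measurable]: "N k \<in> borel_measurable borel" for k
    unfolding N_def[abs_def] by (rule measurable_conv) measurable
  have "(\<lambda>k. LBINT z. (indicator (cball 0 R) z * N k z)\<^sup>2) \<longlonglongrightarrow> (\<integral>z. 0 \<partial>(lborel :: spacetime measure))"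
  proof (rule integral_dominated_convergence[where w = "\<lambda>z. H\<^sup>2 * indicator (cball 0 R) z"])
    show "AE z in lborel. (\<lambda>k. (indicator (cball 0 R) z * N k z)\<^sup>2) \<longlonglongrightarrow> 0"
    proof (intro AE_I2)
      fix z
      have "(\<lambda>k. (indicator (cball 0 R) z * N k z)\<^sup>2) \<longlonglongrightarrow> (indicator (cball 0 R) z * 0)\<^sup>2"
        by (intro tendsto_intros N_lim)
      then show "(\<lambda>k. (indicator (cball 0 R) z * N k z)\<^sup>2) \<longlonglongrightarrow> 0" by simp
    qed
    have "(N k z)\<^sup>2 \<le> H\<^sup>2" for k z using power_mono[OF N_le[of k z], of 2] by simp
    then show "AE z in lborel. norm ((indicator (cball 0 R) z * N k z)\<^sup>2) \<le> H\<^sup>2 * indicator (cball 0 R) z" for k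
      by (intro AE_I2) (auto simp: indicator_def)
    show "(\<lambda>z. (indicator (cball 0 R) z * N k z)\<^sup>2) \<in> borel_measurable lborel" for k
      by (intro borel_measurable_power borel_measurable_times borel_measurable_indicator) auto
  qed (auto intro!: integrable_mult_right integrable_real_indicator emeasure_bounded_finite)
  \<comment> \<open>The factor \<open>a\<close> compensates the division by \<open>a\<close> in
    \<open>avg_le\<close>.\<close>
  then have "\<forall>\<^sub>F k in sequentially. (LBINT z. (indicator (cball 0 R) z * N k z)\<^sup>2) < a * (\<eta> / 4)"
    using a \<open>\<eta> > 0\<close> by (intro order_tendstoD(2)) auto
  then show ?thesis
  proof (rule eventually_mono)
    fix k assume k: "(LBINT z. (indicator (cball 0 R) z * N k z)\<^sup>2) < a * (\<eta> / 4)"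
    have "\<bar>S.avg k \<delta> \<theta>\<bar> \<le> a * A + (LBINT z. (indicator (cball 0 R) z * N k z)\<^sup>2) / a"
      unfolding A_def by (rule S.avg_le[OF \<delta>(1) a]) (use N_le \<kappa>(2) in \<open>auto simp: N_def\<close>)
    also have "\<dots> \<le> \<eta> / 4 + \<eta> / 4"
      using k a e3 by (intro add_mono) (auto simp: field_simps)
    finally have "\<bar>S.avg k \<delta> \<theta>\<bar> \<le> \<eta> / 4 + \<eta> / 4" .
    moreover have "\<bar>S.avg k \<delta> 0 - S.avg k \<delta> \<theta>\<bar> \<le> \<eta> / 4"
      using S.avg_time_scaling[OF \<delta> \<theta>, of k] e2 unfolding G_def by linarith
    moreover have "(LBINT z. \<psi> z * (r k z * S.b k z)) \<ge> S.avg k \<delta> 0 - C * \<delta>"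
      unfolding C_def by (rule S.pairing_ge_avg[OF \<delta>])
    ultimately show "(LBINT z. \<psi> z * (r k z * (r k z - (\<epsilon>1 * v1 k z + \<epsilon>2 * v2 k z)))) \<ge> - \<eta>"
      using e1 unfolding S.b_def by linarith
  qed
qed

section \<open>Weakly bounded sequences in \<open>L\<^sup>2\<close> are bounded\<close>

lemma AE_summable_integral:
  fixes f :: "nat \<Rightarrow> 'a \<Rightarrow> real"
  assumes int: "\<And>i. integrable M (f i)" and nn: "\<And>i x. f i x \<ge> 0" and sum: "summable (\<lambda>i. \<integral>x. f i x \<partial>M)"
  shows "AE x in M. summable (\<lambda>i. f i x)"
proof -
  have [measurable]: "f i \<in> borel_measurable M" for i using int by auto
  have "(\<integral>\<^sup>+x. (\<Sum>i. ennreal (f i x)) \<partial>M) = (\<Sum>i. \<integral>\<^sup>+x. ennreal (f i x) \<partial>M)"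
    by (intro nn_integral_suminf) measurable
  also have "\<dots> = (\<Sum>i. ennreal (\<integral>x. f i x \<partial>M))"
    using int nn by (simp add: nn_integral_eq_integral)
  also have "\<dots> = ennreal (\<Sum>i. \<integral>x. f i x \<partial>M)"
    using sum nn by (intro suminf_ennreal2) (auto intro!: integral_nonneg)
  finally have "(\<integral>\<^sup>+x. (\<Sum>i. ennreal (f i x)) \<partial>M) \<noteq> \<infinity>" by simp
  then have "AE x in M. (\<Sum>i. ennreal (f i x)) \<noteq> \<infinity>"
    by (intro nn_integral_PInf_AE) measurable
  then show ?thesis
    by eventually_elim (use nn in \<open>auto intro!: summable_suminf_not_top\<close>)
qed

text \<open>The gliding hump: if the norms were unbounded, a series of normalized members with geometric
  weights and suitably chosen signs would have unbounded products with the sequence.\<close>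

theorem L2_uniform_boundedness:
  fixes F :: "nat \<Rightarrow> 'a \<Rightarrow> real"
  assumes F: "\<And>k. square_integrable M (F k)"
    and bdd: "\<And>g. square_integrable M g \<Longrightarrow> \<exists>C. \<forall>k. \<bar>\<integral>x. F k x * g x \<partial>M\<bar> \<le> C"
  shows "\<exists>C. \<forall>k. (\<integral>x. (F k x)\<^sup>2 \<partial>M) \<le> C"
proof (rule ccontr)
  assume "\<not> ?thesis"
  \<comment> \<open>Norms beyond 4^n meet weights 3^(-n), so the n-th hump is at least (4/3)^n,
    which is unbounded.\<close>
  then have "\<forall>n. \<exists>k. (\<integral>x. (F k x)\<^sup>2 \<partial>M) > (4 ^ n)\<^sup>2" by (meson not_le)
  then obtain \<kappa> where \<kappa>: "\<And>n. (\<integral>x. (F (\<kappa> n) x)\<^sup>2 \<partial>M) > (4 ^ n)\<^sup>2" by metis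
  define N where "N n = sqrt (\<integral>x. (F (\<kappa> n) x)\<^sup>2 \<partial>M)" for n
  have N: "N n > 4 ^ n" for n using \<kappa>[of n] unfolding N_def by (intro real_less_rsqrt)
  have Npos: "N n > 0" for n using N[of n] zero_less_power[of "4::real" n] by linarith
  have N2: "(\<integral>x. (F (\<kappa> n) x)\<^sup>2 \<partial>M) = (N n)\<^sup>2" for n by (simp add: N_def)
  define G where "G n x = F (\<kappa> n) x / N n" for n x
  have sqG: "square_integrable M (G n)" for n
    using square_integrable_cmult[OF F[of "\<kappa> n"], of "1 / N n"] by (simp add: G_def[abs_def])
  have G1: "(\<integral>x. (G n x)\<^sup>2 \<partial>M) = 1" for n
    using Npos[of n] by (simp add: G_def power_divide N2)
  have FG: "(\<integral>x. F (\<kappa> n) x * G n x \<partial>M) = N n" for n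
    using Npos[of n] N2[of n] by (simp add: G_def power2_eq_square[symmetric]) (simp add: power2_eq_square)
  have FG_le: "\<bar>\<integral>x. F (\<kappa> n) x * G i x \<partial>M\<bar> \<le> N n" "(\<integral>x. \<bar>F (\<kappa> n) x * G i x\<bar> \<partial>M) \<le> N n" for n i
  proof -
    have [measurable]: "F k \<in> borel_measurable M" "G k \<in> borel_measurable M" for k
      using F sqG by (auto simp: square_integrable_def)
    have s: "square_integrable M (\<lambda>x. \<bar>F (\<kappa> n) x\<bar>)" "square_integrable M (\<lambda>x. \<bar>G i x\<bar>)"
      using F sqG by (auto simp: square_integrable_def)
    have "(\<integral>x. \<bar>F (\<kappa> n) x\<bar> * \<bar>G i x\<bar> \<partial>M) \<le> N n"
      using Cauchy_Schwarz_integral_sqrt[OF s] G1[of i] Npos[of n] by (simp add: N_def)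
    then show "(\<integral>x. \<bar>F (\<kappa> n) x * G i x\<bar> \<partial>M) \<le> N n" by (simp add: abs_mult)
    then show "\<bar>\<integral>x. F (\<kappa> n) x * G i x \<partial>M\<bar> \<le> N n" by (rule order_trans[OF integral_abs_bound])
  qed
  \<comment> \<open>\<open>y n\<close> is the sum of the first \<open>n\<close> terms. The sign of
    the next term is that of the product of \<open>F (\<kappa> n)\<close> with this sum, so the two
    contributions cannot cancel.\<close>
  define y where "y = rec_nat (\<lambda>x. 0) (\<lambda>n y x. y x + (if (\<integral>x. F (\<kappa> n) x * y x \<partial>M) \<ge> 0 then 1 else -1) * (1 / 3) ^ n * G n x)"
  define \<sigma> :: "nat \<Rightarrow> real" where "\<sigma> n = (if (\<integral>x. F (\<kappa> n) x * y n x \<partial>M) \<ge> 0 then 1 else -1)" for n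
  define t where "t n x = \<sigma> n * (1 / 3) ^ n * G n x" for n x
  have y: "y n x = (\<Sum>i<n. t i x)" for n x
  proof (induction n arbitrary: x)
    case (Suc n)
    then show ?case by (simp add: y_def t_def \<sigma>_def)
  qed (simp add: y_def)
  have \<sigma>: "\<bar>\<sigma> n\<bar> = 1" for n by (simp add: \<sigma>_def)
  have sqt: "square_integrable M (t n)" for n
    unfolding t_def by (intro square_integrable_cmult sqG)
  define T where "T n i = (\<integral>x. F (\<kappa> n) x * t i x \<partial>M)" for n i
  have T_eq: "T n i = \<sigma> i * (1 / 3) ^ i * (\<integral>x. F (\<kappa> n) x * G i x \<partial>M)" for n i
  proof -
    have "F (\<kappa> n) x * (\<sigma> i * (1 / 3) ^ i * G i x) = (\<sigma> i * (1 / 3) ^ i) * (F (\<kappa> n) x * G i x)" for x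
      by (simp only: mult_ac)
    then show ?thesis unfolding T_def t_def by (simp only: integral_mult_right_zero)
  qed
  have T_le: "\<bar>T n i\<bar> \<le> (1 / 3) ^ i * N n" for n i
    unfolding T_eq abs_mult \<sigma> using FG_le(1)[of n i] by (simp add: power_abs mult_left_mono)
  have hump: "\<bar>\<Sum>i<Suc n. T n i\<bar> \<ge> (1 / 3) ^ n * N n" for n
  proof -
    have "(\<Sum>i<n. T n i) = (\<integral>x. F (\<kappa> n) x * y n x \<partial>M)"
      unfolding T_def y by (simp add: sum_distrib_left square_integrable_mult[OF F sqt])
    moreover have "T n n = \<sigma> n * ((1 / 3) ^ n * N n)" unfolding T_eq FG by simp
    moreover have "(1 / 3) ^ n * N n > 0" using Npos by simp
    ultimately show ?thesis by (auto simp: \<sigma>_def)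
  qed
  \<comment> \<open>With each weight split into two square roots, Cauchy-Schwarz bounds the square
    of the series by 3/2 times the sum of \<open>H\<close>, which is integrable; hence the limit is
    square integrable.\<close>
  define H where "H i x = (1 / 3) ^ i * (G i x)\<^sup>2" for i x
  have geo: "summable (\<lambda>i. (1 / 3 :: real) ^ i)" "(\<Sum>i. (1 / 3 :: real) ^ i) = 3 / 2"
    using geometric_sums[of "1 / 3 :: real"] by (auto simp: sums_iff)
  have Hint: "integrable M (H i)" for i unfolding H_def using sqG by (simp add: square_integrable_def)
  have Hnn: "H i x \<ge> 0" for i x by (simp add: H_def)
  have HI: "(\<integral>x. H i x \<partial>M) = (1 / 3) ^ i" for i unfolding H_def using G1 by simp
  have AEH: "AE x in M. summable (\<lambda>i. H i x)"
    by (rule AE_summable_integral[OF Hint Hnn]) (simp add: HI geo)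
  have intH: "integrable M (\<lambda>x. \<Sum>i. H i x)"
    using Hint AEH Hnn by (intro integrable_suminf) (auto simp: HI geo)
  have t_abs: "\<bar>t i x\<bar> = (1 / 3) ^ i * \<bar>G i x\<bar>" for i x by (simp add: t_def abs_mult \<sigma> power_abs)
  have t_le: "\<bar>t i x\<bar> \<le> (1 / 3) ^ i + H i x" for i x
  proof -
    have "\<bar>G i x\<bar> \<le> 1 + (G i x)\<^sup>2" using abs_mult_le_weighted_squares[of 1 "G i x" 1] by simp
    then have "(1 / 3) ^ i * \<bar>G i x\<bar> \<le> (1 / 3) ^ i * (1 + (G i x)\<^sup>2)" by (intro mult_left_mono) auto
    then show ?thesis by (simp add: t_abs H_def distrib_left)
  qed
  have sum_t: "summable (\<lambda>i. \<bar>t i x\<bar>)" if "summable (\<lambda>i. H i x)" for x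
    by (rule summable_comparison_test'[OF summable_add[OF geo(1) that]]) (use t_le in auto)
  define g where "g x = (\<Sum>i. t i x)" for x
  have [measurable]: "t i \<in> borel_measurable M" "F i \<in> borel_measurable M" for i
    using sqt F by (simp_all add: square_integrable_def)
  have [measurable]: "g \<in> borel_measurable M" unfolding g_def by measurable
  have g2: "(g x)\<^sup>2 \<le> 3 / 2 * (\<Sum>i. H i x)" if s: "summable (\<lambda>i. H i x)" for x
  proof (rule LIMSEQ_le_const2)
    show "(\<lambda>m. (\<Sum>i<m. t i x)\<^sup>2) \<longlonglongrightarrow> (g x)\<^sup>2"
      unfolding g_def by (rule tendsto_power[OF summable_LIMSEQ[OF summable_rabs_cancel[OF sum_t[OF s]]]])
    have "(\<Sum>i<m. t i x)\<^sup>2 \<le> 3 / 2 * (\<Sum>i. H i x)" for m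
    proof -
      have "(\<Sum>i<m. t i x)\<^sup>2 = (\<Sum>i<m. sqrt ((1 / 3) ^ i) * (\<sigma> i * sqrt ((1 / 3) ^ i) * G i x))\<^sup>2"
      proof -
        have *: "sqrt p * (s * sqrt p * q) = s * p * q" if "p \<ge> 0" for p s q :: real
        proof -
          have "sqrt p * (s * sqrt p * q) = s * (sqrt p * sqrt p) * q" by (simp only: mult_ac)
          with that show ?thesis by simp
        qed
        have "t i x = sqrt ((1 / 3) ^ i) * (\<sigma> i * sqrt ((1 / 3) ^ i) * G i x)" for i
          unfolding t_def by (rule *[symmetric]) simp
        then show ?thesis by (simp only:)
      qed
      also have "\<dots> \<le> (\<Sum>i<m. (sqrt ((1 / 3) ^ i))\<^sup>2) * (\<Sum>i<m. (\<sigma> i * sqrt ((1 / 3) ^ i) * G i x)\<^sup>2)"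
        by (rule Cauchy_Schwarz_ineq_sum)
      also have "\<dots> = (\<Sum>i<m. (1 / 3) ^ i) * (\<Sum>i<m. H i x)"
      proof -
        have "(\<sigma> i)\<^sup>2 = 1" for i using \<sigma>[of i] by (metis power2_abs power_one)
        then show ?thesis by (simp add: power_mult_distrib H_def)
      qed
      also have "\<dots> \<le> 3 / 2 * (\<Sum>i. H i x)"
        using sum_le_suminf[OF geo(1), of "{..<m}"] sum_le_suminf[OF s, of "{..<m}"] Hnn geo(2)
        by (intro mult_mono) (auto intro!: sum_nonneg)
      finally show ?thesis .
    qed
    then show "\<exists>N. \<forall>m\<ge>N. (\<Sum>i<m. t i x)\<^sup>2 \<le> 3 / 2 * (\<Sum>i. H i x)" by blast
  qed
  have sqg: "square_integrable M g"
    unfolding square_integrable_def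
  proof
    show "integrable M (\<lambda>x. (g x)\<^sup>2)"
    proof (rule Bochner_Integration.integrable_bound)
      show "integrable M (\<lambda>x. 3 / 2 * (\<Sum>i. H i x))" using intH by simp
      show "AE x in M. norm ((g x)\<^sup>2) \<le> norm (3 / 2 * (\<Sum>i. H i x))"
        using AEH by eventually_elim (use g2 in fastforce)
    qed measurable
  qed measurable
  have Fg: "(\<integral>x. F (\<kappa> n) x * g x \<partial>M) = (\<Sum>i. T n i)" for n
  proof -
    have "(\<integral>x. F (\<kappa> n) x * g x \<partial>M) = (\<integral>x. (\<Sum>i. F (\<kappa> n) x * t i x) \<partial>M)"
    proof (rule integral_cong_AE)
      show "AE x in M. F (\<kappa> n) x * g x = (\<Sum>i. F (\<kappa> n) x * t i x)"
        using AEH by eventually_elim (use sum_t summable_rabs_cancel in \<open>simp add: g_def suminf_mult\<close>)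
    qed measurable
    also have "\<dots> = (\<Sum>i. T n i)"
      unfolding T_def
    proof (rule integral_suminf)
      show "integrable M (\<lambda>x. F (\<kappa> n) x * t i x)" for i by (rule square_integrable_mult[OF F sqt])
      show "AE x in M. summable (\<lambda>i. norm (F (\<kappa> n) x * t i x))"
        using AEH by eventually_elim (use sum_t in \<open>simp add: abs_mult summable_mult\<close>)
      have "(\<integral>x. norm (F (\<kappa> n) x * t i x) \<partial>M) = (1 / 3) ^ i * (\<integral>x. \<bar>F (\<kappa> n) x * G i x\<bar> \<partial>M)" for i
      proof -
        have "norm (F (\<kappa> n) x * t i x) = (1 / 3) ^ i * \<bar>F (\<kappa> n) x * G i x\<bar>" for x
          by (simp add: abs_mult t_abs)
        then show ?thesis by (simp only: integral_mult_right_zero)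
      qed
      then show "summable (\<lambda>i. \<integral>x. norm (F (\<kappa> n) x * t i x) \<partial>M)"
        using FG_le(2)[of n]
        by (intro summable_comparison_test'[OF summable_mult2[OF geo(1), of "N n"]]) 
          (auto simp: integral_nonneg intro!: mult_left_mono)
    qed
    finally show ?thesis .
  qed
  obtain C where C: "\<And>k. \<bar>\<integral>x. F k x * g x \<partial>M\<bar> \<le> C" using bdd[OF sqg] by blast
  have "(4 / 3) ^ n / 2 \<le> C" for n
  proof -
    have sumT: "summable (\<lambda>i. \<bar>T n i\<bar>)"
      by (rule summable_comparison_test'[OF summable_mult2[OF geo(1), of "N n"]]) (use T_le in auto)
    then have sumT': "summable (T n)" by (rule summable_rabs_cancel)
    \<comment> \<open>The later weights sum to 3^(-n) / 2, and each product of
      \<open>F (\<kappa> n)\<close> with a normalized member is at most \<open>N n\<close>, so the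
      tail destroys at most half of the hump.\<close>
    have tail: "\<bar>\<Sum>i. T n (i + Suc n)\<bar> \<le> (1 / 3) ^ n * N n / 2"
    proof -
      have "\<bar>\<Sum>i. T n (i + Suc n)\<bar> \<le> (\<Sum>i. \<bar>T n (i + Suc n)\<bar>)"
        by (rule summable_rabs[OF summable_ignore_initial_segment[OF sumT]])
      also have "\<dots> \<le> (\<Sum>i. (1 / 3) ^ i * ((1 / 3) ^ Suc n * N n))"
      proof (rule suminf_le)
        show "\<bar>T n (i + Suc n)\<bar> \<le> (1 / 3) ^ i * ((1 / 3) ^ Suc n * N n)" for i
          using T_le[of n "i + Suc n"] by (simp add: power_add mult_ac)
        show "summable (\<lambda>i. \<bar>T n (i + Suc n)\<bar>)" by (rule summable_ignore_initial_segment[OF sumT])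
        show "summable (\<lambda>i. (1 / 3) ^ i * ((1 / 3) ^ Suc n * N n))" by (intro summable_mult2 geo)
      qed
      also have "\<dots> = (\<Sum>i. (1 / 3) ^ i) * ((1 / 3) ^ Suc n * N n)"
        by (rule suminf_mult2[symmetric, OF geo(1)])
      also have "\<dots> = (1 / 3) ^ n * N n / 2" by (simp add: geo(2))
      finally show ?thesis .
    qed
    have "(\<Sum>i. T n i) = (\<Sum>i. T n (i + Suc n)) + (\<Sum>i<Suc n. T n i)"
      by (rule suminf_split_initial_segment[OF sumT'])
    then have "\<bar>\<Sum>i. T n i\<bar> \<ge> (1 / 3) ^ n * N n / 2" using tail hump[of n] by linarith
    moreover have "(1 / 3) ^ n * N n \<ge> (1 / 3) ^ n * 4 ^ n"
      using N[of n] by (intro mult_left_mono) auto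
    moreover have "(1 / 3 :: real) ^ n * 4 ^ n = (4 / 3) ^ n" by (simp flip: power_mult_distrib)
    ultimately show ?thesis using C[of "\<kappa> n"] unfolding Fg by linarith
  qed
  moreover obtain n where "(4 / 3 :: real) ^ n > 2 * C" using real_arch_pow[of "4 / 3" "2 * C"] by auto
  ultimately show False by (smt (verit) field_sum_of_halves)
qed

section \<open>Weak limits of weak solutions\<close>

lemma conv_uminus: "conv J (\<lambda>y. - f y) z = - conv J f z"
  by (simp add: conv_def)

text \<open>Convolving at \<open>z\<close> is testing against the reflected mollifier centred at
  \<open>z\<close>, whose support fits into \<open>Q\<close>. The shape with three functions and
  three directions covers transport, divergence and curl at once.\<close>

lemma mollified_equation:
  fixes f1 f2 f3 :: "'a::euclidean_space \<Rightarrow> real"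
  assumes f: "square_integrable lborel f1" "square_integrable lborel f2" "square_integrable lborel f3"
    and eq: "\<And>\<phi>. \<phi> \<in> test_functions Q \<Longrightarrow> (LBINT y. f1 y * frechet_derivative \<phi> (at y) w1
      + f2 y * frechet_derivative \<phi> (at y) w2 + f3 y * frechet_derivative \<phi> (at y) w3) = 0"
    and "\<epsilon> > 0" "cball z \<epsilon> \<subseteq> Q"
  defines "J' \<equiv> \<lambda>w z. frechet_derivative (mollifier \<epsilon>) (at z) w"
  shows "conv (J' w1) f1 z + conv (J' w2) f2 z + conv (J' w3) f3 z = 0"
proof -
  define \<phi> where "\<phi> y = mollifier \<epsilon> (z - y)" for y
  have bd: "bounded_diff (mollifier \<epsilon>) J'" unfolding J'_def by (rule bounded_diff_mollifier[OF \<open>\<epsilon> > 0\<close>])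
  have D: "frechet_derivative \<phi> (at y) w = - J' w (z - y)" for y w
  proof -
    have "(mollifier \<epsilon> has_derivative frechet_derivative (mollifier \<epsilon>) (at (z - y))) (at (z - y))"
      using Ck_mollifier[of "Suc 0" \<epsilon>] by (auto simp: differentiable_on_def frechet_derivative_works)
    moreover have "((\<lambda>y. z - y) has_derivative (\<lambda>w. - w)) (at y)"
      by (auto intro!: derivative_eq_intros)
    ultimately have "(\<phi> has_derivative (\<lambda>w. frechet_derivative (mollifier \<epsilon>) (at (z - y)) (- w))) (at y)"
      unfolding \<phi>_def by (rule has_derivative_compose[rotated])
    then have "frechet_derivative \<phi> (at y) w = J' (- w) (z - y)"
      unfolding J'_def using frechet_derivative_at by metis
    then show ?thesis by (simp add: linear_neg[OF bounded_diff_linear[OF bd]])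
  qed
  have sqJ': "square_integrable lborel (J' w)" for w
  proof -
    obtain C where "\<And>z. \<bar>J' w z\<bar> \<le> C" using bounded_diff_deriv_bound[OF bd] by blast
    then show ?thesis
      by (intro square_integrable_bounded_support[where C = C and R = \<epsilon>] bounded_diff_measurable(2)[OF bd]
          bounded_diff_deriv_eq_0[OF bd, where R = \<epsilon>]) (auto intro!: mollifier_eq_0[OF \<open>\<epsilon> > 0\<close>])
  qed
  have int: "integrable lborel (\<lambda>y. f y * J' w (z - y))" if "square_integrable lborel f" for f w
    by (intro square_integrable_mult square_integrable_reflect sqJ' that)
  have "\<phi> \<in> test_functions Q" unfolding \<phi>_def by (rule mollifier_test_function) fact+
  from eq[OF this] have "(LBINT y. f1 y * J' w1 (z - y) + f2 y * J' w2 (z - y) + f3 y * J' w3 (z - y)) = 0"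
  proof -
    assume "(LBINT y. f1 y * frechet_derivative \<phi> (at y) w1
      + f2 y * frechet_derivative \<phi> (at y) w2 + f3 y * frechet_derivative \<phi> (at y) w3) = 0"
    then have "(LBINT y. - (f1 y * J' w1 (z - y) + f2 y * J' w2 (z - y) + f3 y * J' w3 (z - y))) = 0"
      unfolding D by simp
    then show ?thesis by (subst (asm) Bochner_Integration.integral_minus) simp
  qed
  then show ?thesis
    using int[OF f(1), of w1] int[OF f(2), of w2] int[OF f(3), of w3] by (simp add: conv_def mult.commute)
qed

lemma weakly_null_bounded:
  fixes f :: "nat \<Rightarrow> 'a::euclidean_space \<Rightarrow> real"
  assumes f: "\<And>k. square_integrable lborel (f k)"
    and weak: "\<And>g. square_integrable lborel g \<Longrightarrow> (\<lambda>k. LBINT z. g z * f k z) \<longlonglongrightarrow> 0"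
  obtains C where "C \<ge> 0" "\<And>k. (LBINT z. (f k z)\<^sup>2) \<le> C"
proof -
  have "\<exists>C. \<forall>k. \<bar>LBINT z. f k z * g z\<bar> \<le> C" if "square_integrable lborel g" for g
  proof -
    have "Bseq (\<lambda>k. LBINT z. g z * f k z)" using weak[OF that] by (intro convergent_imp_Bseq convergentI)
    then show ?thesis by (auto simp: Bseq_def mult.commute)
  qed
  from L2_uniform_boundedness[OF f this] obtain C where C: "\<And>k. (LBINT z. (f k z)\<^sup>2) \<le> C" by blast
  have "0 \<le> (LBINT z. (f 0 z)\<^sup>2)" by simp
  with C[of 0] have "C \<ge> 0" by linarith
  then show ?thesis using C that by blast
qed

lemma integral_mult_tendsto_0:
  assumes f: "\<And>k. square_integrable M (f k)" and g: "\<And>k. square_integrable M (g k)"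
    and fb: "\<And>k::nat. (\<integral>x. (f k x)\<^sup>2 \<partial>M) \<le> C" and g0: "(\<lambda>k. \<integral>x. (g k x)\<^sup>2 \<partial>M) \<longlonglongrightarrow> 0"
  shows "(\<lambda>k. \<integral>x. f k x * g k x \<partial>M) \<longlonglongrightarrow> 0"
proof (rule Lim_null_comparison)
  have "\<bar>\<integral>x. f k x * g k x \<partial>M\<bar> \<le> sqrt C * sqrt (\<integral>x. (g k x)\<^sup>2 \<partial>M)" for k
    by (rule order_trans[OF Cauchy_Schwarz_integral_sqrt[OF f g]]) (intro mult_right_mono real_sqrt_le_mono fb, simp)
  then show "\<forall>\<^sub>F k in sequentially. norm (\<integral>x. f k x * g k x \<partial>M) \<le> sqrt C * sqrt (\<integral>x. (g k x)\<^sup>2 \<partial>M)"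
    by simp
  show "(\<lambda>k. sqrt C * sqrt (\<integral>x. (g k x)\<^sup>2 \<partial>M)) \<longlonglongrightarrow> 0"
    using tendsto_mult[OF tendsto_const tendsto_real_sqrt[OF g0], of "sqrt C"] by simp
qed

text \<open>The differences between a sequence of solutions and its weak limit, as scalar functions
  on the whole space. All equations have the three-term form of \<open>mollified_equation\<close>,
  which is why the signs are attached to the functions.\<close>

locale weakly_null_solutions =
  fixes Q :: "spacetime set" and r v1 v2 n1 n2 :: "nat \<Rightarrow> spacetime \<Rightarrow> real"
  assumes sq: "\<And>k. square_integrable lborel (r k)" "\<And>k. square_integrable lborel (v1 k)"
      "\<And>k. square_integrable lborel (v2 k)" "\<And>k. square_integrable lborel (n1 k)" "\<And>k. square_integrable lborel (n2 k)"
    and weak: "\<And>g. square_integrable lborel g \<Longrightarrow> (\<lambda>k. LBINT z. g z * r k z) \<longlonglongrightarrow> 0"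
      "\<And>g. square_integrable lborel g \<Longrightarrow> (\<lambda>k. LBINT z. g z * v1 k z) \<longlonglongrightarrow> 0"
      "\<And>g. square_integrable lborel g \<Longrightarrow> (\<lambda>k. LBINT z. g z * v2 k z) \<longlonglongrightarrow> 0"
      "\<And>g. square_integrable lborel g \<Longrightarrow> (\<lambda>k. LBINT z. g z * n1 k z) \<longlonglongrightarrow> 0"
      "\<And>g. square_integrable lborel g \<Longrightarrow> (\<lambda>k. LBINT z. g z * n2 k z) \<longlonglongrightarrow> 0"
    and transport: "\<And>k \<phi>. \<phi> \<in> test_functions Q \<Longrightarrow> (LBINT z. r k z * frechet_derivative \<phi> (at z) dir_t
      + n1 k z * frechet_derivative \<phi> (at z) dir_x + n2 k z * frechet_derivative \<phi> (at z) dir_y) = 0"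
    and divergence: "\<And>k \<phi>. \<phi> \<in> test_functions Q \<Longrightarrow> (LBINT z. v1 k z * frechet_derivative \<phi> (at z) dir_x
      + v2 k z * frechet_derivative \<phi> (at z) dir_y + - r k z * frechet_derivative \<phi> (at z) dir_y) = 0"
    and curl: "\<And>k \<phi>. \<phi> \<in> test_functions Q \<Longrightarrow> (LBINT z. v2 k z * frechet_derivative \<phi> (at z) dir_x
      + r k z * frechet_derivative \<phi> (at z) dir_x + - v1 k z * frechet_derivative \<phi> (at z) dir_y) = 0"
begin

lemma energy_bound:
  obtains M where "M \<ge> 0" "\<And>k. (LBINT z. (r k z)\<^sup>2) \<le> M" "\<And>k. (LBINT z. (v1 k z)\<^sup>2) \<le> M"
    "\<And>k. (LBINT z. (v2 k z)\<^sup>2) \<le> M" "\<And>k. (LBINT z. (n1 k z)\<^sup>2) \<le> M" "\<And>k. (LBINT z. (n2 k z)\<^sup>2) \<le> M"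
proof -
  obtain C1 where C1: "C1 \<ge> 0" "\<And>k. (LBINT z. (r k z)\<^sup>2) \<le> C1" using weakly_null_bounded[OF sq(1) weak(1)] by blast
  obtain C2 where C2: "C2 \<ge> 0" "\<And>k. (LBINT z. (v1 k z)\<^sup>2) \<le> C2" using weakly_null_bounded[OF sq(2) weak(2)] by blast
  obtain C3 where C3: "C3 \<ge> 0" "\<And>k. (LBINT z. (v2 k z)\<^sup>2) \<le> C3" using weakly_null_bounded[OF sq(3) weak(3)] by blast
  obtain C4 where C4: "C4 \<ge> 0" "\<And>k. (LBINT z. (n1 k z)\<^sup>2) \<le> C4" using weakly_null_bounded[OF sq(4) weak(4)] by blast
  obtain C5 where C5: "C5 \<ge> 0" "\<And>k. (LBINT z. (n2 k z)\<^sup>2) \<le> C5" using weakly_null_bounded[OF sq(5) weak(5)] by blast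
  show ?thesis
    by (rule that[of "C1 + C2 + C3 + C4 + C5"]; (rule order_trans[OF C1(2)] order_trans[OF C2(2)] order_trans[OF C3(2)] 
          order_trans[OF C4(2)] order_trans[OF C5(2)])?) (use C1(1) C2(1) C3(1) C4(1) C5(1) in linarith)+
qed

text \<open>Each member is mollified at its own scale, so small that the squared L2 error is at most
  1 / (k + 1). The mollified sequence is still weakly null and solves the equations classically, and
  because energies are bounded the quadratic pairing changes by a null sequence only. The margin 2 d
  is spent once on mollifying and once on shifting.\<close>

lemma liminf_pairing:
  assumes \<psi>: "bounded_diff \<psi> \<psi>'" and nonneg: "\<And>z. 0 \<le> \<psi> z" and supp: "\<And>z. norm z > R \<Longrightarrow> \<psi> z = 0"
    and d: "d > 0" "\<And>z. \<psi> z \<noteq> 0 \<Longrightarrow> cball z (2 * d) \<subseteq> Q" and \<epsilon>: "\<epsilon>1\<^sup>2 + \<epsilon>2\<^sup>2 \<le> 1" and "\<eta> > 0"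
  shows "\<forall>\<^sub>F k in sequentially. (LBINT z. \<psi> z * (r k z * (r k z - (\<epsilon>1 * v1 k z + \<epsilon>2 * v2 k z)))) \<ge> - \<eta>"
proof -
  obtain M where M: "M \<ge> 0" "\<And>k. (LBINT z. (r k z)\<^sup>2) \<le> M" "\<And>k. (LBINT z. (v1 k z)\<^sup>2) \<le> M"
    "\<And>k. (LBINT z. (v2 k z)\<^sup>2) \<le> M" "\<And>k. (LBINT z. (n1 k z)\<^sup>2) \<le> M" "\<And>k. (LBINT z. (n2 k z)\<^sup>2) \<le> M"
    using energy_bound by blast
  \<comment> \<open>One scale must serve all five components, hence a minimum of five thresholds;
    \<open>e \<le> d\<close> keeps the mollifier inside the margin.\<close>
  have ex: "\<exists>e. 0 < e \<and> e \<le> d \<and> (\<forall>f\<in>{r k, v1 k, v2 k, n1 k, n2 k}. square_integrable lborel (conv (mollifier e) f)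
       \<and> (LBINT z. (conv (mollifier e) f z - f z)\<^sup>2) \<le> 1 / real (Suc k))" for k
  proof -
    define G where "G f c \<longleftrightarrow> 0 < c \<and> (\<forall>e. 0 < e \<longrightarrow> e \<le> c \<longrightarrow> square_integrable lborel (conv (mollifier e) f)
       \<and> (LBINT z. (conv (mollifier e) f z - f z)\<^sup>2) \<le> 1 / real (Suc k))" for f :: "spacetime \<Rightarrow> real" and c
    have *: "\<exists>c. G f c" if f: "square_integrable lborel f" for f :: "spacetime \<Rightarrow> real"
    proof -
      obtain c where "c > 0" "\<And>e. 0 < e \<Longrightarrow> e \<le> c \<Longrightarrow> square_integrable lborel (conv (mollifier e) f)
         \<and> (LBINT z. (conv (mollifier e) f z - f z)\<^sup>2) \<le> 1 / real (Suc k)"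
        by (rule mollify_L2[OF f, of "1 / real (Suc k)"]) auto
      then show ?thesis by (auto simp: G_def)
    qed
    obtain c1 where m1: "G (r k) c1" using *[OF sq(1)] by blast
    obtain c2 where m2: "G (v1 k) c2" using *[OF sq(2)] by blast
    obtain c3 where m3: "G (v2 k) c3" using *[OF sq(3)] by blast
    obtain c4 where m4: "G (n1 k) c4" using *[OF sq(4)] by blast
    obtain c5 where m5: "G (n2 k) c5" using *[OF sq(5)] by blast
    have c: "c1 > 0" "c2 > 0" "c3 > 0" "c4 > 0" "c5 > 0" using m1 m2 m3 m4 m5 by (auto simp: G_def)
    define e where "e = min d (min c1 (min c2 (min c3 (min c4 c5))))"
    have e: "0 < e" "e \<le> d" "e \<le> c1" "e \<le> c2" "e \<le> c3" "e \<le> c4" "e \<le> c5" using c d by (auto simp: e_def)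
    show ?thesis
    proof (intro exI[of _ e] conjI ballI)
      have mono: "G f e" if "G f c" "e \<le> c" for f c using that e(1) unfolding G_def by simp
      have G: "\<forall>f\<in>{r k, v1 k, v2 k, n1 k, n2 k}. G f e"
        by (simp add: mono[OF m1 e(3)] mono[OF m2 e(4)] mono[OF m3 e(5)] mono[OF m4 e(6)] mono[OF m5 e(7)])
      fix f assume "f \<in> {r k, v1 k, v2 k, n1 k, n2 k}"
      with G have "G f e" by (rule bspec)
      then have *: "square_integrable lborel (conv (mollifier e) f)
          \<and> (LBINT z. (conv (mollifier e) f z - f z)\<^sup>2) \<le> 1 / real (Suc k)"
        using e(1) by (simp add: G_def)
      show "square_integrable lborel (conv (mollifier e) f)" using * by (rule conjunct1)
      show "(LBINT z. (conv (mollifier e) f z - f z)\<^sup>2) \<le> 1 / real (Suc k)" using * by (rule conjunct2)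
    qed (fact e)+
  qed
  obtain e where E: "\<forall>k. 0 < e k \<and> e k \<le> d \<and> (\<forall>f\<in>{r k, v1 k, v2 k, n1 k, n2 k}.
       square_integrable lborel (conv (mollifier (e k)) f)
       \<and> (LBINT z. (conv (mollifier (e k)) f z - f z)\<^sup>2) \<le> 1 / real (Suc k))"
    using choice[OF allI[OF ex]] by (rule exE)
  have e: "0 < e k" "e k \<le> d" for k
    using conjunct1[OF spec[OF E]] conjunct1[OF conjunct2[OF spec[OF E]]] .
  have ef: "square_integrable lborel (conv (mollifier (e k)) f)
       \<and> (LBINT z. (conv (mollifier (e k)) f z - f z)\<^sup>2) \<le> 1 / real (Suc k)"
    if "f \<in> {r k, v1 k, v2 k, n1 k, n2 k}" for k f
    using bspec[OF conjunct2[OF conjunct2[OF spec[OF E]]] that] .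
  define S where "S f k = conv (mollifier (e k)) (f k)" for f :: "nat \<Rightarrow> spacetime \<Rightarrow> real" and k
  define S' where "S' f k w = conv (\<lambda>z. frechet_derivative (mollifier (e k)) (at z) w) (f k)" for f :: "nat \<Rightarrow> spacetime \<Rightarrow> real" and k w
  have fam: "f k \<in> {r k, v1 k, v2 k, n1 k, n2 k}" if "f \<in> {r, v1, v2, n1, n2}" for f k using that by auto
  have sqf: "square_integrable lborel (f k)" and Mf: "(LBINT z. (f k z)\<^sup>2) \<le> M" if "f \<in> {r, v1, v2, n1, n2}" for f k
    using that sq M by auto
  have sqS: "square_integrable lborel (S f k)" and err: "(LBINT z. (S f k z - f k z)\<^sup>2) \<le> 1 / real (Suc k)"
    if "f \<in> {r, v1, v2, n1, n2}" for f k
    using ef[OF fam[OF that]] by (auto simp: S_def)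
  have bdS: "bounded_diff (S f k) (S' f k)" if "f \<in> {r, v1, v2, n1, n2}" for f k
    unfolding S_def S'_def
    by (rule bounded_diff_conv[OF bounded_diff_mollifier[OF e(1)] _ sqf[OF that], where R = "e k"]) (auto intro!: mollifier_eq_0[OF e(1)] less_imp_le)
  have enS: "(LBINT z. (S f k z)\<^sup>2) \<le> 2 * M + 2" if "f \<in> {r, v1, v2, n1, n2}" for f k
  proof -
    have "(LBINT z. (S f k z)\<^sup>2) = (LBINT z. (f k z + (S f k z - f k z))\<^sup>2)" by simp
    also have "\<dots> \<le> 2 * (LBINT z. (f k z)\<^sup>2) + 2 * (LBINT z. (S f k z - f k z)\<^sup>2)"
      by (rule integral_square_add_le[OF sqf[OF that] square_integrable_diff[OF sqS[OF that] sqf[OF that]]])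
    also have "\<dots> \<le> 2 * M + 2 * 1"
    proof (intro add_mono mult_left_mono)
      have "1 / real (Suc k) \<le> 1" by simp
      with err[OF that, of k] show "(LBINT z. (S f k z - f k z)\<^sup>2) \<le> 1" by linarith
    qed (use Mf[OF that] in auto)
    finally show ?thesis by simp
  qed
  have err0: "(\<lambda>k. LBINT z. (S f k z - f k z)\<^sup>2) \<longlonglongrightarrow> 0" if "f \<in> {r, v1, v2, n1, n2}" for f
  proof (rule Lim_null_comparison)
    show "\<forall>\<^sub>F k in sequentially. norm (LBINT z. (S f k z - f k z)\<^sup>2) \<le> 1 / real (Suc k)"
      using err[OF that] by simp
    show "(\<lambda>k. 1 / real (Suc k)) \<longlonglongrightarrow> 0" using LIMSEQ_inverse_real_of_nat by (simp add: inverse_eq_divide)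
  qed
  define U where "U = {z. cball z d \<subseteq> Q}"
  have UQ: "cball z (e k) \<subseteq> Q" if "z \<in> U" for z k using that e(2)[of k] by (auto simp: U_def)
  obtain K0 where K0: "\<And>z. \<bar>\<psi> z\<bar> \<le> K0" using bounded_diff_bound[OF \<psi>] by blast
  obtain K1 where K1: "\<And>z. \<bar>\<psi>' dir_x z\<bar> \<le> K1" using bounded_diff_deriv_bound[OF \<psi>] by blast
  obtain K2 where K2: "\<And>z. \<bar>\<psi>' dir_y z\<bar> \<le> K2" using bounded_diff_deriv_bound[OF \<psi>] by blast
  define K where "K = max K0 (max K1 K2)"
  have mem: "r \<in> {r, v1, v2, n1, n2}" "v1 \<in> {r, v1, v2, n1, n2}" "v2 \<in> {r, v1, v2, n1, n2}"
    "n1 \<in> {r, v1, v2, n1, n2}" "n2 \<in> {r, v1, v2, n1, n2}" by auto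
  have sol: "smooth_solution (S r k) (S v1 k) (S v2 k) (S n1 k) (S n2 k) \<psi> (S' r k) (S' v1 k) (S' v2 k) (S' n1 k) (S' n2 k) \<psi>'
     U d R (2 * M + 2) K \<epsilon>1 \<epsilon>2" for k
  proof (intro smooth_solution.intro bdS sqS enS mem \<psi> nonneg supp d(1) \<epsilon>)
    fix z assume z: "z \<in> U"
    show "S' v1 k dir_x z + S' v2 k dir_y z - S' r k dir_y z = 0"
      using mollified_equation[OF sq(2) sq(3) square_integrable_uminus[OF sq(1)] divergence e(1) UQ[OF z]]
      by (simp add: S'_def conv_uminus)
    show "S' v2 k dir_x z + S' r k dir_x z - S' v1 k dir_y z = 0"
      using mollified_equation[OF sq(3) sq(1) square_integrable_uminus[OF sq(2)] curl e(1) UQ[OF z]]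
      by (simp add: S'_def conv_uminus)
    show "S' r k dir_t z + S' n1 k dir_x z + S' n2 k dir_y z = 0"
      using mollified_equation[OF sq(1) sq(4) sq(5) transport e(1) UQ[OF z]] by (simp add: S'_def)
  next
    fix z
    show "\<psi> z \<le> K" "\<bar>\<psi>' dir_x z\<bar> \<le> K" "\<bar>\<psi>' dir_y z\<bar> \<le> K"
      using K0[of z] K1[of z] K2[of z] by (auto simp: K_def)
    assume "\<psi> z \<noteq> 0"
    then have Q: "cball z (2 * d) \<subseteq> Q" by (rule d(2))
    show "cball z d \<subseteq> U"
    proof
      fix x assume x: "x \<in> cball z d"
      have "cball x d \<subseteq> cball z (2 * d)"
      proof
        fix y assume "y \<in> cball x d"
        then show "y \<in> cball z (2 * d)" using x dist_triangle[of z y x] by (simp add: mem_cball)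
      qed
      then show "x \<in> U" using Q by (auto simp: U_def)
    qed
  qed
  have meas\<psi>: "\<psi> \<in> borel_measurable lborel" using bounded_diff_measurable(1)[OF \<psi>] by simp
  have weakS: "(\<lambda>k. LBINT z. g z * S r k z) \<longlonglongrightarrow> 0" if g: "square_integrable lborel g" for g
  proof -
    have "(\<lambda>k. (LBINT z. g z * r k z) + (LBINT z. g z * (S r k z - r k z))) \<longlonglongrightarrow> 0 + 0"
      by (intro tendsto_add weak(1) g integral_mult_tendsto_0[where f = "\<lambda>_. g" and C = "LBINT z. (g z)\<^sup>2"]
          square_integrable_diff sqS sq err0 mem order_refl)
    moreover have "(LBINT z. g z * r k z) + (LBINT z. g z * (S r k z - r k z)) = (LBINT z. g z * S r k z)" for k
    proof -
      have "integrable lborel (\<lambda>z. g z * r k z)" "integrable lborel (\<lambda>z. g z * (S r k z - r k z))"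
        by (intro square_integrable_mult square_integrable_diff sqS sq g mem)+
      from Bochner_Integration.integral_add[OF this, symmetric] show ?thesis by (simp add: algebra_simps)
    qed
    ultimately show ?thesis by simp
  qed
  have ev: "\<forall>\<^sub>F k in sequentially. (LBINT z. \<psi> z * (S r k z * (S r k z - (\<epsilon>1 * S v1 k z + \<epsilon>2 * S v2 k z)))) \<ge> - (\<eta> / 2)"
    by (rule compensated_compactness[OF sol weakS]) (use \<open>\<eta> > 0\<close> in auto)
  define b where "b k z = r k z - (\<epsilon>1 * v1 k z + \<epsilon>2 * v2 k z)" for k z
  define Sb where "Sb k z = S r k z - (\<epsilon>1 * S v1 k z + \<epsilon>2 * S v2 k z)" for k z
  have sqb: "square_integrable lborel (b k)" and sqSb: "square_integrable lborel (Sb k)" for k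
    unfolding b_def Sb_def by (intro square_integrable_diff square_integrable_add square_integrable_cmult sq sqS mem)+
  have prod0: "(\<lambda>k. LBINT z. (\<psi> z * f k z) * g k z) \<longlonglongrightarrow> 0"
    if f: "\<And>k. square_integrable lborel (f k)" "\<And>k. (LBINT z. (f k z)\<^sup>2) \<le> C"
    and g: "\<And>k. square_integrable lborel (g k)" "(\<lambda>k. LBINT z. (g k z)\<^sup>2) \<longlonglongrightarrow> 0" for f g C
  proof -
    have s: "square_integrable lborel (\<lambda>z. \<psi> z * f k z)" for k
      by (rule square_integrable_bounded_mult[OF f(1) meas\<psi> K0])
    have "(LBINT z. (\<psi> z * f k z)\<^sup>2) \<le> K0\<^sup>2 * C" for k
    proof -
      have "(\<psi> z)\<^sup>2 \<le> K0\<^sup>2" for z using power_mono[OF K0[of z], of 2] by simp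
      then have "(LBINT z. (\<psi> z * f k z)\<^sup>2) \<le> (LBINT z. K0\<^sup>2 * (f k z)\<^sup>2)"
        using s[of k] f(1)[of k] by (intro integral_mono) (auto simp: square_integrable_def power_mult_distrib intro!: mult_right_mono)
      also have "\<dots> \<le> K0\<^sup>2 * C" using f(2)[of k] by (auto intro!: mult_left_mono)
      finally show ?thesis .
    qed
    from integral_mult_tendsto_0[OF s g(1) this g(2)] show ?thesis .
  qed
  have cmult0: "(\<lambda>k. LBINT z. (\<psi> z * f k z) * (c * g k z)) \<longlonglongrightarrow> 0"
    if "(\<lambda>k. LBINT z. (\<psi> z * f k z) * g k z) \<longlonglongrightarrow> 0" for f g c
    using tendsto_mult[OF tendsto_const that, of c] by (simp add: mult.left_commute[of _ c])
  have enb: "(LBINT z. (b k z)\<^sup>2) \<le> 2 * M + 2 * (2 * (\<epsilon>1\<^sup>2 * M) + 2 * (\<epsilon>2\<^sup>2 * M))" for k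
  proof -
    have "(LBINT z. (b k z)\<^sup>2) \<le> 2 * (LBINT z. (r k z)\<^sup>2) + 2 * (LBINT z. (\<epsilon>1 * v1 k z + \<epsilon>2 * v2 k z)\<^sup>2)"
      unfolding b_def by (intro integral_square_diff_le square_integrable_add square_integrable_cmult sq)
    also have "\<dots> \<le> 2 * M + 2 * (2 * (LBINT z. (\<epsilon>1 * v1 k z)\<^sup>2) + 2 * (LBINT z. (\<epsilon>2 * v2 k z)\<^sup>2))"
      by (intro add_mono mult_left_mono M integral_square_add_le square_integrable_cmult sq) auto
    also have "\<dots> \<le> 2 * M + 2 * (2 * (\<epsilon>1\<^sup>2 * M) + 2 * (\<epsilon>2\<^sup>2 * M))"
      by (intro add_mono mult_left_mono order_refl) (auto simp: power_mult_distrib M intro!: mult_left_mono)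
    finally show ?thesis .
  qed
  have i: "integrable lborel (\<lambda>z. (\<psi> z * f z) * g z)" if "square_integrable lborel f" "square_integrable lborel g" for f g
    by (rule square_integrable_mult[OF square_integrable_bounded_mult[OF that(1) meas\<psi> K0] that(2)])
  \<comment> \<open>The difference of the two pairings, arranged so that every correction has one
    factor of bounded energy and one mollification error, and therefore tends to zero.\<close>
  have split: "(LBINT z. \<psi> z * (r k z * b k z)) = (LBINT z. \<psi> z * (S r k z * Sb k z))
      - ((LBINT z. (\<psi> z * b k z) * (S r k z - r k z))
         + ((LBINT z. (\<psi> z * S r k z) * (S r k z - r k z))
            - ((LBINT z. (\<psi> z * S r k z) * (\<epsilon>1 * (S v1 k z - v1 k z)))
               + (LBINT z. (\<psi> z * S r k z) * (\<epsilon>2 * (S v2 k z - v2 k z))))))" for k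
  proof -
    note t = sq(1)[of k] sqb[of k] sqS[OF mem(1), of k] sqSb[of k]
      square_integrable_diff[OF sqS[OF mem(1), of k] sq(1)[of k]]
      square_integrable_cmult[OF square_integrable_diff[OF sqS[OF mem(2), of k] sq(2)[of k]], of \<epsilon>1]
      square_integrable_cmult[OF square_integrable_diff[OF sqS[OF mem(3), of k] sq(3)[of k]], of \<epsilon>2]
    have "(LBINT z. \<psi> z * (r k z * b k z)) = (LBINT z. (\<psi> z * S r k z) * Sb k z - ((\<psi> z * b k z) * (S r k z - r k z)
        + ((\<psi> z * S r k z) * (S r k z - r k z) - ((\<psi> z * S r k z) * (\<epsilon>1 * (S v1 k z - v1 k z)) 
        + (\<psi> z * S r k z) * (\<epsilon>2 * (S v2 k z - v2 k z))))))"
      by (intro Bochner_Integration.integral_cong) (auto simp: b_def Sb_def algebra_simps)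
    also have "\<dots> = (LBINT z. (\<psi> z * S r k z) * Sb k z) - ((LBINT z. (\<psi> z * b k z) * (S r k z - r k z))
        + ((LBINT z. (\<psi> z * S r k z) * (S r k z - r k z)) - ((LBINT z. (\<psi> z * S r k z) * (\<epsilon>1 * (S v1 k z - v1 k z)))
        + (LBINT z. (\<psi> z * S r k z) * (\<epsilon>2 * (S v2 k z - v2 k z))))))"
      using i[OF t(3) t(4)] i[OF t(2) t(5)] i[OF t(3) t(5)] i[OF t(3) t(6)] i[OF t(3) t(7)]
      by (simp only: Bochner_Integration.integral_diff Bochner_Integration.integral_add
          Bochner_Integration.integrable_diff Bochner_Integration.integrable_add)
    finally show ?thesis by (simp add: mult.assoc)
  qed
  have "(\<lambda>k. (LBINT z. (\<psi> z * b k z) * (S r k z - r k z))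
         + ((LBINT z. (\<psi> z * S r k z) * (S r k z - r k z))
            - ((LBINT z. (\<psi> z * S r k z) * (\<epsilon>1 * (S v1 k z - v1 k z)))
               + (LBINT z. (\<psi> z * S r k z) * (\<epsilon>2 * (S v2 k z - v2 k z)))))) \<longlonglongrightarrow> 0 + (0 - (0 + 0))"
    by (intro tendsto_add tendsto_diff cmult0 prod0[OF sqb enb] prod0[OF sqS[OF mem(1)] enS[OF mem(1)]]
        square_integrable_diff sqS sq err0 mem)
  then have "\<forall>\<^sub>F k in sequentially. (LBINT z. (\<psi> z * b k z) * (S r k z - r k z))
         + ((LBINT z. (\<psi> z * S r k z) * (S r k z - r k z))
            - ((LBINT z. (\<psi> z * S r k z) * (\<epsilon>1 * (S v1 k z - v1 k z)))
               + (LBINT z. (\<psi> z * S r k z) * (\<epsilon>2 * (S v2 k z - v2 k z))))) < \<eta> / 2"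
    using \<open>\<eta> > 0\<close> by (intro order_tendstoD(2)) auto
  with ev show ?thesis
  proof eventually_elim
    case (elim k)
    then show ?case using split[of k] unfolding b_def Sb_def by linarith
  qed
qed

end

subsection \<open>Localization\<close>

text \<open>The points of \<open>Q\<close> where F is positive are exhausted by the sets
  \<open>P j\<close>, which stay away from the boundary. Mollified indicators of \<open>P j\<close>
  are admissible weights and converge to the indicator almost everywhere along a subsequence, so the
  integral of F over \<open>P j\<close> is at most 0 and \<open>P j\<close> is a null set.\<close>

lemma AE_nonpos_if_integral_nonpos:
  fixes F :: "'a::euclidean_space \<Rightarrow> real"
  assumes Q: "open Q" "bounded Q" and F: "integrable lborel F"
    and test: "\<And>\<psi> \<psi>' R d. \<lbrakk>bounded_diff \<psi> \<psi>'; \<And>z. 0 \<le> \<psi> z; \<And>z. norm z > R \<Longrightarrow> \<psi> z = 0; d > 0;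
      \<And>z. \<psi> z \<noteq> 0 \<Longrightarrow> cball z (2 * d) \<subseteq> Q\<rbrakk> \<Longrightarrow> (LBINT z. \<psi> z * F z) \<le> 0"
  shows "AE z in lborel. z \<in> Q \<longrightarrow> F z \<le> 0"
proof -
  have [measurable]: "F \<in> borel_measurable borel" using F by auto
  \<comment> \<open>The distance to an empty set is 0 by convention, which would make every
    \<open>P j\<close> empty; boundedness of \<open>Q\<close> excludes this.\<close>
  have ne: "- Q \<noteq> {}" using Q(2) not_bounded_UNIV[where 'a = 'a] by (metis Compl_empty_eq double_complement)
  obtain R where R: "\<And>z. z \<in> Q \<Longrightarrow> norm z \<le> R" using Q(2) by (auto simp: bounded_iff)
  define P where "P j = {z. F z > 0 \<and> infdist z (- Q) > 3 / real (Suc j)}" for j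
  have [measurable]: "P j \<in> sets borel" for j
  proof -
    have "open {z. infdist z (- Q) > 3 / real (Suc j)}"
      by (intro open_Collect_less continuous_intros)
    then have "{z. infdist z (- Q) > 3 / real (Suc j)} \<in> sets borel" by simp
    moreover have "{z. F z > 0} \<in> sets borel" by measurable
    ultimately have "{z. F z > 0} \<inter> {z. infdist z (- Q) > 3 / real (Suc j)} \<in> sets borel" by blast
    then show ?thesis by (simp add: P_def Collect_conj_eq)
  qed
  have PQ: "cball z (3 / real (Suc j)) \<subseteq> Q" if "z \<in> P j" for z j
  proof
    fix x assume "x \<in> cball z (3 / real (Suc j))"
    then have "dist z x \<le> 3 / real (Suc j)" by simp
    with that infdist_le[of x "- Q" z] show "x \<in> Q" by (force simp: P_def)
  qed
  have PR: "norm z \<le> R" if "z \<in> P j" for z j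
    using R[of z] PQ[OF that] by (auto simp: subset_iff)
  have "AE z in lborel. z \<notin> P j" for j
  proof -
    \<comment> \<open>The distance 3 c from the complement is spent on c for mollifying
      \<open>P j\<close> and on 2 c for the ball required of a weight.\<close>
    define c where "c = 1 / real (Suc j)"
    have c: "c > 0" by (simp add: c_def)
    define I :: "'a \<Rightarrow> real" where "I = indicator (P j)"
    have [measurable]: "I \<in> borel_measurable borel" unfolding I_def by measurable
    have sqI: "square_integrable lborel I"
      by (rule square_integrable_bounded_support[where C = 1 and R = R]) (use PR in \<open>auto simp: I_def indicator_def dest: PR\<close>)
    have "\<exists>\<epsilon>. 0 < \<epsilon> \<and> \<epsilon> \<le> c \<and> square_integrable lborel (conv (mollifier \<epsilon>) I) \<and> (LBINT z. (conv (mollifier \<epsilon>) I z - I z)\<^sup>2) \<le> 1 / real (Suc k)" for k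
    proof -
      obtain d where "d > 0" "\<And>\<epsilon>. 0 < \<epsilon> \<Longrightarrow> \<epsilon> \<le> d \<Longrightarrow> square_integrable lborel (conv (mollifier \<epsilon>) I)
         \<and> (LBINT z. (conv (mollifier \<epsilon>) I z - I z)\<^sup>2) \<le> 1 / real (Suc k)"
        by (rule mollify_L2[OF sqI, of "1 / real (Suc k)"]) auto
      then show ?thesis using c by (intro exI[of _ "min c d"]) auto
    qed
    then obtain \<epsilon> where \<epsilon>: "\<And>k. 0 < \<epsilon> k" "\<And>k. \<epsilon> k \<le> c" and sqc: "\<And>k. square_integrable lborel (conv (mollifier (\<epsilon> k)) I)"
      and err: "\<And>k. (LBINT z. (conv (mollifier (\<epsilon> k)) I z - I z)\<^sup>2) \<le> 1 / real (Suc k)"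
      by metis
    define \<psi> where "\<psi> k = conv (mollifier (\<epsilon> k)) I" for k
    have bd: "bounded_diff (\<psi> k) (\<lambda>w. conv (\<lambda>z. frechet_derivative (mollifier (\<epsilon> k)) (at z) w) I)" for k
      unfolding \<psi>_def by (rule bounded_diff_conv[OF bounded_diff_mollifier[OF \<epsilon>(1)] _ sqI, where R = "\<epsilon> k"]) 
        (auto intro!: mollifier_eq_0[OF \<epsilon>(1)] less_imp_le)
    note [measurable] = bounded_diff_measurable(1)[OF bd]
    have nn: "0 \<le> \<psi> k z" for k z
      unfolding \<psi>_def conv_def by (intro Bochner_Integration.integral_nonneg) (auto simp: mollifier_nonneg I_def)
    have le1: "\<psi> k z \<le> 1" for k z
    proof -
      have int: "integrable lborel (\<lambda>y. mollifier (\<epsilon> k) (z - y))"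
        by (rule integrable_reflect[OF integrable_mollifier[OF \<epsilon>(1)]])
      have "\<psi> k z \<le> (LBINT y. mollifier (\<epsilon> k) (z - y))"
        unfolding \<psi>_def conv_def
      proof (rule integral_mono[OF _ int])
        show "integrable lborel (\<lambda>y. mollifier (\<epsilon> k) (z - y) * I y)"
          by (rule Bochner_Integration.integrable_bound[OF int]) (auto simp: I_def indicator_def)
      qed (auto simp: I_def indicator_def mollifier_nonneg)
      also have "\<dots> = 1" using integral_mollifier[OF \<epsilon>(1)] integral_reflect[of "mollifier (\<epsilon> k)" z] by simp
      finally show ?thesis .
    qed
    have near: "\<exists>y\<in>P j. dist z y < c" if nz: "\<psi> k z \<noteq> 0" for k and z :: 'a
    proof (rule ccontr)
      assume no: "\<not> ?thesis"
      have "mollifier (\<epsilon> k) (z - y) * I y = 0" for y :: 'a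
      proof (cases "y \<in> P j")
        case True
        then have "norm (z - y) \<ge> \<epsilon> k" using no \<epsilon>(2)[of k] by (force simp: dist_norm)
        then show ?thesis by (simp add: mollifier_eq_0[OF \<epsilon>(1)])
      qed (simp add: I_def)
      then have "\<psi> k z = 0" unfolding \<psi>_def conv_def by (simp only: Bochner_Integration.integral_zero)
      with nz show False by simp
    qed
    have le0: "(LBINT z. \<psi> k z * F z) \<le> 0" for k
    proof (rule test[OF bd nn, where R = "R + c" and d = c])
      fix z :: 'a assume z: "norm z > R + c"
      show "\<psi> k z = 0"
      proof (rule ccontr)
        assume "\<psi> k z \<noteq> 0"
        then obtain y where "y \<in> P j" "dist z y < c" using near by blast
        with PR[of y j] z norm_triangle_sub[of z y] show False by (simp add: dist_norm)
      qed
    next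
      fix z :: 'a assume "\<psi> k z \<noteq> 0"
      then obtain y where y: "y \<in> P j" "dist z y < c" using near by blast
      have "cball z (2 * c) \<subseteq> cball y (3 / real (Suc j))"
      proof
        fix x assume "x \<in> cball z (2 * c)"
        then have "dist y x \<le> 3 * c" using y(2) dist_triangle[of y x z] by (simp add: dist_commute)
        then show "x \<in> cball y (3 / real (Suc j))" by (simp add: c_def)
      qed
      with PQ[OF y(1)] show "cball z (2 * c) \<subseteq> Q" by blast
    qed (rule c)
    have "(\<lambda>k. LBINT z. norm ((\<psi> k z - I z)\<^sup>2)) \<longlonglongrightarrow> 0"
    proof (rule Lim_null_comparison)
      show "\<forall>\<^sub>F k in sequentially. norm (LBINT z. norm ((\<psi> k z - I z)\<^sup>2)) \<le> 1 / real (Suc k)"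
        using err by (simp add: \<psi>_def)
      show "(\<lambda>k. 1 / real (Suc k)) \<longlonglongrightarrow> 0" using LIMSEQ_inverse_real_of_nat by (simp add: inverse_eq_divide)
    qed
    moreover have "integrable lborel (\<lambda>z. (\<psi> k z - I z)\<^sup>2)" for k
      unfolding \<psi>_def by (rule square_integrableD[OF square_integrable_diff[OF sqc sqI]])
    ultimately obtain s where s: "strict_mono s" "AE z in lborel. (\<lambda>n. (\<psi> (s n) z - I z)\<^sup>2) \<longlonglongrightarrow> 0"
      using tendsto_L1_AE_subseq[of lborel "\<lambda>k z. (\<psi> k z - I z)\<^sup>2"] by blast
    have "(\<lambda>n. LBINT z. \<psi> (s n) z * F z) \<longlonglongrightarrow> (LBINT z. I z * F z)"
    proof (rule integral_dominated_convergence[where w = "\<lambda>z. \<bar>F z\<bar>"])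
      show "AE z in lborel. (\<lambda>n. \<psi> (s n) z * F z) \<longlonglongrightarrow> I z * F z"
        using s(2)
      proof eventually_elim
        case (elim z)
        have "(\<lambda>n. \<bar>\<psi> (s n) z - I z\<bar>) \<longlonglongrightarrow> 0" using tendsto_real_sqrt[OF elim] by simp
        then have "(\<lambda>n. \<psi> (s n) z) \<longlonglongrightarrow> I z" using LIM_zero_cancel tendsto_rabs_zero_iff by blast
        then show ?case by (intro tendsto_intros)
      qed
      show "AE z in lborel. norm (\<psi> (s n) z * F z) \<le> \<bar>F z\<bar>" for n
        using nn le1 by (intro AE_I2) (auto simp: abs_mult abs_of_nonneg intro!: mult_left_le_one_le)
    qed (use F in auto)
    then have "(LBINT z. I z * F z) \<le> 0" using le0 by (intro LIMSEQ_le_const2) auto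
    moreover have intIF: "integrable lborel (\<lambda>z. I z * F z)"
      using integrable_real_mult_indicator[OF _ F, of "P j"] by (simp add: I_def mult.commute)
    moreover have IFnn: "0 \<le> I z * F z" for z by (auto simp: I_def indicator_def P_def)
    ultimately have "(LBINT z. I z * F z) = 0" by (intro antisym Bochner_Integration.integral_nonneg) auto
    then have "AE z in lborel. I z * F z = 0"
      using integral_nonneg_eq_0_iff_AE[OF intIF] IFnn by simp
    then show ?thesis by eventually_elim (auto simp: I_def indicator_def P_def split: if_splits)
  qed
  then have "AE z in lborel. \<forall>j. z \<notin> P j" by (simp add: AE_all_countable)
  then show ?thesis
  proof eventually_elim
    case (elim z)
    show ?case
    proof
      assume "z \<in> Q"
      have "closed (- Q)" using Q(1) by (simp add: closed_def)
      then have "infdist z (- Q) > 0" 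
        using \<open>z \<in> Q\<close> ne in_closed_iff_infdist_zero[of "- Q" z] infdist_nonneg[of z "- Q"] by force
      then obtain j where j: "3 / infdist z (- Q) < real j" using reals_Archimedean2 by blast
      with \<open>infdist z (- Q) > 0\<close> have "infdist z (- Q) > 3 / real (Suc j)" by (simp add: field_simps)
      with elim show "F z \<le> 0" by (force simp: P_def)
    qed
  qed
qed

lemma square_integrable_bounded_borel:
  assumes "square_integrable lborel f" "bounded_diff \<psi> \<psi>'"
  shows "square_integrable lborel (\<lambda>z. \<psi> z * f z)"
proof -
  obtain C where "\<And>z. \<bar>\<psi> z\<bar> \<le> C" using bounded_diff_bound[OF assms(2)] by blast
  with assms show ?thesis
    by (intro square_integrable_bounded_mult[where C = C]) (auto dest: bounded_diff_measurable(1))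
qed

text \<open>For \<open>(\<epsilon>1, \<epsilon>2)\<close> in the unit disc, the conditions \<open>separation \<dots> \<le> 0\<close> together say that
  \<open>\<bar>\<rho>\<bar> \<le> 1\<close> (from the center) and \<open>\<bar>m - \<rho> u / 2\<bar> \<le> (1 - \<rho>\<^sup>2) / 2\<close>.\<close>

definition separation :: "real \<Rightarrow> real \<Rightarrow> real \<Rightarrow> real \<Rightarrow> real \<Rightarrow> real \<Rightarrow> real \<Rightarrow> real" where
  "separation \<epsilon>1 \<epsilon>2 \<rho> u1 u2 m1 m2 = \<epsilon>1 * m1 + \<epsilon>2 * m2 - \<rho> * (\<epsilon>1 * u1 + \<epsilon>2 * u2) / 2 + (\<rho>\<^sup>2 - 1) / 2"

context weakly_null_solutions
begin

text \<open>When \<open>separation\<close> is expanded at the limit, the terms linear in the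
  differences are weakly null and the quadratic rest is r (r - v . e) / 2. Its weighted integral is
  asymptotically nonnegative, so the sign passes to the limit, weight by weight.\<close>

lemma weak_limit_separation_nonpos:
  assumes Q: "open Q" "bounded Q" and \<epsilon>: "\<epsilon>1\<^sup>2 + \<epsilon>2\<^sup>2 \<le> 1"
    and sq0: "square_integrable lborel \<rho>" "square_integrable lborel u1" "square_integrable lborel u2"
      "square_integrable lborel m1" "square_integrable lborel m2"
    and neg: "\<And>k. AE z in lborel. z \<in> Q \<longrightarrow>
      separation \<epsilon>1 \<epsilon>2 (\<rho> z + r k z) (u1 z + v1 k z) (u2 z + v2 k z) (m1 z + n1 k z) (m2 z + n2 k z) \<le> 0"
  shows "AE z in lborel. z \<in> Q \<longrightarrow> separation \<epsilon>1 \<epsilon>2 (\<rho> z) (u1 z) (u2 z) (m1 z) (m2 z) \<le> 0"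
proof -
  define I :: "spacetime \<Rightarrow> real" where "I = indicator Q"
  have Qb: "Q \<in> sets borel" using Q by simp
  obtain R0 where R0: "\<And>z. z \<in> Q \<Longrightarrow> norm z \<le> R0" using Q(2) by (auto simp: bounded_iff)
  have sqI: "square_integrable lborel I"
    by (rule square_integrable_bounded_support[where C = 1 and R = R0]) 
      (use Qb in \<open>auto simp: I_def indicator_def dest: R0\<close>)
  \<comment> \<open>The constant in \<open>separation\<close> is not integrable over the whole
    space. Restricting to \<open>Q\<close> by an idempotent factor lets every term be written as a
    product of square-integrable functions.\<close>
  have I2: "I z * I z = I z" for z by (simp add: I_def indicator_def)
  have sqIf: "square_integrable lborel (\<lambda>z. I z * f z)" if "square_integrable lborel f" for f
    by (rule square_integrable_bounded_mult[where C = 1, OF that]) (use Qb in \<open>auto simp: I_def indicator_def\<close>)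
  define F where "F \<rho> u1 u2 m1 m2 z = I z * separation \<epsilon>1 \<epsilon>2 (\<rho> z) (u1 z) (u2 z) (m1 z) (m2 z)"
    for \<rho> u1 u2 m1 m2 :: "spacetime \<Rightarrow> real" and z
  have intF: "integrable lborel (F \<rho> u1 u2 m1 m2)"
    if s: "square_integrable lborel \<rho>" "square_integrable lborel u1" "square_integrable lborel u2"
      "square_integrable lborel m1" "square_integrable lborel m2" for \<rho> u1 u2 m1 m2
  proof -
    have "integrable lborel (\<lambda>z. I z * (\<epsilon>1 * m1 z + \<epsilon>2 * m2 z) - (I z * \<rho> z) * ((\<epsilon>1 / 2) * u1 z + (\<epsilon>2 / 2) * u2 z)
        + ((I z * \<rho> z) * ((1 / 2) * \<rho> z) - I z * ((1 / 2) * I z)))"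
      by (intro Bochner_Integration.integrable_add Bochner_Integration.integrable_diff square_integrable_mult square_integrable_add square_integrable_cmult sqI sqIf s)
    also have "(\<lambda>z. I z * (\<epsilon>1 * m1 z + \<epsilon>2 * m2 z) - (I z * \<rho> z) * ((\<epsilon>1 / 2) * u1 z + (\<epsilon>2 / 2) * u2 z)
        + ((I z * \<rho> z) * ((1 / 2) * \<rho> z) - I z * ((1 / 2) * I z))) = F \<rho> u1 u2 m1 m2"
    proof
      fix z
      have "I z * ((1 / 2) * I z) = I z / 2" using I2[of z] by simp
      then show "I z * (\<epsilon>1 * m1 z + \<epsilon>2 * m2 z) - (I z * \<rho> z) * ((\<epsilon>1 / 2) * u1 z + (\<epsilon>2 / 2) * u2 z)
        + ((I z * \<rho> z) * ((1 / 2) * \<rho> z) - I z * ((1 / 2) * I z)) = F \<rho> u1 u2 m1 m2 z"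
        by (simp only: F_def separation_def) (simp add: power2_eq_square field_simps)
    qed
    finally show ?thesis .
  qed
  have "AE z in lborel. z \<in> Q \<longrightarrow> F \<rho> u1 u2 m1 m2 z \<le> 0"
  proof (rule AE_nonpos_if_integral_nonpos[OF Q intF[OF sq0]])
    fix \<psi> \<psi>' R d
    assume \<psi>: "bounded_diff \<psi> \<psi>'" and nn: "\<And>z. 0 \<le> \<psi> z" and supp: "\<And>z. norm z > R \<Longrightarrow> \<psi> z = 0"
      and d: "d > 0" "\<And>z. \<psi> z \<noteq> 0 \<Longrightarrow> cball z (2 * d) \<subseteq> Q"
    note [measurable] = bounded_diff_measurable(1)[OF \<psi>]
    obtain C where C: "\<And>z. \<bar>\<psi> z\<bar> \<le> C" using bounded_diff_bound[OF \<psi>] by blast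
    have sq\<psi>: "square_integrable lborel \<psi>"
      by (rule square_integrable_bounded_support[where C = C and R = R]) (auto intro: C supp)
    have \<psi>I: "\<psi> z * I z = \<psi> z" for z
    proof (cases "\<psi> z = 0")
      case False
      have "z \<in> Q" using d(2)[OF False] d(1) by (meson centre_in_cball less_eq_real_def mult_pos_pos subsetD zero_less_numeral)
      then show ?thesis by (simp add: I_def)
    qed simp
    have s\<psi>: "square_integrable lborel (\<lambda>z. \<psi> z * f z)" if "square_integrable lborel f" for f
      by (rule square_integrable_bounded_borel[OF that \<psi>])
    \<comment> \<open>Coefficients of the linear part: \<open>g\<close> belongs to v, up to the
      factors - \<epsilon>1 / 2 and - \<epsilon>2 / 2, and \<open>h\<close> to \<open>r\<close>,
      being \<psi> times the derivative of \<open>separation\<close> in the density.\<close>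
    define g where "g z = \<psi> z * \<rho> z" for z
    define h where "h z = \<psi> z * \<rho> z - (\<epsilon>1 / 2) * (\<psi> z * u1 z) - (\<epsilon>2 / 2) * (\<psi> z * u2 z)" for z
    have sqg: "square_integrable lborel g" and sqh: "square_integrable lborel h"
      unfolding g_def h_def by (intro square_integrable_diff square_integrable_cmult s\<psi> sq0)+
    define L where "L k = \<epsilon>1 * (LBINT z. \<psi> z * n1 k z) + \<epsilon>2 * (LBINT z. \<psi> z * n2 k z)
      - \<epsilon>1 / 2 * (LBINT z. g z * v1 k z) - \<epsilon>2 / 2 * (LBINT z. g z * v2 k z) + (LBINT z. h z * r k z)" for k
    define X where "X k = (LBINT z. \<psi> z * (r k z * (r k z - (\<epsilon>1 * v1 k z + \<epsilon>2 * v2 k z))))" for k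
    have "L \<longlonglongrightarrow> \<epsilon>1 * 0 + \<epsilon>2 * 0 - \<epsilon>1 / 2 * 0 - \<epsilon>2 / 2 * 0 + 0"
      unfolding L_def by (intro tendsto_add tendsto_diff tendsto_mult tendsto_const weak sq\<psi> sqg sqh)
    then have L0: "L \<longlonglongrightarrow> 0" by simp
    have le: "(LBINT z. \<psi> z * F \<rho> u1 u2 m1 m2 z) \<le> - L k - X k / 2" for k
    proof -
      define w where "w = F (\<lambda>z. \<rho> z + r k z) (\<lambda>z. u1 z + v1 k z) (\<lambda>z. u2 z + v2 k z) (\<lambda>z. m1 z + n1 k z) (\<lambda>z. m2 z + n2 k z)"
      have intw: "integrable lborel w" unfolding w_def by (intro intF square_integrable_add sq sq0)
      have int\<psi>: "integrable lborel (\<lambda>z. \<psi> z * f z)" if "integrable lborel f" for f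
      proof (rule Bochner_Integration.integrable_bound)
        show "integrable lborel (\<lambda>z. C * f z)" using that by simp
        show "(\<lambda>z. \<psi> z * f z) \<in> borel_measurable lborel" using that by measurable
        have "C \<ge> 0" using C[of 0] by linarith
        then show "AE z in lborel. norm (\<psi> z * f z) \<le> norm (C * f z)"
          using C by (auto intro!: AE_I2 mult_right_mono simp: abs_mult)
      qed
      have i: "integrable lborel (\<lambda>z. \<psi> z * n1 k z)" "integrable lborel (\<lambda>z. \<psi> z * n2 k z)" 
        "integrable lborel (\<lambda>z. g z * v1 k z)" "integrable lborel (\<lambda>z. g z * v2 k z)" "integrable lborel (\<lambda>z. h z * r k z)"
        by (intro square_integrable_mult sq\<psi> sqg sqh sq)+
      have iX: "integrable lborel (\<lambda>z. \<psi> z * (r k z * (r k z - (\<epsilon>1 * v1 k z + \<epsilon>2 * v2 k z))))"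
        by (intro int\<psi> square_integrable_mult square_integrable_diff square_integrable_add square_integrable_cmult sq)
      have "(LBINT z. \<psi> z * w z) \<le> 0"
      proof -
        have "AE z in lborel. \<psi> z * w z \<le> 0"
          using neg[of k]
        proof eventually_elim
          case (elim z)
          then have "w z \<le> 0" by (auto simp: w_def F_def I_def indicator_def)
          then show ?case using nn by (simp add: mult_nonneg_nonpos)
        qed
        then have "0 \<le> (LBINT z. - (\<psi> z * w z))" by (intro integral_nonneg_AE) simp
        then show ?thesis by simp
      qed
      moreover have "\<psi> z * w z = \<psi> z * F \<rho> u1 u2 m1 m2 z + (\<epsilon>1 * (\<psi> z * n1 k z) + \<epsilon>2 * (\<psi> z * n2 k z)
          - \<epsilon>1 / 2 * (g z * v1 k z) - \<epsilon>2 / 2 * (g z * v2 k z) + h z * r k z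
          + (\<psi> z * (r k z * (r k z - (\<epsilon>1 * v1 k z + \<epsilon>2 * v2 k z)))) / 2)" for z
      proof -
        have "\<psi> z * w z = \<psi> z * separation \<epsilon>1 \<epsilon>2 (\<rho> z + r k z) (u1 z + v1 k z) (u2 z + v2 k z) (m1 z + n1 k z) (m2 z + n2 k z)"
          "\<psi> z * F \<rho> u1 u2 m1 m2 z = \<psi> z * separation \<epsilon>1 \<epsilon>2 (\<rho> z) (u1 z) (u2 z) (m1 z) (m2 z)"
          using \<psi>I[of z] by (simp_all add: w_def F_def flip: mult.assoc)
        then show ?thesis
          by (simp only: separation_def g_def h_def) (simp add: power2_eq_square field_simps)
      qed
      then have "(LBINT z. \<psi> z * w z) = (LBINT z. \<psi> z * F \<rho> u1 u2 m1 m2 z) + (L k + X k / 2)"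
        using i iX int\<psi>[OF intF[OF sq0]] by (simp add: L_def X_def)
      ultimately show ?thesis by linarith
    qed
    show "(LBINT z. \<psi> z * F \<rho> u1 u2 m1 m2 z) \<le> 0"
    proof (rule field_le_epsilon)
      fix e :: real assume "e > 0"
      have "\<forall>\<^sub>F k in sequentially. X k \<ge> - e"
        unfolding X_def by (rule liminf_pairing[OF \<psi> nn supp d \<epsilon> \<open>e > 0\<close>])
      moreover have "\<forall>\<^sub>F k in sequentially. L k > - (e / 2)"
        using L0 \<open>e > 0\<close> by (intro order_tendstoD(1)) auto
      ultimately have "\<forall>\<^sub>F k in sequentially. - L k - X k / 2 \<le> e"
        by eventually_elim linarith
      then obtain k where "- L k - X k / 2 \<le> e" by (auto simp: eventually_sequentially)
      with le[of k] show "(LBINT z. \<psi> z * F \<rho> u1 u2 m1 m2 z) \<le> 0 + e" by linarith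
    qed
  qed
  then show ?thesis by eventually_elim (auto simp: F_def I_def)
qed

end

subsection \<open>Borel representatives\<close>

text \<open>Functions on \<open>lebesgue_on Q\<close> are measurable for the completed measure only,
  while translations and Fubini are used on \<open>lborel\<close>. A Borel representative extended
  by zero bridges the two; any choice will do, since it is determined almost everywhere.\<close>

definition borel_rep :: "'a::euclidean_space set \<Rightarrow> ('a \<Rightarrow> real) \<Rightarrow> 'a \<Rightarrow> real" where
  "borel_rep Q f = (SOME g. g \<in> borel_measurable borel \<and> (\<forall>z. z \<notin> Q \<longrightarrow> g z = 0) \<and> (AE z in lborel. z \<in> Q \<longrightarrow> g z = f z))"

lemma borel_rep:
  assumes "open Q" and f: "f \<in> borel_measurable (lebesgue_on Q)"
  shows "borel_rep Q f \<in> borel_measurable borel" "\<And>z. z \<notin> Q \<Longrightarrow> borel_rep Q f z = 0"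
    "AE z in lborel. z \<in> Q \<longrightarrow> borel_rep Q f z = f z"
proof -
  have Q: "Q \<in> sets borel" using \<open>open Q\<close> by simp
  have "(\<lambda>z. if z \<in> Q then f z else 0) \<in> borel_measurable lebesgue"
    using f Q by (subst borel_measurable_if) auto
  then obtain g where g: "g \<in> borel_measurable lborel" "AE z in lborel. (if z \<in> Q then f z else 0) = g z"
    using completion_ex_borel_measurable_real by blast
  have "\<exists>g. g \<in> borel_measurable borel \<and> (\<forall>z. z \<notin> Q \<longrightarrow> g z = 0) \<and> (AE z in lborel. z \<in> Q \<longrightarrow> g z = f z)"
  proof (intro exI[of _ "\<lambda>z. indicator Q z * g z"] conjI)
    show "(\<lambda>z. indicator Q z * g z) \<in> borel_measurable borel" using g(1) Q by measurable
    show "AE z in lborel. z \<in> Q \<longrightarrow> indicator Q z * g z = f z"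
      using g(2) by eventually_elim auto
  qed auto
  from someI_ex[OF this, folded borel_rep_def]
  show "borel_rep Q f \<in> borel_measurable borel" "\<And>z. z \<notin> Q \<Longrightarrow> borel_rep Q f z = 0"
    "AE z in lborel. z \<in> Q \<longrightarrow> borel_rep Q f z = f z" by auto
qed

lemma AE_lebesgue_on_iff:
  "open Q \<Longrightarrow> (AE z in lebesgue_on Q. P z) \<longleftrightarrow> (AE z in lborel. z \<in> Q \<longrightarrow> P z)"
  by (subst AE_restrict_space_iff) (auto simp: AE_completion_iff)

lemma
  fixes f g :: "'a::euclidean_space \<Rightarrow> real"
  assumes Q: "open Q" and g: "g \<in> borel_measurable borel" "\<And>z. z \<notin> Q \<Longrightarrow> g z = 0"
    and eq: "AE z in lborel. z \<in> Q \<longrightarrow> g z = f z" and f: "f \<in> borel_measurable (lebesgue_on Q)"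
  shows integral_lebesgue_on_eq: "(\<integral>z. f z \<partial>lebesgue_on Q) = (LBINT z. g z)"
    and integrable_lebesgue_on_eq: "integrable (lebesgue_on Q) f \<longleftrightarrow> integrable lborel g"
proof -
  have Qs: "Q \<inter> space lebesgue \<in> sets lebesgue" using Q by simp
  have gm: "g \<in> borel_measurable (lebesgue_on Q)"
    using g(1) by (intro measurable_restrict_space1 measurable_completion) simp
  have AE: "AE z in lebesgue_on Q. f z = g z"
    unfolding AE_lebesgue_on_iff[OF Q] using eq by eventually_elim simp
  have ind: "(\<lambda>z. indicator Q z *\<^sub>R g z) = g" using g(2) by (auto simp: fun_eq_iff indicator_def)
  have "(\<integral>z. f z \<partial>lebesgue_on Q) = (\<integral>z. g z \<partial>lebesgue_on Q)"
    by (rule integral_cong_AE[OF f gm AE])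
  also have "\<dots> = (\<integral>z. g z \<partial>lebesgue)"
    by (simp only: integral_restrict_space[OF Qs] ind)
  also have "\<dots> = (LBINT z. g z)" using g(1) by (intro integral_completion) simp
  finally show "(\<integral>z. f z \<partial>lebesgue_on Q) = (LBINT z. g z)" .
  have "integrable (lebesgue_on Q) f \<longleftrightarrow> integrable (lebesgue_on Q) g"
    by (rule integrable_cong_AE[OF f gm AE])
  also have "\<dots> \<longleftrightarrow> integrable lebesgue g"
    by (simp only: integrable_restrict_space[OF Qs] ind)
  also have "\<dots> \<longleftrightarrow> integrable lborel g" using g(1) by (intro integrable_completion) simp
  finally show "integrable (lebesgue_on Q) f \<longleftrightarrow> integrable lborel g" .
qed

lemma measurable_lebesgue_on: "h \<in> borel_measurable borel \<Longrightarrow> h \<in> borel_measurable (lebesgue_on Q)"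
  by (intro measurable_restrict_space1 measurable_completion) simp

lemma square_integrable_borel_rep:
  fixes f :: "'a::euclidean_space \<Rightarrow> real"
  assumes Q: "open Q" and f: "f \<in> L2 Q"
  shows "square_integrable lborel (borel_rep Q f)"
proof -
  have m: "f \<in> borel_measurable (lebesgue_on Q)" and i: "integrable (lebesgue_on Q) (\<lambda>z. (f z)\<^sup>2)"
    using f by (auto simp: L2_def)
  note b = borel_rep[OF Q m]
  have "integrable lborel (\<lambda>z. (borel_rep Q f z)\<^sup>2)"
  proof (rule integrable_lebesgue_on_eq[OF Q, THEN iffD1, OF _ _ _ _ i])
    show "AE z in lborel. z \<in> Q \<longrightarrow> (borel_rep Q f z)\<^sup>2 = (f z)\<^sup>2" using b(3) by eventually_elim simp
  qed (use b m in auto)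
  then show ?thesis using b by (simp add: square_integrable_def)
qed

lemma integral_borel_rep_mult:
  fixes f h :: "'a::euclidean_space \<Rightarrow> real"
  assumes Q: "open Q" and m: "f \<in> borel_measurable (lebesgue_on Q)" and h: "h \<in> borel_measurable borel"
  shows "(\<integral>z. f z * h z \<partial>lebesgue_on Q) = (LBINT z. borel_rep Q f z * h z)"
proof (rule integral_lebesgue_on_eq[OF Q])
  note b = borel_rep[OF Q m]
  show "AE z in lborel. z \<in> Q \<longrightarrow> borel_rep Q f z * h z = f z * h z" using b(3) by eventually_elim simp
  show "(\<lambda>z. f z * h z) \<in> borel_measurable (lebesgue_on Q)" using m measurable_lebesgue_on[OF h] by measurable
  show "(\<lambda>z. borel_rep Q f z * h z) \<in> borel_measurable borel" using b(1) h by measurable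
qed (use borel_rep[OF Q m] in auto)

lemma L2_linear_image:
  fixes f :: "'a::euclidean_space \<Rightarrow> 'b::euclidean_space" and A :: "'b \<Rightarrow> real"
  assumes f: "f \<in> L2 Q" and A: "linear A" and C: "\<And>x. \<bar>A x\<bar> \<le> C * norm x"
  shows "(\<lambda>z. A (f z)) \<in> L2 Q"
proof -
  have [measurable]: "A \<in> borel_measurable borel"
    using A by (intro borel_measurable_continuous_onI linear_continuous_on) (simp add: linear_conv_bounded_linear)
  have m: "f \<in> borel_measurable (lebesgue_on Q)" and i: "integrable (lebesgue_on Q) (\<lambda>z. (norm (f z))\<^sup>2)"
    using f by (auto simp: L2_def)
  have mA: "(\<lambda>z. A (f z)) \<in> borel_measurable (lebesgue_on Q)" using m by measurable
  have "integrable (lebesgue_on Q) (\<lambda>z. (A (f z))\<^sup>2)"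
  proof (rule Bochner_Integration.integrable_bound)
    show "integrable (lebesgue_on Q) (\<lambda>z. C\<^sup>2 * (norm (f z))\<^sup>2)" using i by simp
    have "(A x)\<^sup>2 \<le> C\<^sup>2 * (norm x)\<^sup>2" for x
      using power_mono[OF C[of x], of 2] by (simp add: power_mult_distrib)
    then show "AE z in lebesgue_on Q. norm ((A (f z))\<^sup>2) \<le> norm (C\<^sup>2 * (norm (f z))\<^sup>2)" by simp
  qed (use mA in measurable)
  then show ?thesis using mA by (simp add: L2_def)
qed

subsection \<open>Test functions in coordinates\<close>

lemma test_function_bounded_diff:
  assumes "\<phi> \<in> test_functions (Q :: spacetime set)"
  obtains R where "bounded_diff \<phi> (\<lambda>w z. frechet_derivative \<phi> (at z) w)" "\<And>z. norm z > R \<Longrightarrow> \<phi> z = 0"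
    "\<And>z w. z \<notin> Q \<Longrightarrow> frechet_derivative \<phi> (at z) w = 0"
    "\<And>w. square_integrable lborel (\<lambda>z. frechet_derivative \<phi> (at z) w)"
proof -
  have C: "Ck (Suc 0) \<phi>" and comp: "compact (closure {z. \<phi> z \<noteq> 0})" and sub: "closure {z. \<phi> z \<noteq> 0} \<subseteq> Q"
    using assms unfolding test_functions_def by blast+
  obtain R where R: "\<And>z. z \<in> closure {z. \<phi> z \<noteq> 0} \<Longrightarrow> norm z \<le> R"
    using compact_imp_bounded[OF comp] by (auto simp: bounded_iff)
  have supp: "\<phi> z = 0" if "norm z > R" for z
  proof (rule ccontr)
    assume "\<phi> z \<noteq> 0"
    then have "z \<in> closure {z. \<phi> z \<noteq> 0}" by (intro subsetD[OF closure_subset]) simp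
    from R[OF this] that show False by linarith
  qed
  have bd: "bounded_diff \<phi> (\<lambda>w z. frechet_derivative \<phi> (at z) w)"
    by (rule Ck_Suc_bounded_diff[OF C supp])
  have off: "frechet_derivative \<phi> (at z) w = 0" if "z \<notin> Q" for z w
  proof -
    have "(\<phi> has_derivative (\<lambda>w. 0)) (at z)"
    proof (rule has_derivative_transform_within_open[where s = "- closure {z. \<phi> z \<noteq> 0}" and f = "\<lambda>_. 0"])
      show "z \<in> - closure {z. \<phi> z \<noteq> 0}" using that sub by blast
      show "0 = \<phi> x" if "x \<in> - closure {z. \<phi> z \<noteq> 0}" for x
        using that subsetD[OF closure_subset, of x "{z. \<phi> z \<noteq> 0}"] by auto
    qed auto
    then show ?thesis using frechet_derivative_at by metis
  qed
  have "square_integrable lborel (\<lambda>z. frechet_derivative \<phi> (at z) w)" for w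
  proof -
    obtain C where "\<And>z. \<bar>frechet_derivative \<phi> (at z) w\<bar> \<le> C" using bounded_diff_deriv_bound[OF bd] by blast
    then show ?thesis
      by (intro square_integrable_bounded_support[where C = C and R = R] bounded_diff_measurable(2)[OF bd]
          bounded_diff_deriv_eq_0[OF bd supp])
  qed
  then show ?thesis using that bd supp off by blast
qed

lemma inner_vec2: "x \<bullet> y = x $ 1 * y $ 1 + x $ 2 * y $ 2" for x y :: "real ^ 2"
  by (simp add: inner_vec_def sum_2)

lemma weak_solution_lborel:
  assumes Q: "open Q" and \<phi>: "\<phi> \<in> test_functions Q" and sol: "weak_solution Q \<rho> u m"
    and L2: "\<rho> \<in> L2 Q" "\<And>i. (\<lambda>z. u z $ i) \<in> L2 Q" "\<And>i. (\<lambda>z. m z $ i) \<in> L2 Q"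
  defines "D \<equiv> \<lambda>w z. frechet_derivative \<phi> (at z) w"
  defines "I \<equiv> \<lambda>f w. LBINT z. borel_rep Q f z * D w z"
  shows "I \<rho> dir_t + I (\<lambda>z. m z $ 1) dir_x + I (\<lambda>z. m z $ 2) dir_y = 0"
    "I (\<lambda>z. u z $ 1) dir_x + I (\<lambda>z. u z $ 2) dir_y - I \<rho> dir_y = 0"
    "I (\<lambda>z. u z $ 2) dir_x + I \<rho> dir_x - I (\<lambda>z. u z $ 1) dir_y = 0"
proof -
  obtain R where bd: "bounded_diff \<phi> D" and off: "\<And>z w. z \<notin> Q \<Longrightarrow> D w z = 0" 
    and sqD: "\<And>w. square_integrable lborel (D w)"
    using test_function_bounded_diff[OF \<phi>] unfolding D_def by blast
  have D[measurable]: "D w \<in> borel_measurable borel" for w using bounded_diff_measurable[OF bd] by auto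
  have mD[measurable]: "D w \<in> borel_measurable (lebesgue_on Q)" for w by (rule measurable_lebesgue_on[OF D])
  have meas: "f \<in> borel_measurable (lebesgue_on Q)" if "f \<in> L2 Q" for f :: "spacetime \<Rightarrow> real" using that by (simp add: L2_def)
  \<comment> \<open>One formula for all three equations; the coefficient \<open>c\<close> carries
    the sign of the third term.\<close>
  have three: "(\<integral>z. f1 z * D w1 z + f2 z * D w2 z + c * (f3 z * D w3 z) \<partial>lebesgue_on Q) = I f1 w1 + I f2 w2 + c * I f3 w3"
    if f: "f1 \<in> L2 Q" "f2 \<in> L2 Q" "f3 \<in> L2 Q" for f1 f2 f3 w1 w2 w3 c
  proof -
    note [measurable] = meas[OF f(1)] meas[OF f(2)] meas[OF f(3)] borel_rep(1)[OF Q meas[OF f(1)]] borel_rep(1)[OF Q meas[OF f(2)]] borel_rep(1)[OF Q meas[OF f(3)]]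
    have "(\<integral>z. f1 z * D w1 z + f2 z * D w2 z + c * (f3 z * D w3 z) \<partial>lebesgue_on Q)
      = (LBINT z. borel_rep Q f1 z * D w1 z + borel_rep Q f2 z * D w2 z + c * (borel_rep Q f3 z * D w3 z))"
    proof (rule integral_lebesgue_on_eq[OF Q])
      show "AE z in lborel. z \<in> Q \<longrightarrow> borel_rep Q f1 z * D w1 z + borel_rep Q f2 z * D w2 z + c * (borel_rep Q f3 z * D w3 z)
         = f1 z * D w1 z + f2 z * D w2 z + c * (f3 z * D w3 z)"
        using borel_rep(3)[OF Q meas[OF f(1)]] borel_rep(3)[OF Q meas[OF f(2)]] borel_rep(3)[OF Q meas[OF f(3)]]
        by eventually_elim simp
      show "(\<lambda>z. f1 z * D w1 z + f2 z * D w2 z + c * (f3 z * D w3 z)) \<in> borel_measurable (lebesgue_on Q)"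
        by (intro borel_measurable_add borel_measurable_times borel_measurable_const meas f mD)
    qed (measurable, simp add: off)
    also have "\<dots> = I f1 w1 + I f2 w2 + c * I f3 w3"
      unfolding I_def using square_integrable_mult[OF square_integrable_borel_rep[OF Q] sqD] f by simp
    finally show ?thesis .
  qed
  have grad: "grad_x \<phi> z $ 1 = D dir_x z" "grad_x \<phi> z $ 2 = D dir_y z" "deriv_t \<phi> z = D dir_t z" for z
    by (simp_all add: grad_x_def deriv_t_def D_def)
  have "(\<integral>z. \<rho> z * deriv_t \<phi> z + m z \<bullet> grad_x \<phi> z \<partial>lebesgue_on Q) = 0"
    "(\<integral>z. (u z - vector [0, \<rho> z]) \<bullet> grad_x \<phi> z \<partial>lebesgue_on Q) = 0"
    "(\<integral>z. (u z + vector [0, \<rho> z]) $ 2 * grad_x \<phi> z $ 1 - (u z + vector [0, \<rho> z]) $ 1 * grad_x \<phi> z $ 2 \<partial>lebesgue_on Q) = 0"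
    using sol \<phi> unfolding weak_solution_def weak_transport_def weak_div_free_def weak_curl_free_def by blast+
  note eqs = this[unfolded inner_vec2 grad]
  have "(\<integral>z. \<rho> z * D dir_t z + m z $ 1 * D dir_x z + 1 * (m z $ 2 * D dir_y z) \<partial>lebesgue_on Q) = 0"
    using eqs(1) by (simp add: add.assoc)
  then show "I \<rho> dir_t + I (\<lambda>z. m z $ 1) dir_x + I (\<lambda>z. m z $ 2) dir_y = 0"
    using three[OF L2(1) L2(3) L2(3), of dir_t 1 dir_x 1 2 dir_y] by simp
  have "(\<integral>z. u z $ 1 * D dir_x z + u z $ 2 * D dir_y z + (- 1) * (\<rho> z * D dir_y z) \<partial>lebesgue_on Q) = 0"
    using eqs(2) by (simp add: algebra_simps)
  then show "I (\<lambda>z. u z $ 1) dir_x + I (\<lambda>z. u z $ 2) dir_y - I \<rho> dir_y = 0"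
    using three[OF L2(2) L2(2) L2(1), of 1 dir_x 2 dir_y "-1" dir_y] by simp
  have "(\<integral>z. u z $ 2 * D dir_x z + \<rho> z * D dir_x z + (- 1) * (u z $ 1 * D dir_y z) \<partial>lebesgue_on Q) = 0"
    using eqs(3) by (simp add: algebra_simps)
  then show "I (\<lambda>z. u z $ 2) dir_x + I \<rho> dir_x - I (\<lambda>z. u z $ 1) dir_y = 0"
    using three[OF L2(2) L2(1) L2(2), of 2 dir_x dir_x "-1" 1 dir_y] by simp
qed

subsection \<open>Stability of the separated set\<close>

text \<open>This turns out to be the hull itself. The family of inequalities is kept as the
  definition because weak limits are handled for one (a, b) at a time.\<close>

definition separated_set :: "state set" where
  "separated_set = {(\<rho>, u, m). \<forall>a b. a\<^sup>2 + b\<^sup>2 \<le> 1 \<longrightarrow> separation a b \<rho> (u $ 1) (u $ 2) (m $ 1) (m $ 2) \<le> 0}"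

lemma L2_inner:
  fixes f :: "'a::euclidean_space \<Rightarrow> 'b::euclidean_space"
  assumes "f \<in> L2 Q"
  shows "(\<lambda>z. f z \<bullet> c) \<in> L2 Q"
  by (rule L2_linear_image[OF assms, where C = "norm c"])
    (auto intro!: linearI simp: inner_left_distrib Cauchy_Schwarz_ineq2 mult.commute[of "norm c"])

lemma square_integrable_imp_L2:
  fixes c :: "'b::euclidean_space"
  assumes "open Q" and g: "square_integrable lborel g"
  shows "(\<lambda>z. g z *\<^sub>R c) \<in> L2 Q"
proof -
  have Q: "Q \<inter> space lebesgue \<in> sets lebesgue" "Q \<in> sets lebesgue" using \<open>open Q\<close> by auto
  have [measurable]: "g \<in> borel_measurable borel" using g by (simp add: square_integrable_def)
  have m: "g \<in> borel_measurable (lebesgue_on Q)" by (rule measurable_lebesgue_on) measurable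
  have "integrable lebesgue (\<lambda>z. (g z)\<^sup>2)"
    using g by (subst integrable_completion) (auto simp: square_integrable_def)
  then have "integrable (lebesgue_on Q) (\<lambda>z. (g z)\<^sup>2)"
    by (simp only: integrable_restrict_space[OF Q(1)]) (rule integrable_mult_indicator[OF Q(2)])
  then have "integrable (lebesgue_on Q) (\<lambda>z. (g z)\<^sup>2 * (norm c)\<^sup>2)" by simp
  then show ?thesis using m by (simp add: L2_def power_mult_distrib)
qed

lemma weak_convergence_component:
  fixes F :: "nat \<Rightarrow> 'a::euclidean_space \<Rightarrow> 'b::euclidean_space"
  assumes Q: "open Q" and weak: "weakly_converges_L2 Q F f" and g: "square_integrable lborel g"
  shows "(\<lambda>k. LBINT z. borel_rep Q (\<lambda>z. F k z \<bullet> c) z * g z) \<longlonglongrightarrow> (LBINT z. borel_rep Q (\<lambda>z. f z \<bullet> c) z * g z)"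
proof -
  have L2: "F k \<in> L2 Q" "f \<in> L2 Q" for k using weak by (auto simp: weakly_converges_L2_def)
  have "\<forall>g\<in>L2 Q. (\<lambda>k. \<integral>z. F k z \<bullet> g z \<partial>lebesgue_on Q) \<longlonglongrightarrow> (\<integral>z. f z \<bullet> g z \<partial>lebesgue_on Q)"
    using weak unfolding weakly_converges_L2_def by blast
  from bspec[OF this square_integrable_imp_L2[OF Q g, of c]]
  have "(\<lambda>k. \<integral>z. F k z \<bullet> (g z *\<^sub>R c) \<partial>lebesgue_on Q) \<longlonglongrightarrow> (\<integral>z. f z \<bullet> (g z *\<^sub>R c) \<partial>lebesgue_on Q)" .
  moreover have "(\<integral>z. h z \<bullet> (g z *\<^sub>R c) \<partial>lebesgue_on Q) = (LBINT z. borel_rep Q (\<lambda>z. h z \<bullet> c) z * g z)"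
    if "h \<in> L2 Q" for h
    using integral_borel_rep_mult[OF Q, of "\<lambda>z. h z \<bullet> c" g] L2_inner[OF that, of c] g
    by (simp add: L2_def square_integrable_def mult.commute)
  ultimately show ?thesis using L2 by simp
qed

text \<open>The limit solves the same linear equations, so the differences are weakly null solutions
  and each single inequality passes to the limit almost everywhere. The exceptional null set depends
  on (a, b), so the inequalities are collected over a countable family and recovered for all (a, b)
  by continuity.\<close>

theorem weakly_stable_separated_set:
  assumes "open \<Omega>" "bounded \<Omega>"
  shows "weakly_stable \<Omega> T separated_set"
  unfolding weakly_stable_def Let_def
proof (intro allI impI; elim conjE)
  define Q where "Q = \<Omega> \<times> {0<..<T}"
  fix \<rho>s us ms \<rho> u m
  assume sol: "\<forall>k. weak_solution (\<Omega> \<times> {0<..<T}) (\<rho>s k) (us k) (ms k)"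
    and inS: "\<forall>k. AE z in lebesgue_on (\<Omega> \<times> {0<..<T}). (\<rho>s k z, us k z, ms k z) \<in> separated_set"
    and weak: "weakly_converges_L2 (\<Omega> \<times> {0<..<T}) (\<lambda>k z. (\<rho>s k z, us k z, ms k z)) (\<lambda>z. (\<rho> z, u z, m z))"
  note sol = sol[folded Q_def, rule_format] and inS = inS[folded Q_def, rule_format] and weak = weak[folded Q_def]
  have Q: "open Q" "bounded Q" using assms by (auto simp: Q_def open_Times bounded_Times)
  define B where "B = borel_rep Q"
  define c1 :: state where "c1 = (1, 0, 0)"
  define c2 :: "2 \<Rightarrow> state" where "c2 i = (0, axis i 1, 0)" for i
  define c3 :: "2 \<Rightarrow> state" where "c3 i = (0, 0, axis i 1)" for i
  have L2: "(\<lambda>z. (\<rho>s k z, us k z, ms k z)) \<in> L2 Q" "(\<lambda>z. (\<rho> z, u z, m z)) \<in> L2 Q" for k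
    using weak by (auto simp: weakly_converges_L2_def)
  have comp: "\<rho>s k \<in> L2 Q" "(\<lambda>z. us k z $ i) \<in> L2 Q" "(\<lambda>z. ms k z $ i) \<in> L2 Q" 
    "\<rho> \<in> L2 Q" "(\<lambda>z. u z $ i) \<in> L2 Q" "(\<lambda>z. m z $ i) \<in> L2 Q" for k i
    using L2_inner[OF L2(1), of k c1] L2_inner[OF L2(1), of k "c2 i"] L2_inner[OF L2(1), of k "c3 i"]
      L2_inner[OF L2(2), of c1] L2_inner[OF L2(2), of "c2 i"] L2_inner[OF L2(2), of "c3 i"]
    by (simp_all add: c1_def c2_def c3_def inner_axis)
  have sqB: "square_integrable lborel (B f)" if "f \<in> L2 Q" for f
    unfolding B_def by (rule square_integrable_borel_rep[OF Q(1) that])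
  have lim: "(\<lambda>k. LBINT z. B (\<rho>s k) z * g z) \<longlonglongrightarrow> (LBINT z. B \<rho> z * g z)"
    "(\<lambda>k. LBINT z. B (\<lambda>z. us k z $ i) z * g z) \<longlonglongrightarrow> (LBINT z. B (\<lambda>z. u z $ i) z * g z)"
    "(\<lambda>k. LBINT z. B (\<lambda>z. ms k z $ i) z * g z) \<longlonglongrightarrow> (LBINT z. B (\<lambda>z. m z $ i) z * g z)"
    if "square_integrable lborel g" for g i
    using weak_convergence_component[OF Q(1) weak that, of c1] weak_convergence_component[OF Q(1) weak that, of "c2 i"]
      weak_convergence_component[OF Q(1) weak that, of "c3 i"]
    by (simp_all add: c1_def c2_def c3_def inner_axis B_def)
  have null: "(\<lambda>k. LBINT z. g z * (B (fs k) z - B f z)) \<longlonglongrightarrow> 0"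
    if g: "square_integrable lborel g" and "\<And>k. fs k \<in> L2 Q" "f \<in> L2 Q"
      and lim: "(\<lambda>k. LBINT z. B (fs k) z * g z) \<longlonglongrightarrow> (LBINT z. B f z * g z)" for g fs f
  proof -
    have "(LBINT z. g z * (B (fs k) z - B f z)) = (LBINT z. B (fs k) z * g z) - (LBINT z. B f z * g z)" for k
      using square_integrable_mult[OF sqB[OF that(2)] g, of k] square_integrable_mult[OF sqB[OF that(3)] g]
      by (simp add: right_diff_distrib mult.commute[of "g _"])
    then show ?thesis using lim by (simp add: LIM_zero_iff)
  qed
  have eqs: "(LBINT z. (B f1 z - B g1 z) * h1 z + (B f2 z - B g2 z) * h2 z + (B f3 z - B g3 z) * h3 z)
     = (LBINT z. B f1 z * h1 z) + (LBINT z. B f2 z * h2 z) + (LBINT z. B f3 z * h3 z)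
      - ((LBINT z. B g1 z * h1 z) + (LBINT z. B g2 z * h2 z) + (LBINT z. B g3 z * h3 z))"
    if "f1 \<in> L2 Q" "f2 \<in> L2 Q" "f3 \<in> L2 Q" "g1 \<in> L2 Q" "g2 \<in> L2 Q" "g3 \<in> L2 Q"
      "square_integrable lborel h1" "square_integrable lborel h2" "square_integrable lborel h3"
    for f1 f2 f3 g1 g2 g3 h1 h2 h3
    using square_integrable_mult[OF sqB[OF that(1)] that(7)] square_integrable_mult[OF sqB[OF that(2)] that(8)]
      square_integrable_mult[OF sqB[OF that(3)] that(9)] square_integrable_mult[OF sqB[OF that(4)] that(7)]
      square_integrable_mult[OF sqB[OF that(5)] that(8)] square_integrable_mult[OF sqB[OF that(6)] that(9)]
    by (simp add: left_diff_distrib)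
  \<comment> \<open>Moves the sign onto the test function, so that \<open>eqs\<close> also applies
    to the divergence and curl equations.\<close>
  have neg: "- (x - y) * c = (x - y) * - c" for x y c :: real by (simp add: algebra_simps)
  interpret weakly_null_solutions Q "\<lambda>k z. B (\<rho>s k) z - B \<rho> z" 
    "\<lambda>k z. B (\<lambda>z. us k z $ 1) z - B (\<lambda>z. u z $ 1) z" "\<lambda>k z. B (\<lambda>z. us k z $ 2) z - B (\<lambda>z. u z $ 2) z"
    "\<lambda>k z. B (\<lambda>z. ms k z $ 1) z - B (\<lambda>z. m z $ 1) z" "\<lambda>k z. B (\<lambda>z. ms k z $ 2) z - B (\<lambda>z. m z $ 2) z"
  proof (unfold_locales, goal_cases)
    \<comment> \<open>Goals 11 to 13 are the three equations, after five goals on square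
      integrability and five on weak convergence. For a fixed test function each equation is linear,
      so it survives in the weak limit and holds for the difference.\<close>
    case (11 k \<phi>)
    define D where "D w z = frechet_derivative \<phi> (at z) w" for w z
    have sqD: "square_integrable lborel (D w)" for w
      using test_function_bounded_diff[OF 11] unfolding D_def by blast
    have 0: "(LBINT z. B (\<rho>s k) z * D dir_t z) + (LBINT z. B (\<lambda>z. ms k z $ 1) z * D dir_x z) 
        + (LBINT z. B (\<lambda>z. ms k z $ 2) z * D dir_y z) = 0" for k
      using weak_solution_lborel(1)[OF Q(1) 11 sol comp(1-3)] by (simp add: B_def D_def)
    have "(\<lambda>k. (LBINT z. B (\<rho>s k) z * D dir_t z) + (LBINT z. B (\<lambda>z. ms k z $ 1) z * D dir_x z) 
        + (LBINT z. B (\<lambda>z. ms k z $ 2) z * D dir_y z)) \<longlonglongrightarrow> (LBINT z. B \<rho> z * D dir_t z) 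
        + (LBINT z. B (\<lambda>z. m z $ 1) z * D dir_x z) + (LBINT z. B (\<lambda>z. m z $ 2) z * D dir_y z)"
      by (intro tendsto_add lim sqD)
    from this[unfolded 0] have 1: "(LBINT z. B \<rho> z * D dir_t z)
        + (LBINT z. B (\<lambda>z. m z $ 1) z * D dir_x z) + (LBINT z. B (\<lambda>z. m z $ 2) z * D dir_y z) = 0"
      by (simp add: LIMSEQ_const_iff)
    show ?case
      unfolding D_def[symmetric] eqs[OF comp(1,3,3,4,6,6) sqD sqD sqD] 0 1 by simp
  next
    case (12 k \<phi>)
    define D where "D w z = frechet_derivative \<phi> (at z) w" for w z
    have sqD: "square_integrable lborel (D w)" for w
      using test_function_bounded_diff[OF 12] unfolding D_def by blast
    have 0: "(LBINT z. B (\<lambda>z. us k z $ 1) z * D dir_x z) + (LBINT z. B (\<lambda>z. us k z $ 2) z * D dir_y z)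
        + (LBINT z. B (\<rho>s k) z * - D dir_y z) = 0" for k
      using weak_solution_lborel(2)[OF Q(1) 12 sol comp(1-3)] by (simp add: B_def D_def)
    have "(\<lambda>k. (LBINT z. B (\<lambda>z. us k z $ 1) z * D dir_x z) + (LBINT z. B (\<lambda>z. us k z $ 2) z * D dir_y z)
        + (LBINT z. B (\<rho>s k) z * - D dir_y z)) \<longlonglongrightarrow> (LBINT z. B (\<lambda>z. u z $ 1) z * D dir_x z) 
        + (LBINT z. B (\<lambda>z. u z $ 2) z * D dir_y z) + (LBINT z. B \<rho> z * - D dir_y z)"
      by (intro tendsto_add lim sqD square_integrable_uminus)
    from this[unfolded 0] have 1: "(LBINT z. B (\<lambda>z. u z $ 1) z * D dir_x z)
        + (LBINT z. B (\<lambda>z. u z $ 2) z * D dir_y z) + (LBINT z. B \<rho> z * - D dir_y z) = 0"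
      by (simp add: LIMSEQ_const_iff)
    show ?case
      unfolding D_def[symmetric] neg eqs[OF comp(2,2,1,5,5,4) sqD sqD square_integrable_uminus[OF sqD]] 0 1 by simp
  next
    case (13 k \<phi>)
    define D where "D w z = frechet_derivative \<phi> (at z) w" for w z
    have sqD: "square_integrable lborel (D w)" for w
      using test_function_bounded_diff[OF 13] unfolding D_def by blast
    have 0: "(LBINT z. B (\<lambda>z. us k z $ 2) z * D dir_x z) + (LBINT z. B (\<rho>s k) z * D dir_x z)
        + (LBINT z. B (\<lambda>z. us k z $ 1) z * - D dir_y z) = 0" for k
      using weak_solution_lborel(3)[OF Q(1) 13 sol comp(1-3)] by (simp add: B_def D_def)
    have "(\<lambda>k. (LBINT z. B (\<lambda>z. us k z $ 2) z * D dir_x z) + (LBINT z. B (\<rho>s k) z * D dir_x z)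
        + (LBINT z. B (\<lambda>z. us k z $ 1) z * - D dir_y z)) \<longlonglongrightarrow> (LBINT z. B (\<lambda>z. u z $ 2) z * D dir_x z)
        + (LBINT z. B \<rho> z * D dir_x z) + (LBINT z. B (\<lambda>z. u z $ 1) z * - D dir_y z)"
      by (intro tendsto_add lim sqD square_integrable_uminus)
    from this[unfolded 0] have 1: "(LBINT z. B (\<lambda>z. u z $ 2) z * D dir_x z)
        + (LBINT z. B \<rho> z * D dir_x z) + (LBINT z. B (\<lambda>z. u z $ 1) z * - D dir_y z) = 0"
      by (simp add: LIMSEQ_const_iff)
    show ?case
      unfolding D_def[symmetric] neg eqs[OF comp(2,1,2,5,4,5) sqD sqD square_integrable_uminus[OF sqD]] 0 1 by simp
  qed (intro square_integrable_diff sqB comp null lim; assumption)+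
  have meas: "f \<in> borel_measurable (lebesgue_on Q)" if "f \<in> L2 Q" for f :: "spacetime \<Rightarrow> real" using that by (simp add: L2_def)
  have rep: "AE z in lborel. z \<in> Q \<longrightarrow> B f z = f z" if "f \<in> L2 Q" for f
    unfolding B_def by (rule borel_rep(3)[OF Q(1) meas[OF that]])
  have each: "AE z in lborel. z \<in> Q \<longrightarrow> separation a b (B \<rho> z) (B (\<lambda>z. u z $ 1) z) (B (\<lambda>z. u z $ 2) z) (B (\<lambda>z. m z $ 1) z) (B (\<lambda>z. m z $ 2) z) \<le> 0"
    if ab: "a\<^sup>2 + b\<^sup>2 \<le> 1" for a b
  proof (rule weak_limit_separation_nonpos[OF Q ab])
    fix k
    show "AE z in lborel. z \<in> Q \<longrightarrow> separation a b (B \<rho> z + (B (\<rho>s k) z - B \<rho> z))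
        (B (\<lambda>z. u z $ 1) z + (B (\<lambda>z. us k z $ 1) z - B (\<lambda>z. u z $ 1) z)) (B (\<lambda>z. u z $ 2) z + (B (\<lambda>z. us k z $ 2) z - B (\<lambda>z. u z $ 2) z))
        (B (\<lambda>z. m z $ 1) z + (B (\<lambda>z. ms k z $ 1) z - B (\<lambda>z. m z $ 1) z)) (B (\<lambda>z. m z $ 2) z + (B (\<lambda>z. ms k z $ 2) z - B (\<lambda>z. m z $ 2) z)) \<le> 0"
      using inS[of k, unfolded AE_lebesgue_on_iff[OF Q(1)]] rep[OF comp(1)[of k]] rep[OF comp(2)[of k 1]] rep[OF comp(2)[of k 2]]
        rep[OF comp(3)[of k 1]] rep[OF comp(3)[of k 2]]
      by eventually_elim (use ab in \<open>auto simp: separated_set_def\<close>)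
  qed (intro sqB comp)+
  obtain D :: "(real \<times> real) set" where D: "countable D" "\<And>X. open X \<Longrightarrow> X \<noteq> {} \<Longrightarrow> \<exists>d\<in>D. d \<in> X"
    using countable_dense_setE by metis
  define D1 where "D1 = {d \<in> D. (fst d)\<^sup>2 + (snd d)\<^sup>2 \<le> 1}"
  have "countable D1" using D(1) by (auto simp: D1_def)
  have "AE z in lborel. \<forall>d\<in>D1. z \<in> Q \<longrightarrow> separation (fst d) (snd d) (B \<rho> z) (B (\<lambda>z. u z $ 1) z) (B (\<lambda>z. u z $ 2) z) (B (\<lambda>z. m z $ 1) z) (B (\<lambda>z. m z $ 2) z) \<le> 0"
    using each by (subst AE_ball_countable[OF \<open>countable D1\<close>]) (auto simp: D1_def)
  then have "AE z in lborel. z \<in> Q \<longrightarrow> (\<rho> z, u z, m z) \<in> separated_set"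
    using rep[OF comp(4)] rep[OF comp(5)[of 1]] rep[OF comp(5)[of 2]] rep[OF comp(6)[of 1]] rep[OF comp(6)[of 2]]
  proof eventually_elim
    case (elim z)
    define S where "S d = separation (fst d) (snd d) (\<rho> z) (u z $ 1) (u z $ 2) (m z $ 1) (m z $ 2)" for d
    have contS: "continuous_on UNIV S" unfolding S_def separation_def by (auto intro!: continuous_intros)
    show ?case
    proof
      assume "z \<in> Q"
      with elim have le: "S d \<le> 0" if "d \<in> D1" for d using that by (simp add: S_def)
      have "S (a, b) \<le> 0" if ab: "a\<^sup>2 + b\<^sup>2 \<le> 1" for a b
      proof (rule ccontr)
        assume "\<not> ?thesis"
        then have pos: "S (a, b) > 0" by simp
        define X where "X = {d. S d > 0} \<inter> {d. (fst d)\<^sup>2 + (snd d)\<^sup>2 < 1}"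
        have "open X"
          unfolding X_def by (intro open_Int open_Collect_less continuous_intros contS continuous_on_const)
        \<comment> \<open>A point (a, b) on the unit circle is pulled slightly inwards: this shows
          that \<open>X\<close>, an open subset of the disc, is nonempty, and the dense set has a
          point in it.\<close>
        have "((\<lambda>s. S (s * a, s * b)) \<longlongrightarrow> S (1 * a, 1 * b)) (at_left 1)"
        proof -
          have "continuous_on UNIV (\<lambda>s. S (s * a, s * b))"
            by (rule continuous_on_compose2[OF contS]) (auto intro!: continuous_intros)
          then have "isCont (\<lambda>s. S (s * a, s * b)) 1" by (simp add: continuous_on_eq_continuous_at)
          then show ?thesis by (simp add: isCont_def filterlim_at_split)
        qed
        then have "\<forall>\<^sub>F s in at_left 1. S (s * a, s * b) > 0" using pos by (intro order_tendstoD(1)) auto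
        moreover have "\<forall>\<^sub>F s in at_left (1::real). s \<in> {0<..<1}" by (rule eventually_at_left_real) simp
        ultimately have "\<forall>\<^sub>F s in at_left 1. S (s * a, s * b) > 0 \<and> s \<in> {0<..<1}" by (rule eventually_conj)
        then obtain s where s: "S (s * a, s * b) > 0" "0 < s" "s < 1"
          using eventually_happens'[of "at_left (1::real)"] by (auto simp: trivial_limit_at_left_real)
        have "(s * a)\<^sup>2 + (s * b)\<^sup>2 = s\<^sup>2 * (a\<^sup>2 + b\<^sup>2)" by (simp add: power_mult_distrib algebra_simps)
        also have "\<dots> \<le> s\<^sup>2 * 1" using ab by (intro mult_left_mono) auto
        also have "\<dots> < 1" using s by (simp add: power_less_one_iff)
        finally have "(s * a, s * b) \<in> X" using s by (simp add: X_def)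
        with D(2)[OF \<open>open X\<close>] obtain d where "d \<in> D" "d \<in> X" by blast
        with le[of d] show False by (auto simp: X_def D1_def)
      qed
      then show "(\<rho> z, u z, m z) \<in> separated_set" by (simp add: separated_set_def S_def)
    qed
  qed
  then show "AE z in lebesgue_on (\<Omega> \<times> {0<..<T}). (\<rho> z, u z, m z) \<in> separated_set"
    unfolding Q_def[symmetric] AE_lebesgue_on_iff[OF Q(1)] .
qed

section \<open>The hull\<close>

lemma convex_on_quadratic:
  fixes A B C :: real
  assumes "A \<ge> 0"
  shows "convex_on UNIV (\<lambda>s. A * s\<^sup>2 + B * s + C)"
proof (rule convex_onI)
  fix t x y :: real assume t: "0 < t" "t < 1"
  have "(1 - t) * (A * x\<^sup>2 + B * x + C) + t * (A * y\<^sup>2 + B * y + C)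
      - (A * ((1 - t) *\<^sub>R x + t *\<^sub>R y)\<^sup>2 + B * ((1 - t) *\<^sub>R x + t *\<^sub>R y) + C) = A * (t * (1 - t)) * (x - y)\<^sup>2"
    by (simp add: power2_eq_square algebra_simps)
  also have "\<dots> \<ge> 0" using t assms by simp
  finally show "A * ((1 - t) *\<^sub>R x + t *\<^sub>R y)\<^sup>2 + B * ((1 - t) *\<^sub>R x + t *\<^sub>R y) + C
      \<le> (1 - t) * (A * x\<^sup>2 + B * x + C) + t * (A * y\<^sup>2 + B * y + C)" by simp
qed simp

lemma norm_square_vec2: "(norm u)\<^sup>2 = (u $ 1)\<^sup>2 + (u $ 2)\<^sup>2" for u :: "real ^ 2"
  unfolding power2_norm_eq_inner inner_vec2 by (simp only: power2_eq_square)

text \<open>Along \<open>w\<close> the function is a quadratic polynomial in \<open>s\<close> with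
  leading coefficient (\<rho>^2 - \<rho> k) / 2, where k = a u_1 + b u_2. Cauchy-Schwarz, the disc
  and the cone give |k| <= |u| = |\<rho>|, so it is nonnegative.\<close>

lemma Lambda_convex_separation:
  assumes ab: "a\<^sup>2 + b\<^sup>2 \<le> 1"
  shows "Lambda_convex wave_cone (\<lambda>(\<rho>, u, m). separation a b \<rho> (u $ 1) (u $ 2) (m $ 1) (m $ 2))"
  unfolding Lambda_convex_def
proof (intro allI ballI)
  fix w0 w :: state assume w: "w \<in> wave_cone"
  obtain \<rho>0 u0 m0 where w0: "w0 = (\<rho>0, u0, m0)" by (metis prod.collapse)
  obtain \<rho> u m where w': "w = (\<rho>, u, m)" by (metis prod.collapse)
  have cone: "\<rho>\<^sup>2 = (u $ 1)\<^sup>2 + (u $ 2)\<^sup>2"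
    using w by (simp add: w' wave_cone_def norm_square_vec2)
  define k where "k = a * u $ 1 + b * u $ 2"
  have "k\<^sup>2 \<le> k\<^sup>2 + (a * u $ 2 - b * u $ 1)\<^sup>2" by simp
  also have "\<dots> = (a\<^sup>2 + b\<^sup>2) * \<rho>\<^sup>2" unfolding cone k_def by (simp add: power2_eq_square algebra_simps)
  also have "\<dots> \<le> 1 * \<rho>\<^sup>2" using ab by (intro mult_right_mono) auto
  finally have "k\<^sup>2 \<le> \<rho>\<^sup>2" by simp
  moreover have "0 \<le> (\<rho> - k)\<^sup>2" by simp
  ultimately have A: "(\<rho>\<^sup>2 - \<rho> * k) / 2 \<ge> 0" by (simp add: power2_eq_square algebra_simps)
  have "(case w0 + s *\<^sub>R w of (\<rho>, u, m) \<Rightarrow> separation a b \<rho> (u $ 1) (u $ 2) (m $ 1) (m $ 2))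
      = (\<rho>\<^sup>2 - \<rho> * k) / 2 * s\<^sup>2 + (a * m $ 1 + b * m $ 2 - \<rho> * (a * u0 $ 1 + b * u0 $ 2) / 2 - \<rho>0 * k / 2 + \<rho> * \<rho>0) * s
        + separation a b \<rho>0 (u0 $ 1) (u0 $ 2) (m0 $ 1) (m0 $ 2)" for s
    by (simp add: w0 w' separation_def k_def power2_eq_square field_simps)
  with convex_on_quadratic[OF A]
  show "convex_on UNIV (\<lambda>s. case w0 + s *\<^sub>R w of (\<rho>, u, m) \<Rightarrow> separation a b \<rho> (u $ 1) (u $ 2) (m $ 1) (m $ 2))"
    by simp
qed

text \<open>The choice (a, b) = 0 isolates the density; the unit vector along
  \<open>m - (\<rho> / 2) *\<^sub>R u\<close> turns the inner product into the norm.\<close>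

lemma separated_set_bounds:
  assumes "(\<rho>, u, m) \<in> separated_set"
  shows "\<rho>\<^sup>2 \<le> 1" "norm (m - (\<rho> / 2) *\<^sub>R u) \<le> (1 - \<rho>\<^sup>2) / 2"
proof -
  define x where "x = m - (\<rho> / 2) *\<^sub>R u"
  have sep: "a * x $ 1 + b * x $ 2 \<le> (1 - \<rho>\<^sup>2) / 2" if "a\<^sup>2 + b\<^sup>2 \<le> 1" for a b
  proof -
    have "separation a b \<rho> (u $ 1) (u $ 2) (m $ 1) (m $ 2) \<le> 0"
      using assms that by (simp add: separated_set_def)
    then show ?thesis by (simp add: separation_def x_def field_simps)
  qed
  show "\<rho>\<^sup>2 \<le> 1" using sep[of 0 0] by simp
  have n: "(norm x)\<^sup>2 = (x $ 1)\<^sup>2 + (x $ 2)\<^sup>2"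
    by (rule norm_square_vec2)
  show "norm (m - (\<rho> / 2) *\<^sub>R u) \<le> (1 - \<rho>\<^sup>2) / 2"
  proof (cases "norm x = 0")
    case True
    then show ?thesis using \<open>\<rho>\<^sup>2 \<le> 1\<close> by (simp add: x_def)
  next
    case False
    have "(x $ 1 / norm x)\<^sup>2 + (x $ 2 / norm x)\<^sup>2 = ((x $ 1)\<^sup>2 + (x $ 2)\<^sup>2) / (norm x)\<^sup>2"
      by (simp add: power_divide add_divide_distrib)
    also have "\<dots> = 1" using False unfolding n[symmetric] by simp
    finally have "(x $ 1 / norm x) * x $ 1 + (x $ 2 / norm x) * x $ 2 \<le> (1 - \<rho>\<^sup>2) / 2" by (intro sep) simp
    also have "(x $ 1 / norm x) * x $ 1 + (x $ 2 / norm x) * x $ 2 = ((x $ 1)\<^sup>2 + (x $ 2)\<^sup>2) / norm x"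
      by (simp add: power2_eq_square add_divide_distrib)
    also have "\<dots> = norm x" using False unfolding n[symmetric] by (simp add: power2_eq_square)
    finally show ?thesis by (simp add: x_def)
  qed
qed

lemma constraint_set_separation:
  assumes "(\<rho>, u, m) \<in> constraint_set"
  shows "separation a b \<rho> (u $ 1) (u $ 2) (m $ 1) (m $ 2) = 0"
proof -
  have "\<rho>\<^sup>2 = 1" "m = (\<rho> / 2) *\<^sub>R u" using assms by (auto simp: constraint_set_def abs_square_eq_1)
  then show ?thesis by (simp add: separation_def field_simps)
qed

lemma Lambda_hull_subset_separated_set: "Lambda_hull wave_cone constraint_set \<subseteq> separated_set"
proof
  fix z assume z: "z \<in> Lambda_hull wave_cone constraint_set"
  obtain \<rho> u m where z': "z = (\<rho>, u, m)" by (metis prod.collapse)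
  have "separation a b \<rho> (u $ 1) (u $ 2) (m $ 1) (m $ 2) \<le> 0" if "a\<^sup>2 + b\<^sup>2 \<le> 1" for a b
  proof (rule ccontr)
    assume "\<not> ?thesis"
    then have "\<exists>f. Lambda_convex wave_cone f \<and> (\<forall>y\<in>constraint_set. f y \<le> 0) \<and> f z > 0"
      using Lambda_convex_separation[OF that] 
      by (intro exI[of _ "\<lambda>(\<rho>, u, m). separation a b \<rho> (u $ 1) (u $ 2) (m $ 1) (m $ 2)"])
        (auto simp: z' constraint_set_separation)
    with z show False unfolding Lambda_hull_def by blast
  qed
  then show "z \<in> separated_set" by (simp add: separated_set_def z')
qed

text \<open>Points with \<open>\<bar>m - \<rho> u / 2\<bar> = (1 - \<rho>\<^sup>2) / 2\<close> lie on a segment in the wave cone between the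
  sheets \<open>\<rho> = -1\<close> and \<open>\<rho> = 1\<close> of the constraint set; the other points of the separated set lie
  between two such points which differ only in \<open>m\<close>.\<close>

lemma separated_set_subset:
  assumes K: "constraint_set \<subseteq> S"
    and seg: "\<And>z w t. z \<in> S \<Longrightarrow> z + w \<in> S \<Longrightarrow> w \<in> wave_cone \<Longrightarrow> 0 \<le> t \<Longrightarrow> t \<le> 1 \<Longrightarrow> z + t *\<^sub>R w \<in> S"
  shows "separated_set \<subseteq> S"
proof
  have boundary: "(\<rho>, u, (\<rho> / 2) *\<^sub>R u + ((1 - \<rho>\<^sup>2) / 2) *\<^sub>R e) \<in> S" if \<rho>: "\<rho>\<^sup>2 \<le> 1" and e: "norm e = 1" for \<rho> and u e :: "real ^ 2"
  proof -
    \<comment> \<open>The endpoints have densities -1 and 1. Their velocities differ by 2 e, of norm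
      2 as the cone demands, and are placed so that the parameter (1 + \<rho>) / 2 returns to
      \<open>(\<rho>, u)\<close>. Since \<open>m\<close> is a product on the constraint set,
      interpolating it leaves the excess (1 - \<rho>^2) / 2 in direction e.\<close>
    define z :: state where "z = (-1, u - (1 + \<rho>) *\<^sub>R e, (- 1 / 2) *\<^sub>R (u - (1 + \<rho>) *\<^sub>R e))"
    define w :: state where "w = (2, 2 *\<^sub>R e, u - \<rho> *\<^sub>R e)"
    have zw: "z + w = (1, u + (1 - \<rho>) *\<^sub>R e, (1 / 2) *\<^sub>R (u + (1 - \<rho>) *\<^sub>R e))"
      by (auto simp: z_def w_def vec_eq_iff field_simps)
    have zK: "z \<in> constraint_set" by (simp add: z_def constraint_set_def)
    have zwK: "z + w \<in> constraint_set" unfolding zw by (simp add: constraint_set_def)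
    have wc: "w \<in> wave_cone" using e by (simp add: w_def wave_cone_def)
    have "\<bar>\<rho>\<bar> \<le> 1" using \<rho> by (simp add: abs_square_le_1)
    then have "0 \<le> (1 + \<rho>) / 2" "(1 + \<rho>) / 2 \<le> 1" by auto
    then have "z + ((1 + \<rho>) / 2) *\<^sub>R w \<in> S"
      by (rule seg[OF subsetD[OF K zK] subsetD[OF K zwK] wc])
    also have "z + ((1 + \<rho>) / 2) *\<^sub>R w = (\<rho>, u, (\<rho> / 2) *\<^sub>R u + ((1 - \<rho>\<^sup>2) / 2) *\<^sub>R e)"
      by (auto simp: z_def w_def vec_eq_iff field_simps power2_eq_square)
    finally show ?thesis .
  qed
  fix y assume "y \<in> separated_set"
  moreover obtain \<rho> u m where y: "y = (\<rho>, u, m)" by (metis prod.collapse)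
  ultimately have b: "\<rho>\<^sup>2 \<le> 1" "norm (m - (\<rho> / 2) *\<^sub>R u) \<le> (1 - \<rho>\<^sup>2) / 2"
    using separated_set_bounds by auto
  define h where "h = (1 - \<rho>\<^sup>2) / 2"
  define x where "x = m - (\<rho> / 2) *\<^sub>R u"
  have x: "norm x \<le> h" using b by (simp add: x_def h_def)
  \<comment> \<open>For \<open>x = 0\<close> any unit vector will do, as its coefficient
    \<open>norm x\<close> vanishes.\<close>
  obtain e where e: "norm e = 1" "x = norm x *\<^sub>R e"
  proof (cases "x = 0")
    case True
    then show ?thesis using that[of "axis 1 1"] by simp
  next
    case False
    then show ?thesis using that[of "x /\<^sub>R norm x"] by simp
  qed
  have m: "m = (\<rho> / 2) *\<^sub>R u + norm x *\<^sub>R e" using e by (simp add: x_def)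
  show "y \<in> S"
  proof (cases "h = 0")
    case True
    then have "norm x = 0" using x by (metis norm_ge_zero antisym)
    then show ?thesis using boundary[OF b(1) e(1), of u] True by (simp add: y m h_def)
  next
    case False
    then have h: "h > 0" using x norm_ge_zero[of x] by linarith
    \<comment> \<open>The segment runs from offset - h e to offset h e with density and velocity
      fixed, a direction trivially in the cone. The offset \<open>norm x\<close> times e sits at the
      fraction (norm x + h) / (2 h).\<close>
    define z :: state where "z = (\<rho>, u, (\<rho> / 2) *\<^sub>R u + h *\<^sub>R (- e))"
    define w :: state where "w = (0, 0, (2 * h) *\<^sub>R e)"
    have "z \<in> S" using boundary[OF b(1), of "- e" u] e by (simp add: z_def h_def)
    moreover have "z + w \<in> S" 
    proof -
      have "z + w = (\<rho>, u, (\<rho> / 2) *\<^sub>R u + h *\<^sub>R e)" by (auto simp: z_def w_def vec_eq_iff)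
      then show ?thesis using boundary[OF b(1) e(1), of u] by (simp add: h_def)
    qed
    moreover have "w \<in> wave_cone" by (simp add: w_def wave_cone_def)
    ultimately have "z + ((norm x + h) / (2 * h)) *\<^sub>R w \<in> S" using x h by (intro seg) auto
    also have "z + ((norm x + h) / (2 * h)) *\<^sub>R w = y"
      using h by (auto simp: z_def w_def y m vec_eq_iff field_simps)
    finally show ?thesis .
  qed
qed

text \<open>For an admissible \<open>f\<close> the set where \<open>f\<close> is nonpositive
  contains the constraint set and, by convexity along the cone, the wave-cone segments between its
  points, so \<open>separated_set_subset\<close> applies to it.\<close>

lemma separated_set_subset_Lambda_hull: "separated_set \<subseteq> Lambda_hull wave_cone constraint_set"
proof
  fix y assume y: "y \<in> separated_set"
  have "f y \<le> 0" if f: "Lambda_convex wave_cone f" "\<forall>y\<in>constraint_set. f y \<le> 0" for f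
  proof -
    have "separated_set \<subseteq> {y. f y \<le> 0}"
    proof (rule separated_set_subset)
      fix z w :: state and t :: real
      assume zw: "z \<in> {y. f y \<le> 0}" "z + w \<in> {y. f y \<le> 0}" "w \<in> wave_cone" "0 \<le> t" "t \<le> 1"
      have "convex_on UNIV (\<lambda>s. f (z + s *\<^sub>R w))" using f(1) zw(3) unfolding Lambda_convex_def by blast
      from convex_onD[OF this zw(4,5), of 0 1] have "f (z + t *\<^sub>R w) \<le> (1 - t) * f z + t * f (z + w)" by simp
      also have "\<dots> \<le> 0" using zw by (intro add_nonpos_nonpos mult_nonneg_nonpos) auto
      finally show "z + t *\<^sub>R w \<in> {y. f y \<le> 0}" by simp
    qed (use f in auto)
    with y show ?thesis by auto
  qed
  then show "y \<in> Lambda_hull wave_cone constraint_set" by (force simp: Lambda_hull_def)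
qed

lemma Lambda_hull_eq: "Lambda_hull wave_cone constraint_set = separated_set"
  using Lambda_hull_subset_separated_set separated_set_subset_Lambda_hull by blast

section \<open>Stable sets contain wave-cone segments\<close>

text \<open>Two values only, so that a state oscillating with it takes just the two endpoints of a
  segment. \<open>Suc k\<close> avoids the zero frequency.\<close>

definition square_wave :: "nat \<Rightarrow> spacetime \<Rightarrow> spacetime \<Rightarrow> real" where
  "square_wave k \<zeta> z = (if even \<lfloor>real (Suc k) * (\<zeta> \<bullet> z)\<rfloor> then 1 else - 1)"

lemma measurable_square_wave [measurable]: "square_wave k \<zeta> \<in> borel_measurable borel"
  unfolding square_wave_def by measurable

lemma abs_square_wave: "\<bar>square_wave k \<zeta> z\<bar> = 1"
  by (simp add: square_wave_def)

lemma square_wave_invariant: "\<zeta> \<bullet> w = 0 \<Longrightarrow> square_wave k \<zeta> (z + s *\<^sub>R w) = square_wave k \<zeta> z"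
  by (simp add: square_wave_def inner_add_right)

lemma square_wave_shift:
  assumes "\<zeta> \<noteq> 0"
  shows "square_wave k \<zeta> (z + (1 / (real (Suc k) * (norm \<zeta>)\<^sup>2)) *\<^sub>R \<zeta>) = - square_wave k \<zeta> z"
proof -
  have "real (Suc k) * (\<zeta> \<bullet> (z + (1 / (real (Suc k) * (norm \<zeta>)\<^sup>2)) *\<^sub>R \<zeta>)) = real (Suc k) * (\<zeta> \<bullet> z) + 1"
    using assms by (simp add: inner_add_right distrib_left power2_norm_eq_inner del: of_nat_Suc)
  moreover have "\<lfloor>real (Suc k) * (\<zeta> \<bullet> z) + 1\<rfloor> = \<lfloor>real (Suc k) * (\<zeta> \<bullet> z)\<rfloor> + 1" by linarith
  ultimately show ?thesis by (simp only: square_wave_def) auto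
qed

text \<open>Shifting by the half period \<open>T k\<close> reverses the sign, so twice the integral
  against \<open>G\<close> is the integral against \<open>G\<close> minus its translate by
  \<open>T k\<close>. As \<open>T k\<close> tends to zero, the continuity of translations in L2
  makes this small.\<close>

lemma square_wave_weakly_null:
  assumes "\<zeta> \<noteq> 0" and G: "square_integrable lborel G" and R: "\<And>z. norm z > R \<Longrightarrow> G z = 0"
  shows "(\<lambda>k. LBINT z. square_wave k \<zeta> z * G z) \<longlonglongrightarrow> 0"
proof -
  have [measurable]: "G \<in> borel_measurable borel" using G by (simp add: square_integrable_def)
  define T where "T k = (1 / (real (Suc k) * (norm \<zeta>)\<^sup>2)) *\<^sub>R \<zeta>" for k
  define D where "D = R + 1 / norm \<zeta>"
  have T0: "T \<longlonglongrightarrow> 0"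
  proof -
    have "(\<lambda>k. (inverse (real (Suc k)) * (1 / (norm \<zeta>)\<^sup>2)) *\<^sub>R \<zeta>) \<longlonglongrightarrow> (0 * (1 / (norm \<zeta>)\<^sup>2)) *\<^sub>R \<zeta>"
      by (intro tendsto_intros LIMSEQ_inverse_real_of_nat)
    then show ?thesis by (simp add: T_def[abs_def] divide_inverse mult.commute)
  qed
  have Tn: "norm (T k) \<le> 1 / norm \<zeta>" for k
  proof -
    have "norm (T k) = (1 / real (Suc k)) * (1 / norm \<zeta>)" using assms(1) by (simp add: T_def power2_eq_square)
    also have "\<dots> \<le> 1 * (1 / norm \<zeta>)" by (intro mult_right_mono) auto
    finally show ?thesis by simp
  qed
  have sqG: "square_integrable lborel (\<lambda>z. G z - G (z + T k))" for k
    by (intro square_integrable_diff square_integrable_shift G)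
  have lim: "(\<lambda>k. LBINT z. (G z - G (z + T k))\<^sup>2) \<longlonglongrightarrow> 0"
  proof (rule LIMSEQ_I)
    fix e :: real assume "e > 0"
    obtain d where d: "d > 0" "\<And>h. norm h < d \<Longrightarrow> (LBINT x. (G (x + h) - G x)\<^sup>2) < e"
      using L2_translation_continuous[OF G \<open>e > 0\<close>] by blast
    obtain N where "\<And>k. k \<ge> N \<Longrightarrow> norm (T k) < d" using LIMSEQ_D[OF T0 d(1)] by auto
    moreover have "(\<lambda>z. (G z - G (z + T k))\<^sup>2) = (\<lambda>z. (G (z + T k) - G z)\<^sup>2)" for k
      by (rule ext) (rule power2_commute)
    ultimately show "\<exists>N. \<forall>k\<ge>N. norm ((LBINT z. (G z - G (z + T k))\<^sup>2) - 0) < e"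
      using d(2) by (intro exI[of _ N]) simp
  qed
  \<comment> \<open>The wave itself has infinite energy. It is cut off to a ball of radius
    \<open>D\<close> outside which \<open>G\<close> and all its translates by \<open>T k\<close>
    vanish, so no integral changes.\<close>
  define f :: "nat \<Rightarrow> spacetime \<Rightarrow> real" where "f k z = indicator (cball 0 D) z * square_wave k \<zeta> z" for k z
  have fm[measurable]: "f k \<in> borel_measurable borel" for k
    unfolding f_def by (intro borel_measurable_times borel_measurable_indicator measurable_square_wave) auto
  have fb: "\<bar>f k z\<bar> \<le> indicator (cball 0 D) z" for k z by (simp add: f_def indicator_def abs_square_wave)
  have sqf: "square_integrable lborel (f k)" for k
    by (rule square_integrable_bounded_support[where C = 1 and R = D]) 
      (use fb in \<open>auto intro: order_trans[OF fb] simp: indicator_def f_def abs_square_wave\<close>)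
  have "(LBINT z. (f k z)\<^sup>2) \<le> (\<integral>z. indicator (cball 0 D) z \<partial>(lborel :: spacetime measure))" for k
  proof (rule integral_mono)
    show "(f k z)\<^sup>2 \<le> indicator (cball 0 D) z" for z
      by (auto simp: f_def indicator_def abs_square_eq_1[THEN iffD2, OF abs_square_wave])
  qed (use sqf in \<open>auto simp: square_integrable_def intro!: integrable_real_indicator emeasure_bounded_finite\<close>)
  from integral_mult_tendsto_0[OF sqf sqG this lim]
  have "(\<lambda>k. LBINT z. f k z * (G z - G (z + T k))) \<longlonglongrightarrow> 0" .
  moreover have "(LBINT z. f k z * (G z - G (z + T k))) = 2 * (LBINT z. square_wave k \<zeta> z * G z)" for k
  proof -
    have supp: "square_wave k \<zeta> z * G z = f k z * G z" "square_wave k \<zeta> z * G (z + T k) = f k z * G (z + T k)" for z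
    proof -
      have "norm z \<le> D" if "G z \<noteq> 0" 
      proof -
        have "norm z \<le> R" using R[of z] that by (meson not_le)
        then show ?thesis by (simp add: D_def add_increasing2)
      qed
      moreover have "norm z \<le> D" if "G (z + T k) \<noteq> 0"
      proof -
        have "norm (z + T k) \<le> R" using R[of "z + T k"] that by (meson not_le)
        then show ?thesis using Tn[of k] norm_diff_ineq[of z "T k"] unfolding D_def by linarith
      qed
      ultimately show "square_wave k \<zeta> z * G z = f k z * G z" "square_wave k \<zeta> z * G (z + T k) = f k z * G (z + T k)"
        by (auto simp: f_def indicator_def)
    qed
    have "(LBINT z. square_wave k \<zeta> z * G (z + T k)) = (LBINT z. - (square_wave k \<zeta> (z + T k) * G (z + T k)))"
      unfolding T_def square_wave_shift[OF assms(1)] by simp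
    also have "\<dots> = - (LBINT z. square_wave k \<zeta> z * G z)"
      using integral_shift[of "\<lambda>z. square_wave k \<zeta> z * G z" "T k"] by simp
    finally show ?thesis
      using square_integrable_mult[OF sqf G, of k] square_integrable_mult[OF sqf square_integrable_shift[OF G], of k "T k"]
      unfolding supp by (simp add: right_diff_distrib)
  qed
  ultimately show ?thesis using tendsto_mult_left_iff[of "2::real"] tendsto_mult[OF tendsto_const, of _ 0 _ "1/2"] by fastforce
qed

text \<open>A plane wave with normal \<open>\<zeta>\<close> and amplitude \<open>(\<rho>, u, m)\<close> solves the linear system when \<open>\<zeta>\<close> is
  orthogonal to the three space-time fields below; they are the transport, divergence and
  rotated curl fields of the amplitude.\<close>

definition wave_normal :: "spacetime \<Rightarrow> state \<Rightarrow> bool" where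
  "wave_normal \<zeta> w \<longleftrightarrow> (case w of (\<rho>, u, m) \<Rightarrow> \<zeta> \<bullet> (m, \<rho>) = 0 \<and> \<zeta> \<bullet> (u - vector [0, \<rho>], 0) = 0
     \<and> \<zeta> \<bullet> (vector [u $ 2 + \<rho>, - u $ 1], 0) = 0)"

text \<open>Divergence and curl are two linear equations for the two spatial components of \<zeta>,
  with determinant \<rho>^2 - |u|^2, so the cone is exactly the condition for a nonzero solution. If
  \<rho> is nonzero, the time component solves the transport condition; if \<rho> = 0, then u = 0
  and it suffices to be orthogonal to m in space.\<close>

lemma wave_normal_exists:
  assumes "w \<in> wave_cone"
  obtains \<zeta> where "\<zeta> \<noteq> 0" "wave_normal \<zeta> w"
proof -
  obtain \<rho> u m where w: "w = (\<rho>, u, m)" by (metis prod.collapse)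
  have cone: "\<rho>\<^sup>2 = (u $ 1)\<^sup>2 + (u $ 2)\<^sup>2"
    using assms by (simp add: w wave_cone_def norm_square_vec2)
  have *: "wave_normal (vector [x, y], t) w \<longleftrightarrow> x * m $ 1 + y * m $ 2 + t * \<rho> = 0
      \<and> x * u $ 1 + y * (u $ 2 - \<rho>) = 0 \<and> x * (u $ 2 + \<rho>) - y * u $ 1 = 0" for x y t
    by (simp add: wave_normal_def w inner_vec2)
  have nz: "(vector [x, y] :: real ^ 2, t) \<noteq> 0" if "x \<noteq> 0 \<or> y \<noteq> 0" for x y t :: real
    using that by (auto simp: zero_prod_def vec_eq_iff forall_2)
  consider "\<rho> = 0" "m $ 1 \<noteq> 0 \<or> m $ 2 \<noteq> 0" | "\<rho> = 0" "m $ 1 = 0" "m $ 2 = 0" 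
    | "\<rho> \<noteq> 0" "\<rho> - u $ 2 \<noteq> 0 \<or> u $ 1 \<noteq> 0" | "\<rho> \<noteq> 0" "u $ 2 = \<rho>" "u $ 1 = 0" by auto
  then show ?thesis
  proof cases
    case 1
    then have "u $ 1 = 0" "u $ 2 = 0" using cone by (auto simp: add_nonneg_eq_0_iff)
    with 1 show ?thesis by (intro that[of "(vector [- m $ 2, m $ 1], 0)"] nz) (auto simp: *)
  next
    case 2
    then have "u $ 1 = 0" "u $ 2 = 0" using cone by (auto simp: add_nonneg_eq_0_iff)
    with 2 show ?thesis by (intro that[of "(vector [1, 0], 0)"] nz) (auto simp: *)
  next
    \<comment> \<open>The kernel vector of the two-by-two system; it degenerates exactly when u =
      (0, \<rho>), which is the last case.\<close>
    case 3
    show ?thesis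
    proof (rule that[of "(vector [\<rho> - u $ 2, u $ 1], - ((\<rho> - u $ 2) * m $ 1 + u $ 1 * m $ 2) / \<rho>)"])
      show "wave_normal (vector [\<rho> - u $ 2, u $ 1], - ((\<rho> - u $ 2) * m $ 1 + u $ 1 * m $ 2) / \<rho>) w"
      proof -
        have "(\<rho> - u $ 2) * (u $ 2 + \<rho>) - u $ 1 * u $ 1 = 0" "(\<rho> - u $ 2) * u $ 1 + u $ 1 * (u $ 2 - \<rho>) = 0"
          using cone by (simp_all add: power2_eq_square algebra_simps)
        then show ?thesis unfolding * using 3(1) by simp
      qed
    qed (use 3 in \<open>auto intro!: nz\<close>)
  next
    case 4
    then show ?thesis by (intro that[of "(vector [0, 1], - m $ 2 / \<rho>)"] nz) (auto simp: *)
  qed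
qed

lemma wave_cone_scaleR: "w \<in> wave_cone \<Longrightarrow> s *\<^sub>R w \<in> wave_cone"
  by (auto simp: wave_cone_def abs_mult power_mult_distrib)

section \<open>Plane waves as weak solutions\<close>

lemma bounded_borel_L2_Linfty:
  fixes f :: "'a::euclidean_space \<Rightarrow> 'b::euclidean_space"
  assumes Q: "open Q" "bounded Q" and f: "f \<in> borel_measurable borel" and C: "\<And>z. norm (f z) \<le> C"
  shows "f \<in> L2 Q" "f \<in> Linfty Q"
proof -
  have m: "f \<in> borel_measurable (lebesgue_on Q)"
    using f by (intro measurable_restrict_space1 measurable_completion) simp
  interpret finite_measure "lebesgue_on Q" by (rule finite_measure_lebesgue_on) (rule lmeasurable_open[OF Q(2,1)])
  have "(norm (f z))\<^sup>2 \<le> C\<^sup>2" for z using C[of z] by (intro power_mono) auto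
  then have "integrable (lebesgue_on Q) (\<lambda>z. (norm (f z))\<^sup>2)"
    using m by (intro integrable_const_bound[where B = "C\<^sup>2"]) auto
  then show "f \<in> L2 Q" "f \<in> Linfty Q" using m C by (auto simp: L2_def Linfty_def)
qed

lemma L2_integrable:
  fixes g :: "'a::euclidean_space \<Rightarrow> 'b::euclidean_space"
  assumes Q: "open Q" "bounded Q" and g: "g \<in> L2 Q"
  shows "integrable (lebesgue_on Q) g"
proof -
  interpret finite_measure "lebesgue_on Q" by (rule finite_measure_lebesgue_on) (rule lmeasurable_open[OF Q(2,1)])
  show ?thesis
  proof (rule Bochner_Integration.integrable_bound)
    show "integrable (lebesgue_on Q) (\<lambda>z. 1 + (norm (g z))\<^sup>2)" using g by (simp add: L2_def)
    have "norm (g z) \<le> 1 + (norm (g z))\<^sup>2" for z using abs_mult_le_weighted_squares[of 1 "norm (g z)" 1] by simp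
    then show "AE z in lebesgue_on Q. norm (g z) \<le> norm (1 + (norm (g z))\<^sup>2)" by (intro AE_I2) (simp add: abs_of_nonneg)
  qed (use g in \<open>simp add: L2_def\<close>)
qed

text \<open>Each equation tests the derivative of \<phi> in a fixed space-time direction: the
  transport, divergence or rotated curl field of the amplitude. The profile \<open>h\<close> is
  constant in that direction, so \<open>h\<close> times this derivative integrates to zero; the
  constant background contributes a plain derivative, which does so as well.\<close>

lemma plane_wave_weak_solution:
  assumes Q: "open Q" and h: "h \<in> borel_measurable borel" "\<And>z. \<bar>h z\<bar> \<le> 1"
    and inv: "\<And>v z s. \<zeta> \<bullet> v = 0 \<Longrightarrow> h (z + s *\<^sub>R v) = h z" and normal: "wave_normal \<zeta> (\<rho>, u, m)"
  shows "weak_solution Q (\<lambda>z. \<rho>0 + h z * \<rho>) (\<lambda>z. u0 + h z *\<^sub>R u) (\<lambda>z. m0 + h z *\<^sub>R m)"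
proof -
  have test: "(\<integral>z. frechet_derivative \<phi> (at z) v0 + h z * frechet_derivative \<phi> (at z) v \<partial>lebesgue_on Q) = 0"
    if \<phi>: "\<phi> \<in> test_functions Q" and v: "\<zeta> \<bullet> v = 0" for \<phi> v0 v
  proof -
    define D where "D w z = frechet_derivative \<phi> (at z) w" for w z
    obtain R where R: "bounded_diff \<phi> (\<lambda>w z. frechet_derivative \<phi> (at z) w)" "\<And>z. norm z > R \<Longrightarrow> \<phi> z = 0"
      "\<And>z w. z \<notin> Q \<Longrightarrow> frechet_derivative \<phi> (at z) w = 0"
      "\<And>w. square_integrable lborel (\<lambda>z. frechet_derivative \<phi> (at z) w)"
      by (rule test_function_bounded_diff[OF \<phi>], rule that)
    note bd = R(1)[folded D_def] and supp = R(2) and off = R(3)[folded D_def]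
    have D: "D w \<in> borel_measurable borel" for w using bounded_diff_measurable[OF bd] by auto
    have int: "integrable lborel (\<lambda>z. k z * D w z)" if "k \<in> borel_measurable borel" "\<And>z. \<bar>k z\<bar> \<le> 1" for k w
    proof -
      obtain C where C: "C \<ge> 0" "\<And>z. \<bar>D w z\<bar> \<le> C" using bounded_diff_deriv_bound[OF bd] by blast
      have "\<bar>k z * D w z\<bar> \<le> 1 * C" for z unfolding abs_mult by (intro mult_mono C that) auto
      then show ?thesis
        by (intro integrable_bounded_support[where C = C and R = R] borel_measurable_times D that)
          (auto simp: bounded_diff_deriv_eq_0[OF bd supp])
    qed
    have m: "(\<lambda>z. D v0 z + h z * D v z) \<in> borel_measurable borel"
      by (intro borel_measurable_add borel_measurable_times D h)
    have "(\<integral>z. D v0 z + h z * D v z \<partial>lebesgue_on Q) = (LBINT z. D v0 z + h z * D v z)"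
      by (rule integral_lebesgue_on_eq[OF Q m _ _ measurable_lebesgue_on[OF m]]) (auto simp: off)
    also have "\<dots> = (LBINT z. 1 * D v0 z) + (LBINT z. h z * D v z)"
      using int[of "\<lambda>_. 1" v0] int[OF h, of v] by simp
    also have "(LBINT z. 1 * D v0 z) = 0"
      by (rule integral_directional_derivative_eq_0[OF bd supp, where H = 1]) auto
    also have "(LBINT z. h z * D v z) = 0"
      by (rule integral_directional_derivative_eq_0[OF bd supp h(1) h(2) inv[OF v]])
    finally show ?thesis by (simp add: D_def)
  qed
  have lin: "frechet_derivative \<phi> (at z) (x, t) = x $ 1 * grad_x \<phi> z $ 1 + x $ 2 * grad_x \<phi> z $ 2 + t * deriv_t \<phi> z"
    if \<phi>: "\<phi> \<in> test_functions Q" for \<phi> z x t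
  proof -
    obtain R where bd: "bounded_diff \<phi> (\<lambda>w z. frechet_derivative \<phi> (at z) w)"
      using test_function_bounded_diff[OF \<phi>] by blast
    note l = bounded_diff_linear[OF bd, of z]
    have "(x, t) = (x $ 1) *\<^sub>R dir_x + (x $ 2) *\<^sub>R dir_y + t *\<^sub>R dir_t"
      by (simp add: vec_eq_iff forall_2 axis_def)
    then have "frechet_derivative \<phi> (at z) (x, t) = frechet_derivative \<phi> (at z) ((x $ 1) *\<^sub>R dir_x + (x $ 2) *\<^sub>R dir_y + t *\<^sub>R dir_t)"
      by simp
    also have "\<dots> = x $ 1 * frechet_derivative \<phi> (at z) dir_x + x $ 2 * frechet_derivative \<phi> (at z) dir_y + t * frechet_derivative \<phi> (at z) dir_t"
      by (simp only: linear_add[OF l] linear_cmul[OF l] real_scaleR_def)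
    finally show ?thesis by (simp add: grad_x_def deriv_t_def)
  qed
  have n: "\<zeta> \<bullet> (m, \<rho>) = 0" "\<zeta> \<bullet> (u - vector [0, \<rho>], 0) = 0" "\<zeta> \<bullet> (vector [u $ 2 + \<rho>, - u $ 1], 0) = 0"
    using normal by (auto simp: wave_normal_def)
  show ?thesis
    unfolding weak_solution_def weak_transport_def weak_div_free_def weak_curl_free_def
  proof (intro conjI ballI)
    fix \<phi> assume \<phi>: "\<phi> \<in> test_functions Q"
    show "(\<integral>z. (\<rho>0 + h z * \<rho>) * deriv_t \<phi> z + (m0 + h z *\<^sub>R m) \<bullet> grad_x \<phi> z \<partial>lebesgue_on Q) = 0"
      using test[OF \<phi> n(1), of "(m0, \<rho>0)"] by (simp add: lin[OF \<phi>] inner_vec2 algebra_simps)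
    show "(\<integral>z. (u0 + h z *\<^sub>R u - vector [0, \<rho>0 + h z * \<rho>]) \<bullet> grad_x \<phi> z \<partial>lebesgue_on Q) = 0"
      using test[OF \<phi> n(2), of "(u0 - vector [0, \<rho>0], 0)"] by (simp add: lin[OF \<phi>] inner_vec2 algebra_simps)
    show "(\<integral>z. (u0 + h z *\<^sub>R u + vector [0, \<rho>0 + h z * \<rho>]) $ 2 * grad_x \<phi> z $ 1
        - (u0 + h z *\<^sub>R u + vector [0, \<rho>0 + h z * \<rho>]) $ 1 * grad_x \<phi> z $ 2 \<partial>lebesgue_on Q) = 0"
      using test[OF \<phi> n(3), of "(vector [u0 $ 2 + \<rho>0, - u0 $ 1], 0)"] by (simp add: lin[OF \<phi>] algebra_simps)
  qed
qed

section \<open>Closedness and segments of a stable set\<close>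

locale stable_set =
  fixes \<Omega> :: "(real ^ 2) set" and T :: real and S :: "state set"
  assumes \<Omega>: "open \<Omega>" "\<Omega> \<noteq> {}" "bounded \<Omega>" and T: "T > 0" and stable: "weakly_stable \<Omega> T S"
begin

abbreviation "Q \<equiv> \<Omega> \<times> {0<..<T}"

lemma open_Q: "open Q" using \<Omega> by (auto intro: open_Times)
lemma bounded_Q: "bounded Q" using \<Omega> by (auto intro: bounded_Times)

text \<open>Serves both uses of stability: \<open>h = 0\<close> with varying \<open>C k\<close> for
  closedness, and a square wave about a fixed state for midpoints. Membership almost everywhere
  becomes membership because the limit is constant and \<open>Q\<close> is not a null set.\<close>

lemma stable_plane_waves:
  assumes h: "\<And>k. h k \<in> borel_measurable borel" "\<And>k z. \<bar>h k z\<bar> \<le> 1"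
    and inv: "\<And>k v z s. \<zeta> \<bullet> v = 0 \<Longrightarrow> h k (z + s *\<^sub>R v) = h k z" and normal: "wave_normal \<zeta> w"
    and inS: "\<And>k z. C k + h k z *\<^sub>R w \<in> S"
    and weak: "\<And>g. g \<in> L2 Q \<Longrightarrow> (\<lambda>k. \<integral>z. (C k + h k z *\<^sub>R w) \<bullet> g z \<partial>lebesgue_on Q) \<longlonglongrightarrow> (\<integral>z. c \<bullet> g z \<partial>lebesgue_on Q)"
  shows "c \<in> S"
proof -
  obtain \<rho> u m where w: "w = (\<rho>, u, m)" by (metis prod.collapse)
  obtain \<rho>0 u0 m0 where c: "c = (\<rho>0, u0, m0)" by (metis prod.collapse)
  define \<rho>C uC mC where "\<rho>C k = fst (C k)" and "uC k = fst (snd (C k))" and "mC k = snd (snd (C k))" for k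
  define \<rho>s where "\<rho>s k z = \<rho>C k + h k z * \<rho>" for k z
  define us where "us k z = uC k + h k z *\<^sub>R u" for k z
  define ms where "ms k z = mC k + h k z *\<^sub>R m" for k z
  have F: "(\<rho>s k z, us k z, ms k z) = C k + h k z *\<^sub>R w" for k z
    by (simp add: \<rho>s_def us_def ms_def \<rho>C_def uC_def mC_def w prod_eq_iff)
  have bd: "norm (a + h k z *\<^sub>R b) \<le> norm a + norm b" for a b :: "'b::real_normed_vector" and k z
  proof -
    have "norm (h k z *\<^sub>R b) \<le> 1 * norm b" unfolding norm_scaleR by (intro mult_right_mono h) auto
    then show ?thesis using norm_triangle_ineq[of a "h k z *\<^sub>R b"] by simp
  qed
  have m: "(\<lambda>z. a + h k z *\<^sub>R b) \<in> borel_measurable borel" for a b :: "'b::euclidean_space" and k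
    by (intro borel_measurable_add borel_measurable_scaleR borel_measurable_const h)
  note LL = bounded_borel_L2_Linfty[OF open_Q bounded_Q m bd]
  have reg: "\<rho>s k \<in> Linfty Q" "us k \<in> L2 Q" "ms k \<in> L2 Q" "(\<lambda>z. (\<rho>s k z, us k z, ms k z)) \<in> L2 Q" for k
    using LL(2)[of "\<rho>C k" k \<rho>] LL(1)[of "uC k" k u] LL(1)[of "mC k" k m] LL(1)[of "C k" k w]
    unfolding F by (simp_all add: \<rho>s_def[abs_def] us_def[abs_def] ms_def[abs_def])
  have "weak_solution Q (\<rho>s k) (us k) (ms k)" for k
    using plane_wave_weak_solution[OF open_Q h(1,2) inv normal[unfolded w]] by (simp add: \<rho>s_def[abs_def] us_def[abs_def] ms_def[abs_def])
  moreover have "weakly_converges_L2 Q (\<lambda>k z. (\<rho>s k z, us k z, ms k z)) (\<lambda>z. (\<rho>0, u0, m0))"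
    using weak reg(4) bounded_borel_L2_Linfty(1)[OF open_Q bounded_Q, of "\<lambda>_. c" "norm c"]
    unfolding weakly_converges_L2_def F c[symmetric] by auto
  moreover have "AE z in lebesgue_on Q. (\<rho>s k z, us k z, ms k z) \<in> S" for k
    unfolding F using inS by simp
  ultimately have "AE z in lebesgue_on Q. (\<rho>0, u0, m0) \<in> S"
    using stable[unfolded weakly_stable_def Let_def, rule_format, of \<rho>s us ms "\<lambda>_. \<rho>0" "\<lambda>_. u0" "\<lambda>_. m0"] reg
    by blast
  then have AE: "AE z in lborel. z \<in> Q \<longrightarrow> c \<in> S" unfolding AE_lebesgue_on_iff[OF open_Q] c .
  show "c \<in> S"
  proof (rule ccontr)
    assume "c \<notin> S"
    with AE have "AE z in lborel. z \<notin> Q" by (auto elim: eventually_mono)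
    then have "Q \<in> null_sets lborel" using open_Q by (subst AE_iff_null_sets) auto
    then have "negligible Q" by (simp add: negligible_iff_null_sets null_sets_completionI)
    moreover have "Q \<noteq> {}" using \<Omega> T by auto
    ultimately show False using open_not_negligible[OF open_Q] by simp
  qed
qed

lemma closed_stable: "closed S"
  unfolding closed_sequential_limits
proof (intro allI impI; elim conjE)
  fix C c assume C: "\<forall>k. C k \<in> S" and lim: "C \<longlonglongrightarrow> c"
  show "c \<in> S"
  proof (rule stable_plane_waves[where h = "\<lambda>_ _. 0" and w = 0 and \<zeta> = 0 and C = C])
    fix g :: "spacetime \<Rightarrow> state" assume "g \<in> L2 Q"
    then have "integrable (lebesgue_on Q) g" by (rule L2_integrable[OF open_Q bounded_Q])
    then show "(\<lambda>k. \<integral>z. (C k + 0 *\<^sub>R 0) \<bullet> g z \<partial>lebesgue_on Q) \<longlonglongrightarrow> (\<integral>z. c \<bullet> g z \<partial>lebesgue_on Q)"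
      using lim by (auto intro!: tendsto_intros)
  qed (use C in \<open>auto simp: wave_normal_def\<close>)
qed

lemma stable_midpoint:
  assumes "w \<in> wave_cone" "c + w \<in> S" "c - w \<in> S"
  shows "c \<in> S"
proof -
  obtain \<zeta> where \<zeta>: "\<zeta> \<noteq> 0" "wave_normal \<zeta> w" using wave_normal_exists[OF assms(1)] by blast
  obtain R where R: "\<And>z. z \<in> Q \<Longrightarrow> norm z \<le> R" using bounded_Q by (auto simp: bounded_iff)
  show ?thesis
  proof (rule stable_plane_waves[where h = "\<lambda>k. square_wave k \<zeta>" and w = w and \<zeta> = \<zeta> and C = "\<lambda>_. c"])
    show "c + square_wave k \<zeta> z *\<^sub>R w \<in> S" for k z
      using assms by (simp add: square_wave_def)
    fix g :: "spacetime \<Rightarrow> state" assume g: "g \<in> L2 Q"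
    define f where "f z = g z \<bullet> w" for z
    have f: "f \<in> L2 Q" and cg: "(\<lambda>z. g z \<bullet> c) \<in> L2 Q" unfolding f_def by (rule L2_inner[OF g])+
    have fm: "f \<in> borel_measurable (lebesgue_on Q)" using f by (simp add: L2_def)
    have "square_integrable (lebesgue_on Q) f" using f by (simp add: L2_def square_integrable_def)
    then have "square_integrable (lebesgue_on Q) (\<lambda>z. square_wave k \<zeta> z * f z)" for k
      by (rule square_integrable_bounded_mult[where C = 1]) (auto simp: abs_square_wave intro!: measurable_lebesgue_on)
    then have hf: "(\<lambda>z. square_wave k \<zeta> z * f z) \<in> L2 Q" for k by (simp add: L2_def square_integrable_def)
    have "(\<integral>z. (c + square_wave k \<zeta> z *\<^sub>R w) \<bullet> g z \<partial>lebesgue_on Q)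
        = (\<integral>z. c \<bullet> g z \<partial>lebesgue_on Q) + (LBINT z. square_wave k \<zeta> z * borel_rep Q f z)" for k
    proof -
      have "(\<integral>z. (c + square_wave k \<zeta> z *\<^sub>R w) \<bullet> g z \<partial>lebesgue_on Q)
          = (\<integral>z. g z \<bullet> c + square_wave k \<zeta> z * f z \<partial>lebesgue_on Q)"
      proof -
        have "(c + square_wave k \<zeta> z *\<^sub>R w) \<bullet> g z = g z \<bullet> c + square_wave k \<zeta> z * f z" for z
          by (simp add: f_def inner_add_left inner_commute[of "g z"])
        then show ?thesis by (simp only:)
      qed
      also have "\<dots> = (\<integral>z. g z \<bullet> c \<partial>lebesgue_on Q) + (\<integral>z. square_wave k \<zeta> z * f z \<partial>lebesgue_on Q)"
        by (rule Bochner_Integration.integral_add[OF L2_integrable[OF open_Q bounded_Q cg] L2_integrable[OF open_Q bounded_Q hf]])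
      also have "(\<integral>z. square_wave k \<zeta> z * f z \<partial>lebesgue_on Q) = (LBINT z. square_wave k \<zeta> z * borel_rep Q f z)"
        using integral_borel_rep_mult[OF open_Q fm measurable_square_wave, of k \<zeta>] by (simp add: mult.commute)
      finally show ?thesis by (simp only: inner_commute[of c])
    qed
    moreover have "(\<lambda>k. LBINT z. square_wave k \<zeta> z * borel_rep Q f z) \<longlonglongrightarrow> 0"
    proof (rule square_wave_weakly_null[OF \<zeta>(1) square_integrable_borel_rep[OF open_Q f]])
      fix z :: spacetime assume "norm z > R"
      then have "z \<notin> Q" using R[of z] by linarith
      then show "borel_rep Q f z = 0" by (rule borel_rep(2)[OF open_Q fm])
    qed
    ultimately show "(\<lambda>k. \<integral>z. (c + square_wave k \<zeta> z *\<^sub>R w) \<bullet> g z \<partial>lebesgue_on Q) \<longlonglongrightarrow> (\<integral>z. c \<bullet> g z \<partial>lebesgue_on Q)"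
      using tendsto_add[OF tendsto_const, of "\<lambda>k. LBINT z. square_wave k \<zeta> z * borel_rep Q f z" 0] by simp
  qed (use \<zeta> in \<open>auto simp: abs_square_wave square_wave_invariant\<close>)
qed

text \<open>The parameters \<open>s\<close> with \<open>z + s *\<^sub>R w\<close> in
  \<open>S\<close> form a closed set that contains midpoints. If \<open>t\<close> were missing, the
  largest such parameter in [0, t] and the smallest in [t, 1] would have their midpoint in the gap
  between them.\<close>

lemma stable_segment:
  assumes z: "z \<in> S" "z + w \<in> S" and w: "w \<in> wave_cone" and t: "0 \<le> t" "t \<le> 1"
  shows "z + t *\<^sub>R w \<in> S"
proof (rule ccontr)
  define A where "A = {s. z + s *\<^sub>R w \<in> S}"
  assume "z + t *\<^sub>R w \<notin> S"
  then have tA: "t \<notin> A" by (simp add: A_def)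
  have "closed ((\<lambda>s. z + s *\<^sub>R w) -` S)"
    by (intro continuous_closed_vimage closed_stable) (auto intro!: continuous_intros)
  then have clA: "closed A" by (simp add: A_def vimage_def)
  have mid: "(a + b) / 2 \<in> A" if "a \<in> A" "b \<in> A" for a b
  proof -
    have "z + ((a + b) / 2) *\<^sub>R w \<in> S"
    proof (rule stable_midpoint[OF wave_cone_scaleR[OF w, of "(b - a) / 2"]])
      have e: "z + ((a + b) / 2) *\<^sub>R w + ((b - a) / 2) *\<^sub>R w = z + ((a + b) / 2 + (b - a) / 2) *\<^sub>R w"
        "z + ((a + b) / 2) *\<^sub>R w - ((b - a) / 2) *\<^sub>R w = z + ((a + b) / 2 - (b - a) / 2) *\<^sub>R w"
        by (simp_all only: scaleR_add_left scaleR_diff_left add.assoc add_diff_eq)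
      have "(a + b) / 2 + (b - a) / 2 = b" "(a + b) / 2 - (b - a) / 2 = a" by (auto simp: field_simps)
      with that show "z + ((a + b) / 2) *\<^sub>R w + ((b - a) / 2) *\<^sub>R w \<in> S" "z + ((a + b) / 2) *\<^sub>R w - ((b - a) / 2) *\<^sub>R w \<in> S"
        unfolding e by (simp_all only: A_def mem_Collect_eq)
    qed
    then show ?thesis by (simp add: A_def)
  qed
  define L where "L = A \<inter> {0..t}"
  define U where "U = A \<inter> {t..1}"
  have "0 \<in> L" "1 \<in> U" using z t by (auto simp: L_def U_def A_def)
  moreover have bdd: "bdd_above L" "bdd_below U" by (auto simp: L_def U_def bdd_above_Int2 bdd_below_Int2)
  moreover have "closed L" "closed U" using clA by (auto simp: L_def U_def)
  ultimately have "Sup L \<in> L" "Inf U \<in> U" by (auto intro!: closed_contains_Sup closed_contains_Inf)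
  then have LU: "Sup L \<in> A" "Inf U \<in> A" "Sup L < t" "t < Inf U" "0 \<le> Sup L" "Inf U \<le> 1"
    using tA by (auto simp: L_def U_def less_le)
  define c where "c = (Sup L + Inf U) / 2"
  have "c \<in> A" unfolding c_def by (rule mid[OF LU(1,2)])
  show False
  proof (cases "c \<le> t")
    case True
    then have "c \<in> L" using \<open>c \<in> A\<close> LU by (auto simp: L_def c_def)
    then have "c \<le> Sup L" by (rule cSup_upper[OF _ bdd(1)])
    then show False using LU by (simp add: c_def)
  next
    case False
    then have "c \<in> U" using \<open>c \<in> A\<close> LU by (auto simp: U_def c_def)
    then have "Inf U \<le> c" by (rule cInf_lower[OF _ bdd(2)])
    then show False using LU by (simp add: c_def)
  qed
qed

end

theorem proposition2p4:
  fixes \<Omega> :: "(real ^ 2) set" and T :: real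
  assumes "open \<Omega>" and "connected \<Omega>" and "\<Omega> \<noteq> {}" and "bounded \<Omega>" and "T > 0"
  shows "weakly_stable \<Omega> T (Lambda_hull wave_cone constraint_set) \<and>
         constraint_set \<subseteq> Lambda_hull wave_cone constraint_set \<and>
         (\<forall>S. constraint_set \<subseteq> S \<and> weakly_stable \<Omega> T S
               \<longrightarrow> Lambda_hull wave_cone constraint_set \<subseteq> S)"
proof (intro conjI allI impI)
  show "weakly_stable \<Omega> T (Lambda_hull wave_cone constraint_set)"
    unfolding Lambda_hull_eq by (rule weakly_stable_separated_set) fact+
  show "constraint_set \<subseteq> Lambda_hull wave_cone constraint_set"
    unfolding Lambda_hull_def by force
  fix S assume S: "constraint_set \<subseteq> S \<and> weakly_stable \<Omega> T S"
  interpret stable_set \<Omega> T S using assms S by unfold_locales auto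
  show "Lambda_hull wave_cone constraint_set \<subseteq> S"
    unfolding Lambda_hull_eq by (rule separated_set_subset) (use S stable_segment in auto)
qed


end
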